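(* For $i\in\{1,2\}$ let $G_i=F_{k_i}^{W_i}(K_{n_i})$ be a $k_i$-fan graph of $K_{n_i}$ on the set $W_i\subseteq[n_i]$, with $n_i\ge 2$ and $k_i\ge 1$, let $f_i$ be a leaf of $G_i$ whose neighbor $v_i$ satisfies $\deg_{G_i}(v_i)\ge 2$, and let $G=(G_1,f_1)*(G_2,f_2)$. For $i\in\{1,2\}$ let $W_i=W_{i,1}\sqcup\cdots\sqcup W_{i,k_i}$ be the partition of $W_i$ defining $G_i$, indexed so that $v_i\in W_{i,1}$. Let $$T_i=\max\{|W_{i,1}|,|W_{i,2}|,\ldots,|W_{i,k_i}|\},\qquad T'_i=\max\{|W_{i,1}|-1,|W_{i,2}|,\ldots,|W_{i,k_i}|\}$$ for $i\in\{1,2\}$, and let $t=|\{i\in\{1,2\} : T'_i\ne T_i-1\}|$. Then $$\operatorname{depth}(S_G/I_G)=\operatorname{depth}(S_{G_1}/I_{G_1})+\operatorname{depth}(S_{G_2}/I_{G_2})-s,$$ where $s=0$ if $t=0$, and $s=1$ otherwise.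
   Context: $\mathbb{K}$ is a field; $[n]=\{1,\dots,n\}$. For a finite simple graph $H$, $S_H=\mathbb{K}[x_u:u\in V(H)]$ and $I_H=(x_ux_v : \{u,v\}\in E(H))\subset S_H$ is the edge ideal. For a finitely generated graded $S$-module $M$, $\operatorname{depth}(M)=\min\{i : \operatorname{Ext}^i_S(\mathbb{K},M)\ne 0\}$. A leaf is a vertex of degree $1$. Fan graphs: let $K_n$ be the complete graph on $[n]$. Given $U=\{u_1,\dots,u_r\}\subseteq[n]$ (with a chosen ordering), suppose that for each $i\in[r]$ a new complete graph $K_{a_i}$ on $a_i>i$ vertices is attached to $K_n$ in such a way that $V(K_n)\cap V(K_{a_i})=\{u_1,\dots,u_i\}$ (the new vertices of different attached cliques are pairwise distinct). The resulting graph is said to be obtained by adding a fan to $K_n$ on $U$, and $\{K_{a_1},\dots,K_{a_r}\}$ is the branch of that fan on $U$. If $W\subseteq[n]$ and $W=W_1\sqcup\cdots\sqcup W_k$ is a partition into nonempty subsets, a $k$-fan graph $F_k^W(K_n)$ of $K_n$ on $W$ is a graph obtained from $K_n$ by adding a fan on each $W_i$. The $*$ operation: let $G_1,G_2$ be (vertex-disjoint) graphs, and for $i=1,2$ let $f_i$ be a leaf of $G_i$ with neighbor $v_i$, $\deg_{G_i}(v_i)\ge 2$. Then $(G_1,f_1)*(G_2,f_2)$ is the graph obtained from $G_1$ and $G_2$ by identifying the vertices $f_1$ and $f_2$. *)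

theory Defs
  imports
    "HOL-Algebra.Module"
    "HOL-Algebra.QuotRing"
    "HOL-Library.Poly_Mapping"
    "HOL-Library.Disjoint_Sets"
begin

section \<open>Finite simple graphs\<close>

record 'v graph =
  gverts :: "'v set"
  gedges :: "'v set set"

definition clique_edges :: "'v set \<Rightarrow> 'v set set" where
  "clique_edges C = {{u, v} |u v. u \<in> C \<and> v \<in> C \<and> u \<noteq> v}"

definition vdegree :: "'v graph \<Rightarrow> 'v \<Rightarrow> nat" where
  "vdegree H v = card {e \<in> gedges H. v \<in> e}"

definition is_leaf :: "'v graph \<Rightarrow> 'v \<Rightarrow> bool" where
  "is_leaf H v \<longleftrightarrow> v \<in> gverts H \<and> vdegree H v = 1"

text \<open>For vertex-disjoint graphs: the vertex \<open>f2\<close> of \<open>H2\<close> is identified with the vertex \<open>f1\<close>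
  of \<open>H1\<close>, the latter being kept as the name of the common vertex.\<close>

definition star_op :: "'v graph \<Rightarrow> 'v \<Rightarrow> 'v graph \<Rightarrow> 'v \<Rightarrow> 'v graph" where
  "star_op H1 f1 H2 f2 =
    (let \<phi> = (\<lambda>x. if x = f2 then f1 else x)
     in \<lparr>gverts = gverts H1 \<union> \<phi> ` gverts H2, gedges = gedges H1 \<union> (`) \<phi> ` gedges H2\<rparr>)"


section \<open>Fan graphs\<close>

text \<open>\<open>N\<close> is the vertex set of the complete graph \<open>K\<^sub>n\<close>. The list \<open>us = [u\<^sub>1, \<dots>, u\<^sub>r]\<close> is the chosen
  ordering of the set on which the fan is added, and \<open>C i\<close> (for \<open>1 \<le> i \<le> r\<close>) is the vertex set of the
  attached clique \<open>K\<close> on \<open>a\<^sub>i = card (C i)\<close> vertices.\<close>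

definition fan_branch :: "'v set \<Rightarrow> 'v list \<Rightarrow> (nat \<Rightarrow> 'v set) \<Rightarrow> bool" where
  "fan_branch N us C \<longleftrightarrow>
     distinct us \<and> set us \<subseteq> N \<and>
     (\<forall>i\<in>{1..length us}. finite (C i) \<and> card (C i) > i \<and> N \<inter> C i = set (take i us)) \<and>
     disjoint_family_on (\<lambda>i. C i - N) {1..length us}"

text \<open>\<open>H\<close> is a \<open>k\<close>-fan graph on \<open>W\<close> of the complete graph with vertex set \<open>N\<close>, where
  \<open>W = P 1 \<squnion> \<dots> \<squnion> P k\<close> is the defining partition.\<close>

definition is_fan_graph ::
  "'v set \<Rightarrow> 'v set \<Rightarrow> nat \<Rightarrow> (nat \<Rightarrow> 'v set) \<Rightarrow> 'v graph \<Rightarrow> bool" where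
  "is_fan_graph N W k P H \<longleftrightarrow>
     finite N \<and> W \<subseteq> N \<and>
     W = (\<Union>j\<in>{1..k}. P j) \<and> disjoint_family_on P {1..k} \<and> (\<forall>j\<in>{1..k}. P j \<noteq> {}) \<and>
     (\<exists>us C.
        (\<forall>j\<in>{1..k}. set (us j) = P j \<and> fan_branch N (us j) (C j)) \<and>
        disjoint_family_on (\<lambda>j. \<Union>i\<in>{1..length (us j)}. C j i - N) {1..k} \<and>
        gverts H = N \<union> (\<Union>j\<in>{1..k}. \<Union>i\<in>{1..length (us j)}. C j i) \<and>
        gedges H = clique_edges N \<union> (\<Union>j\<in>{1..k}. \<Union>i\<in>{1..length (us j)}. clique_edges (C j i)))"


section \<open>Ext of modules over a commutative ring\<close>

definition module_hom ::
  "('a, 'r) ring_scheme \<Rightarrow> ('a, 'b, 'm) module_scheme \<Rightarrow> ('a, 'c, 'n) module_scheme \<Rightarrow> ('b \<Rightarrow> 'c) set"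
where
  "module_hom R M N = {h \<in> carrier M \<rightarrow>\<^sub>E carrier N.
     (\<forall>x\<in>carrier M. \<forall>y\<in>carrier M. h (x \<oplus>\<^bsub>M\<^esub> y) = h x \<oplus>\<^bsub>N\<^esub> h y) \<and>
     (\<forall>a\<in>carrier R. \<forall>x\<in>carrier M. h (a \<odot>\<^bsub>M\<^esub> x) = a \<odot>\<^bsub>N\<^esub> h x)}"

definition hom_group ::
  "('a, 'r) ring_scheme \<Rightarrow> ('a, 'b, 'm) module_scheme \<Rightarrow> ('a, 'c, 'n) module_scheme \<Rightarrow> ('b \<Rightarrow> 'c) monoid"
where
  "hom_group R M N =
    \<lparr>carrier = module_hom R M N,
     mult = (\<lambda>g h. \<lambda>x\<in>carrier M. g x \<oplus>\<^bsub>N\<^esub> h x),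
     one = (\<lambda>x\<in>carrier M. \<zero>\<^bsub>N\<^esub>)\<rparr>"

text \<open>The free module of rank \<open>b\<close>. The record type of modules extends that of rings, but the fields
  \<open>mult\<close> and \<open>one\<close> play no role for modules.\<close>

definition free_mod :: "('a, 'r) ring_scheme \<Rightarrow> nat \<Rightarrow> ('a, nat \<Rightarrow> 'a) module" where
  "free_mod R b =
    \<lparr>carrier = {..<b} \<rightarrow>\<^sub>E carrier R,
     mult = (\<lambda>x y. \<lambda>i\<in>{..<b}. x i \<otimes>\<^bsub>R\<^esub> y i),
     one = (\<lambda>i\<in>{..<b}. \<one>\<^bsub>R\<^esub>),
     zero = (\<lambda>i\<in>{..<b}. \<zero>\<^bsub>R\<^esub>),
     add = (\<lambda>x y. \<lambda>i\<in>{..<b}. x i \<oplus>\<^bsub>R\<^esub> y i),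
     smult = (\<lambda>a x. \<lambda>i\<in>{..<b}. a \<otimes>\<^bsub>R\<^esub> x i)\<rparr>"

text \<open>A resolution \<open>\<dots> \<rightarrow> R\<^bsup>b 2\<^esup> \<rightarrow> R\<^bsup>b 1\<^esup> \<rightarrow> R\<^bsup>b 0\<^esup> \<rightarrow> N \<rightarrow> 0\<close> of \<open>N\<close> by free modules of finite rank, with
  differentials \<open>d i : R\<^bsup>b (i+1)\<^esup> \<rightarrow> R\<^bsup>b i\<^esup>\<close> and augmentation \<open>\<epsilon> : R\<^bsup>b 0\<^esup> \<rightarrow> N\<close>. Every finitely generated module
  over a Noetherian ring has such a resolution.\<close>

definition free_resolution ::
  "('a, 'r) ring_scheme \<Rightarrow> ('a, 'c, 'n) module_scheme \<Rightarrow>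
   (nat \<Rightarrow> nat) \<Rightarrow> (nat \<Rightarrow> (nat \<Rightarrow> 'a) \<Rightarrow> (nat \<Rightarrow> 'a)) \<Rightarrow> ((nat \<Rightarrow> 'a) \<Rightarrow> 'c) \<Rightarrow> bool"
where
  "free_resolution R N b d \<epsilon> \<longleftrightarrow>
     (\<forall>i. d i \<in> module_hom R (free_mod R (b (Suc i))) (free_mod R (b i))) \<and>
     \<epsilon> \<in> module_hom R (free_mod R (b 0)) N \<and>
     \<epsilon> ` carrier (free_mod R (b 0)) = carrier N \<and>
     d 0 ` carrier (free_mod R (b 1)) = {x \<in> carrier (free_mod R (b 0)). \<epsilon> x = \<zero>\<^bsub>N\<^esub>} \<and>
     (\<forall>i. d (Suc i) ` carrier (free_mod R (b (Suc (Suc i)))) =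
       {x \<in> carrier (free_mod R (b (Suc i))). d i x = \<zero>\<^bsub>free_mod R (b i)\<^esub>})"

text \<open>Cocycles and coboundaries of the complex \<open>Hom\<^sub>R(R\<^bsup>b \<bullet>\<^esup>, M)\<close>.\<close>

definition cocycles ::
  "('a, 'r) ring_scheme \<Rightarrow> ('a, 'c, 'm) module_scheme \<Rightarrow>
   (nat \<Rightarrow> nat) \<Rightarrow> (nat \<Rightarrow> (nat \<Rightarrow> 'a) \<Rightarrow> (nat \<Rightarrow> 'a)) \<Rightarrow> nat \<Rightarrow> ((nat \<Rightarrow> 'a) \<Rightarrow> 'c) set"
where
  "cocycles R M b d i =
     {h \<in> module_hom R (free_mod R (b i)) M.
        \<forall>x\<in>carrier (free_mod R (b (Suc i))). h (d i x) = \<zero>\<^bsub>M\<^esub>}"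

definition coboundaries ::
  "('a, 'r) ring_scheme \<Rightarrow> ('a, 'c, 'm) module_scheme \<Rightarrow>
   (nat \<Rightarrow> nat) \<Rightarrow> (nat \<Rightarrow> (nat \<Rightarrow> 'a) \<Rightarrow> (nat \<Rightarrow> 'a)) \<Rightarrow> nat \<Rightarrow> ((nat \<Rightarrow> 'a) \<Rightarrow> 'c) set"
where
  "coboundaries R M b d i =
     (case i of
        0 \<Rightarrow> {\<one>\<^bsub>hom_group R (free_mod R (b 0)) M\<^esub>}
      | Suc j \<Rightarrow> (\<lambda>h. compose (carrier (free_mod R (b i))) h (d j)) ` module_hom R (free_mod R (b j)) M)"

definition hom_cohomology ::
  "('a, 'r) ring_scheme \<Rightarrow> ('a, 'c, 'm) module_scheme \<Rightarrow>
   (nat \<Rightarrow> nat) \<Rightarrow> (nat \<Rightarrow> (nat \<Rightarrow> 'a) \<Rightarrow> (nat \<Rightarrow> 'a)) \<Rightarrow> nat \<Rightarrow> ((nat \<Rightarrow> 'a) \<Rightarrow> 'c) set monoid"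
where
  "hom_cohomology R M b d i =
     (hom_group R (free_mod R (b i)) M)\<lparr>carrier := cocycles R M b d i\<rparr> Mod coboundaries R M b d i"

text \<open>\<open>Ext\<^bsup>i\<^esup>\<^sub>R(N, M)\<close> as an abelian group, computed from a chosen free resolution of \<open>N\<close>. It is meaningful
  whenever \<open>N\<close> has a resolution by free modules of finite rank; up to isomorphism it does not
  depend on the choice.\<close>

definition Ext ::
  "('a, 'r) ring_scheme \<Rightarrow> ('a, 'c, 'n) module_scheme \<Rightarrow> ('a, 'e, 'm) module_scheme \<Rightarrow> nat \<Rightarrow>
   ((nat \<Rightarrow> 'a) \<Rightarrow> 'e) set monoid"
where
  "Ext R N M i =
     (let (b, d) = (SOME (b, d). \<exists>\<epsilon>. free_resolution R N b d \<epsilon>) in hom_cohomology R M b d i)"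


section \<open>Polynomial rings, edge ideals, depth\<close>

type_synonym ('v, 'k) mpoly = "('v \<Rightarrow>\<^sub>0 nat) \<Rightarrow>\<^sub>0 'k"

definition poly_ring :: "'v set \<Rightarrow> ('v, 'k::field) mpoly ring" where
  "poly_ring V =
    \<lparr>carrier = {p. \<forall>m\<in>Poly_Mapping.keys p. Poly_Mapping.keys m \<subseteq> V},
     mult = (*), one = 1, zero = 0, add = (+)\<rparr>"

definition pvar :: "'v \<Rightarrow> ('v, 'k::field) mpoly" where
  "pvar u = Poly_Mapping.single (Poly_Mapping.single u 1) 1"

text \<open>The field \<open>\<bbbK>\<close> as a module over a polynomial ring: all variables act as zero.\<close>

definition residue_field :: "(('v, 'k::field) mpoly, 'k) module" where
  "residue_field =
    \<lparr>carrier = UNIV, mult = (*), one = 1, zero = 0, add = (+),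
     smult = (\<lambda>p c. Poly_Mapping.lookup p 0 * c)\<rparr>"

definition quot_module :: "('a, 'r) ring_scheme \<Rightarrow> 'a set \<Rightarrow> ('a, 'a set) module" where
  "quot_module R I =
    \<lparr>carrier = carrier (R Quot I), mult = mult (R Quot I), one = one (R Quot I),
     zero = zero (R Quot I), add = add (R Quot I),
     smult = (\<lambda>a X. (I +>\<^bsub>R\<^esub> a) \<otimes>\<^bsub>R Quot I\<^esub> X)\<rparr>"

definition edge_ideal :: "'v graph \<Rightarrow> ('v, 'k::field) mpoly set" where
  "edge_ideal H = genideal (poly_ring (gverts H)) {pvar u * pvar v |u v. {u, v} \<in> gedges H}"

definition depth :: "'v set \<Rightarrow> (('v, 'k::field) mpoly, 'c) module \<Rightarrow> nat" where
  "depth V M = (LEAST i. let E = Ext (poly_ring V) residue_field M i in carrier E \<noteq> {\<one>\<^bsub>E\<^esub>})"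

text \<open>The depth of \<open>S\<^sub>H/I\<^sub>H\<close> over \<open>\<bbbK> = 'k\<close>.\<close>

definition edge_depth :: "'k::field itself \<Rightarrow> 'v graph \<Rightarrow> nat" where
  "edge_depth K H =
     depth (gverts H) (quot_module (poly_ring (gverts H)) (edge_ideal H :: ('v, 'k) mpoly set))"

end

theory Submission
  imports Defs "HOL-Library.Function_Algebras"
begin

text \<open>Fan graphs and their gluings along leaves are chordal. For a chordal graph \<open>G\<close>, the depth of
  \<open>S/I\<close> is the least size of a maximal independent set. For the lower bound take a neighbour \<open>x\<close> of a
  simplicial vertex and use the exact sequence \<open>0 \<rightarrow> S/(I : x) \<rightarrow> S/I \<rightarrow> S/(I, x) \<rightarrow> 0\<close>: both outer ideals come
  from smaller induced subgraphs, whose least maximal independent sets are at least as large as that of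
  \<open>G\<close>. For the upper bound let \<open>D\<close> be a maximal independent set. If all \<open>Ext\<^sup>j(\<bbbK>, S/I)\<close> with \<open>j \<le> |D|\<close>
  vanished, then removing the variables of \<open>D\<close> one at a time from the Koszul complex, with a graded
  Nakayama argument at each step, would leave no element of \<open>S/I\<close> annihilated by the variables outside
  \<open>D\<close>; but the product of the variables in \<open>D\<close> is one.

  For a fan graph let \<open>\<beta>\<close> and \<open>\<alpha>\<close> be the least sizes of maximal independent sets, leaf removed, that
  contain and avoid \<open>v\<close>. Then \<open>\<beta> = 1 + |W| - |W\<^sub>1|\<close> and \<open>\<alpha> = |W| - T'\<close>, the depth of the fan
  graph is \<open>min \<beta> (\<alpha> + 1)\<close>, and that of the glued graph is \<open>min (\<alpha>\<^sub>1 + \<alpha>\<^sub>2 + 1) (\<beta>\<^sub>1 + \<alpha>\<^sub>2) (\<alpha>\<^sub>1 + \<beta>\<^sub>2)\<close>.\<close>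

section \<open>Linear maps between free modules\<close>

text \<open>\<open>Ext\<close> is computed from a resolution picked by \<open>SOME\<close>, so
  vanishing must first be shown to be the same for all resolutions; afterwards a single concrete
  complex suffices. The Koszul complex is built as an iterated mapping cone: adjoining one variable
  to the resolved ideal is one cone, and every homological step compares a complex with its cone.
  For this reason vanishing is studied for Ext(S/(E), S/J) with any set E of variables, not just for
  the residue field. Homomorphisms into S/J are represented by linear maps into S and compared
  modulo J. A core vertex u together with one new vertex from each attached clique missing u is a
  maximal independent set, so the number of cliques through u decides its size. If the leaf is a new
  vertex, then after the removal of its clique v lies in |W_1| - 1 cliques and the best other core
  vertex in T'. The surplus \<beta> - \<alpha> = T' - (|W_1| - 1) is zero exactly when T' = T - 1,
  which is what t counts.\<close>

definition smul :: "'a::comm_ring_1 \<Rightarrow> (nat \<Rightarrow> 'a) \<Rightarrow> nat \<Rightarrow> 'a" where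
  "smul a u = (\<lambda>k. a * u k)"

lemma smul_apply [simp]: "smul a u k = a * u k"
  by (simp add: smul_def)

lemma smul_simps:
  "smul a (u + w) = smul a u + smul a w" "smul a (u - w) = smul a u - smul a w"
  "smul (a + b) u = smul a u + smul b u" "smul (a * b) u = smul a (smul b u)"
  "smul 1 u = u" "smul 0 u = 0" "smul a 0 = 0" "smul (- 1) u = - u" "smul a (- u) = - smul a u"
  by (auto simp: fun_eq_iff algebra_simps)

lemma smul_commute: "smul a (smul b u) = smul b (smul a u)"
  by (auto simp: fun_eq_iff algebra_simps)

lemma sum_fun_apply: "(\<Sum>k\<in>S. f k) x = (\<Sum>k\<in>S. f k x)"
  by (induction S rule: infinite_finite_induct) auto

lemma smul_sum: "smul a (\<Sum>k\<in>S. f k) = (\<Sum>k\<in>S. smul a (f k))"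
  by (auto simp: fun_eq_iff sum_fun_apply sum_distrib_left)

definition unit_vec :: "nat \<Rightarrow> nat \<Rightarrow> 'a::comm_ring_1" where
  "unit_vec k = (\<lambda>j. if j = k then 1 else 0)"

locale coeff_ring =
  fixes A :: "'a::comm_ring_1 set"
  assumes zero_in [simp]: "0 \<in> A" and one_in [simp]: "1 \<in> A"
    and add_in [simp]: "\<And>a b. a \<in> A \<Longrightarrow> b \<in> A \<Longrightarrow> a + b \<in> A"
    and mult_in [simp]: "\<And>a b. a \<in> A \<Longrightarrow> b \<in> A \<Longrightarrow> a * b \<in> A"
    and uminus_in [simp]: "\<And>a. a \<in> A \<Longrightarrow> - a \<in> A"
begin

lemma diff_in [simp]: "a \<in> A \<Longrightarrow> b \<in> A \<Longrightarrow> a - b \<in> A"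
  using add_in[of a "- b"] by simp

text \<open>Vectors of length \<open>n\<close> over \<open>A\<close> are padded with zeros, so that equality of vectors is
  equality of functions.\<close>

definition vecs :: "nat \<Rightarrow> (nat \<Rightarrow> 'a) set" where
  "vecs n = {u. (\<forall>k. u k \<in> A) \<and> (\<forall>k\<ge>n. u k = 0)}"

definition submod :: "nat \<Rightarrow> (nat \<Rightarrow> 'a) set \<Rightarrow> bool" where
  "submod n Q \<longleftrightarrow> Q \<subseteq> vecs n \<and> 0 \<in> Q \<and> (\<forall>u\<in>Q. \<forall>w\<in>Q. u + w \<in> Q) \<and> (\<forall>a\<in>A. \<forall>u\<in>Q. smul a u \<in> Q)"

definition lin :: "nat \<Rightarrow> nat \<Rightarrow> ((nat \<Rightarrow> 'a) \<Rightarrow> nat \<Rightarrow> 'a) \<Rightarrow> bool" where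
  "lin n m f \<longleftrightarrow> (\<forall>u\<in>vecs n. f u \<in> vecs m) \<and>
     (\<forall>u\<in>vecs n. \<forall>w\<in>vecs n. f (u + w) = f u + f w) \<and>
     (\<forall>a\<in>A. \<forall>u\<in>vecs n. f (smul a u) = smul a (f u))"

definition ideal_in :: "'a set \<Rightarrow> bool" where
  "ideal_in J \<longleftrightarrow> J \<subseteq> A \<and> 0 \<in> J \<and> (\<forall>p\<in>J. \<forall>q\<in>J. p + q \<in> J) \<and> (\<forall>a\<in>A. \<forall>p\<in>J. a * p \<in> J)"

text \<open>The ideal as a submodule of the free module of rank one. Cochains with values in A/J are
  linear maps into rank one, compared modulo this submodule.\<close>

definition one_vec :: "'a set \<Rightarrow> (nat \<Rightarrow> 'a) set" where
  "one_vec J = {u \<in> vecs 1. u 0 \<in> J}"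

lemma submod_vecs: "submod n (vecs n)"
  by (auto simp: submod_def vecs_def)

lemma submod_zero: "submod n {0}"
  by (auto simp: submod_def vecs_def smul_simps)

lemma submod_one_vec: "ideal_in J \<Longrightarrow> submod 1 (one_vec J)"
  by (auto simp: submod_def vecs_def ideal_in_def one_vec_def)

lemma
  assumes "submod n Q"
  shows submod_0: "0 \<in> Q"
    and submod_add: "u \<in> Q \<Longrightarrow> w \<in> Q \<Longrightarrow> u + w \<in> Q"
    and submod_smul: "a \<in> A \<Longrightarrow> u \<in> Q \<Longrightarrow> smul a u \<in> Q"
    and submod_uminus: "u \<in> Q \<Longrightarrow> - u \<in> Q"
    and submod_diff: "u \<in> Q \<Longrightarrow> w \<in> Q \<Longrightarrow> u - w \<in> Q"
proof -
  show "0 \<in> Q" "u \<in> Q \<Longrightarrow> w \<in> Q \<Longrightarrow> u + w \<in> Q"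
    "a \<in> A \<Longrightarrow> u \<in> Q \<Longrightarrow> smul a u \<in> Q" for u w a
    using assms by (auto simp: submod_def)
  have neg: "w \<in> Q \<Longrightarrow> - w \<in> Q" for w
    using assms one_in uminus_in unfolding submod_def by (metis smul_simps(8))
  then show "u \<in> Q \<Longrightarrow> - u \<in> Q" .
  show "u \<in> Q \<Longrightarrow> w \<in> Q \<Longrightarrow> u - w \<in> Q"
    using assms neg[of w] unfolding submod_def by (metis diff_conv_add_uminus)
qed

lemma submod_sum: "submod n Q \<Longrightarrow> (\<And>k. k \<in> S \<Longrightarrow> f k \<in> Q) \<Longrightarrow> sum f S \<in> Q"
  by (induction S rule: infinite_finite_induct) (auto simp: submod_0 submod_add)

lemmas vecs_0 [simp] = submod_0[OF submod_vecs]
  and vecs_add [simp] = submod_add[OF submod_vecs]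
  and vecs_diff [simp] = submod_diff[OF submod_vecs]
  and vecs_uminus [simp] = submod_uminus[OF submod_vecs]
  and vecs_smul [simp] = submod_smul[OF submod_vecs]

lemma vecs_in: "u \<in> vecs n \<Longrightarrow> u k \<in> A"
  by (simp add: vecs_def)

lemma vecs_mono: "u \<in> vecs n \<Longrightarrow> n \<le> m \<Longrightarrow> u \<in> vecs m"
  by (auto simp: vecs_def)

lemma unit_vec_in [simp]: "k < n \<Longrightarrow> unit_vec k \<in> vecs n"
  by (auto simp: vecs_def unit_vec_def)

lemma
  assumes "lin n m f"
  shows lin_in: "u \<in> vecs n \<Longrightarrow> f u \<in> vecs m"
    and lin_add: "u \<in> vecs n \<Longrightarrow> w \<in> vecs n \<Longrightarrow> f (u + w) = f u + f w"
    and lin_smul: "a \<in> A \<Longrightarrow> u \<in> vecs n \<Longrightarrow> f (smul a u) = smul a (f u)"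
    and lin_0: "f 0 = 0"
    and lin_uminus: "u \<in> vecs n \<Longrightarrow> f (- u) = - f u"
    and lin_diff: "u \<in> vecs n \<Longrightarrow> w \<in> vecs n \<Longrightarrow> f (u - w) = f u - f w"
proof -
  show add: "\<And>u w. u \<in> vecs n \<Longrightarrow> w \<in> vecs n \<Longrightarrow> f (u + w) = f u + f w"
    and sm: "\<And>a u. a \<in> A \<Longrightarrow> u \<in> vecs n \<Longrightarrow> f (smul a u) = smul a (f u)"
    and "\<And>u. u \<in> vecs n \<Longrightarrow> f u \<in> vecs m"
    using assms by (auto simp: lin_def)
  have "f (smul 0 0) = smul 0 (f 0)"
    by (rule sm) auto
  then show "f 0 = 0"
    by (simp add: smul_simps)
  show neg: "f (- u) = - f u" if "u \<in> vecs n" for u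
    using sm[of "- 1" u] that by (simp add: smul_simps)
  show "f (u - w) = f u - f w" if "u \<in> vecs n" "w \<in> vecs n"
    using add[of u "- w"] neg[of w] that by simp
qed

lemma lin_sum:
  assumes "lin n m f" "\<And>k. k \<in> S \<Longrightarrow> g k \<in> vecs n"
  shows "f (\<Sum>k\<in>S. g k) = (\<Sum>k\<in>S. f (g k))"
  using assms(2)
  by (induction S rule: infinite_finite_induct)
    (auto simp: lin_0[OF assms(1)] lin_add[OF assms(1)] submod_sum[OF submod_vecs])

lemma lin_zero_map: "lin n m (\<lambda>_. 0)"
  by (auto simp: lin_def smul_simps)

lemma lin_id: "lin n n (\<lambda>u. u)"
  by (auto simp: lin_def)

lemma lin_scale: "x \<in> A \<Longrightarrow> lin n n (smul x)"
  by (auto simp: lin_def smul_simps smul_commute)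

lemma lin_comp: "lin n m f \<Longrightarrow> lin m p g \<Longrightarrow> lin n p (\<lambda>u. g (f u))"
  by (auto simp: lin_def)

lemma lin_plus: "lin n m f \<Longrightarrow> lin n m g \<Longrightarrow> lin n m (\<lambda>u. f u + g u)"
  by (auto simp: lin_def smul_simps)

lemma lin_neg: "lin n m f \<Longrightarrow> lin n m (\<lambda>u. - f u)"
  by (auto simp: lin_def smul_simps)

lemma lin_minus: "lin n m f \<Longrightarrow> lin n m g \<Longrightarrow> lin n m (\<lambda>u. f u - g u)"
  by (auto simp: lin_def smul_simps)

lemma vec_expand: "u \<in> vecs n \<Longrightarrow> u = (\<Sum>k<n. smul (u k) (unit_vec k))"
proof
  fix j
  assume u: "u \<in> vecs n"
  have "(\<Sum>k<n. u k * unit_vec k j) = (\<Sum>k<n. if k = j then u j else 0)"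
    by (intro sum.cong) (auto simp: unit_vec_def)
  then show "u j = (\<Sum>k<n. smul (u k) (unit_vec k)) j"
    using u by (cases "j < n") (simp_all add: sum_fun_apply vecs_def)
qed

lemma lin_expand:
  assumes "lin n m f" "u \<in> vecs n"
  shows "f u = (\<Sum>k<n. smul (u k) (f (unit_vec k)))"
proof -
  have "f u = f (\<Sum>k<n. smul (u k) (unit_vec k))"
    by (rule arg_cong[OF vec_expand[OF assms(2)]])
  also have "\<dots> = (\<Sum>k<n. f (smul (u k) (unit_vec k)))"
    by (rule lin_sum[OF assms(1)]) (use assms(2) vecs_in in auto)
  finally show ?thesis
    using assms by (simp add: lin_smul[OF assms(1)] vecs_in[OF assms(2)])
qed

lemma lin_eqI:
  assumes "lin n m f" "lin n m g" "\<And>k. k < n \<Longrightarrow> f (unit_vec k) = g (unit_vec k)" "u \<in> vecs n"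
  shows "f u = g u"
  unfolding lin_expand[OF assms(1,4)] lin_expand[OF assms(2,4)] using assms(3) by simp

lemma lin_combination:
  assumes "\<And>k. k < n \<Longrightarrow> y k \<in> vecs m"
  shows "lin n m (\<lambda>u. \<Sum>k<n. smul (u k) (y k))"
  unfolding lin_def
proof (intro conjI ballI)
  show "(\<Sum>k<n. smul (u k) (y k)) \<in> vecs m" if "u \<in> vecs n" for u
    using assms that vecs_in by (intro submod_sum[OF submod_vecs] vecs_smul) auto
  show "(\<Sum>k<n. smul ((u + w) k) (y k)) = (\<Sum>k<n. smul (u k) (y k)) + (\<Sum>k<n. smul (w k) (y k))" for u w
    by (simp add: smul_simps(3) sum.distrib)
  show "(\<Sum>k<n. smul (smul a u k) (y k)) = smul a (\<Sum>k<n. smul (u k) (y k))" for a u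
    by (simp add: smul_sum smul_simps(4))
qed

lemma combination_unit_vec: "j < n \<Longrightarrow> (\<Sum>k<n. smul (unit_vec j k) (y k)) = y j"
proof -
  assume j: "j < n"
  have "(\<Sum>k<n. smul (unit_vec j k) (y k)) = (\<Sum>k<n. if k = j then y j else 0)"
    by (intro sum.cong) (auto simp: unit_vec_def smul_simps)
  then show ?thesis
    using j by simp
qed

lemma lin_in_submodI:
  assumes "lin n m f" "submod m Q" "\<And>k. k < n \<Longrightarrow> f (unit_vec k) \<in> Q" "u \<in> vecs n"
  shows "f u \<in> Q"
  unfolding lin_expand[OF assms(1,4)]
  using assms vecs_in by (intro submod_sum[OF assms(2)] submod_smul[OF assms(2)]) auto

text \<open>Projectivity of free modules, relative to a submodule Q: preimages are chosen for the
  unit vectors and extended linearly.\<close>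

lemma lin_lift:
  assumes f: "lin n m f" and d: "lin p m d" and Q: "submod m Q"
    and ex: "\<And>k. k < n \<Longrightarrow> \<exists>y\<in>vecs p. f (unit_vec k) - d y \<in> Q"
  obtains g where "lin n p g" "\<And>u. u \<in> vecs n \<Longrightarrow> f u - d (g u) \<in> Q"
proof -
  from ex obtain y where y: "\<And>k. k < n \<Longrightarrow> y k \<in> vecs p \<and> f (unit_vec k) - d (y k) \<in> Q"
    by metis
  define g where "g = (\<lambda>u. \<Sum>k<n. smul (u k) (y k))"
  have g: "lin n p g"
    unfolding g_def by (rule lin_combination) (use y in auto)
  have "f u - d (g u) \<in> Q" if "u \<in> vecs n" for u
  proof (rule lin_in_submodI[OF lin_minus[OF f lin_comp[OF g d]] Q _ that])
    show "f (unit_vec k) - d (g (unit_vec k)) \<in> Q" if "k < n" for k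
      using y[OF that] that by (simp add: g_def combination_unit_vec)
  qed
  with g that show ?thesis
    by blast
qed

text \<open>A free resolution of \<open>A/P\<close> with the augmentation \<open>d 0\<close> as its first map: level \<open>0\<close> is the free
  module of rank \<open>1\<close>, considered modulo \<open>P\<close>, so the \<open>i\<close>-th free module has rank \<open>b (i + 1)\<close>.\<close>

definition relations :: "'a set \<Rightarrow> nat \<Rightarrow> (nat \<Rightarrow> 'a) set" where
  "relations P i = (if i = 0 then one_vec P else {0})"

definition resolves :: "'a set \<Rightarrow> (nat \<Rightarrow> nat) \<Rightarrow> (nat \<Rightarrow> (nat \<Rightarrow> 'a) \<Rightarrow> nat \<Rightarrow> 'a) \<Rightarrow> bool" where
  "resolves P b d \<longleftrightarrow> ideal_in P \<and> b 0 = 1 \<and> (\<forall>i. lin (b (Suc i)) (b i) (d i)) \<and>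
     (\<forall>w\<in>vecs 1. \<exists>u\<in>vecs (b 1). w - d 0 u \<in> one_vec P) \<and>
     (\<forall>i. \<forall>u\<in>vecs (b (Suc i)). d i u \<in> relations P i \<longleftrightarrow> (\<exists>y\<in>vecs (b (Suc (Suc i))). u = d (Suc i) y))"

text \<open>Cohomology of Hom(-, A/J) in degree j. The augmentation occupies index 0, so degree j
  lives on level j + 1. In degree 0 the only coboundary is zero, since the target of the
  augmentation is not a term of the complex; hence the clause on g.\<close>

definition cohomology_vanishes ::
  "(nat \<Rightarrow> nat) \<Rightarrow> (nat \<Rightarrow> (nat \<Rightarrow> 'a) \<Rightarrow> nat \<Rightarrow> 'a) \<Rightarrow> 'a set \<Rightarrow> nat \<Rightarrow> bool" where
  "cohomology_vanishes b d J j \<longleftrightarrow>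
     (\<forall>h. lin (b (Suc j)) 1 h \<and> (\<forall>u\<in>vecs (b (Suc (Suc j))). h (d (Suc j) u) \<in> one_vec J) \<longrightarrow>
        (\<exists>g. lin (b j) 1 g \<and> (j = 0 \<longrightarrow> g = (\<lambda>_. 0)) \<and>
           (\<forall>u\<in>vecs (b (Suc j)). h u - g (d j u) \<in> one_vec J)))"

section \<open>Comparison of free resolutions\<close>

lemma submod_relations: "ideal_in P \<Longrightarrow> b 0 = 1 \<Longrightarrow> submod (b i) (relations P i)"
  using submod_one_vec[of P] by (auto simp: relations_def submod_zero)

text \<open>The common step in building chain maps and homotopies. Preimages of the images of the
  unit vectors come from surjectivity of the augmentation on level 0 and from exactness above
  it.\<close>

lemma lift_step:
  assumes r: "resolves P b d" and f: "lin n (b i) f"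
    and ker: "\<And>j k. i = Suc j \<Longrightarrow> k < n \<Longrightarrow> d j (f (unit_vec k)) \<in> relations P j"
  obtains g where "lin n (b (Suc i)) g" "\<And>u. u \<in> vecs n \<Longrightarrow> f u - d i (g u) \<in> relations P i"
proof (rule lin_lift[of n "b i" f "b (Suc i)" "d i" "relations P i"])
  show "submod (b i) (relations P i)"
    using r by (auto simp: resolves_def intro: submod_relations)
  show "\<exists>y\<in>vecs (b (Suc i)). f (unit_vec k) - d i y \<in> relations P i" if k: "k < n" for k
  proof (cases i)
    case 0
    have "f (unit_vec k) \<in> vecs 1"
      using f k 0 r by (auto simp: lin_def resolves_def)
    then show ?thesis
      using r 0 unfolding resolves_def relations_def by auto
  next
    case (Suc j)
    have "f (unit_vec k) \<in> vecs (b (Suc j))"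
      using f k Suc by (auto simp: lin_def)
    then obtain y where "y \<in> vecs (b (Suc i))" "f (unit_vec k) = d i y"
      using r ker[OF Suc k] Suc unfolding resolves_def by blast
    then show ?thesis
      by (intro bexI[of _ y]) (auto simp: relations_def Suc)
  qed
qed (use r f that in \<open>auto simp: resolves_def\<close>)

lemma resolution_dd:
  assumes "resolves P b d" "u \<in> vecs (b (Suc (Suc i)))"
  shows "d i (d (Suc i) u) \<in> relations P i"
proof -
  have "lin (b (Suc (Suc i))) (b (Suc i)) (d (Suc i))"
    using assms(1) by (simp add: resolves_def)
  then have "d (Suc i) u \<in> vecs (b (Suc i))"
    using assms(2) by (rule lin_in)
  then show ?thesis
    using assms unfolding resolves_def by blast
qed

lemma resolution_dd0:
  "resolves P b d \<Longrightarrow> u \<in> vecs (b (Suc (Suc (Suc i)))) \<Longrightarrow> d (Suc i) (d (Suc (Suc i)) u) = 0"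
  using resolution_dd[of P b d u "Suc i"] by (simp add: relations_def)

lemma exists_chain_map:
  assumes r: "resolves P b d" and r': "resolves P b' d'"
  obtains \<phi> where "\<And>i. lin (b i) (b' i) (\<phi> i)" "\<phi> 0 = (\<lambda>u. u)"
    "\<And>i u. u \<in> vecs (b (Suc i)) \<Longrightarrow> \<phi> i (d i u) - d' i (\<phi> (Suc i) u) \<in> relations P i"
proof -
  \<comment> \<open>The last clause, that cycles are sent to cycles, is what makes the next lift
    possible; it has to be carried along because dependent choice sees only the current map.\<close>
  define Inv where "Inv i \<phi> \<longleftrightarrow> lin (b i) (b' i) \<phi> \<and> (i = 0 \<longrightarrow> \<phi> = (\<lambda>u. u)) \<and>
    (\<forall>j. i = Suc j \<longrightarrow> (\<forall>u\<in>vecs (b i). d j u \<in> relations P j \<longrightarrow> d' j (\<phi> u) \<in> relations P j))"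
    for i \<phi>
  define Next where "Next i \<phi> \<psi> \<longleftrightarrow>
    (\<forall>u\<in>vecs (b (Suc i)). \<phi> (d i u) - d' i (\<psi> u) \<in> relations P i)" for i and \<phi> \<psi> :: "(nat \<Rightarrow> 'a) \<Rightarrow> nat \<Rightarrow> 'a"
  have lins: "lin (b (Suc i)) (b i) (d i)" "lin (b' (Suc i)) (b' i) (d' i)" for i
    using r r' by (auto simp: resolves_def)
  have sub: "submod (b' i) (relations P i)" for i
    using r' by (auto simp: resolves_def intro: submod_relations)
  have "\<exists>\<phi>. \<forall>i. Inv i (\<phi> i) \<and> Next i (\<phi> i) (\<phi> (Suc i))"
  proof (rule dependent_nat_choice)
    show "\<exists>\<phi>. Inv 0 \<phi>"
      using r r' by (intro exI[of _ "\<lambda>u. u"]) (auto simp: Inv_def resolves_def lin_id)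
    fix \<phi> i
    assume Inv: "Inv i \<phi>"
    then have \<phi>: "lin (b i) (b' i) \<phi>"
      by (simp add: Inv_def)
    obtain \<psi> where \<psi>: "lin (b (Suc i)) (b' (Suc i)) \<psi>"
      "\<And>u. u \<in> vecs (b (Suc i)) \<Longrightarrow> \<phi> (d i u) - d' i (\<psi> u) \<in> relations P i"
    proof (rule lift_step[OF r', of "b (Suc i)" i "\<lambda>u. \<phi> (d i u)"])
      show "lin (b (Suc i)) (b' i) (\<lambda>u. \<phi> (d i u))"
        by (rule lin_comp[OF lins(1) \<phi>])
      show "d' j (\<phi> (d i (unit_vec k))) \<in> relations P j" if "i = Suc j" "k < b (Suc i)" for j k
        using Inv that resolution_dd[OF r, of "unit_vec k" j] lin_in[OF lins(1)[of i]] by (auto simp: Inv_def)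
    qed (use that in blast)
    have "d' i (\<psi> u) \<in> relations P i" if "u \<in> vecs (b (Suc i))" "d i u \<in> relations P i" for u
    proof -
      have *: "\<phi> (d i u) \<in> relations P i"
        using Inv that(2) lin_0[OF \<phi>] by (cases i) (auto simp: Inv_def relations_def)
      then show ?thesis
        using submod_diff[OF sub * \<psi>(2)[OF that(1)]] by simp
    qed
    then show "\<exists>\<psi>. Inv (Suc i) \<psi> \<and> Next i \<phi> \<psi>"
      using \<psi> by (intro exI[of _ \<psi>]) (auto simp: Inv_def Next_def)
  qed
  then obtain \<phi> where "\<And>i. Inv i (\<phi> i)" "\<And>i. Next i (\<phi> i) (\<phi> (Suc i))"
    by blast
  with that[of \<phi>] show ?thesis
    by (auto simp: Inv_def Next_def)
qed

text \<open>To be applied to the composite of comparison maps in both directions, which lies over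
  the identity of A/P. The homotopy starts with zero on level 0.\<close>

lemma exists_homotopy:
  assumes r: "resolves P b d" and \<theta>: "\<And>i. lin (b i) (b i) (\<theta> i)" "\<theta> 0 = (\<lambda>u. u)"
    and chain: "\<And>i u. u \<in> vecs (b (Suc i)) \<Longrightarrow> \<theta> i (d i u) - d i (\<theta> (Suc i) u) \<in> relations P i"
  obtains s where "\<And>i. lin (b i) (b (Suc i)) (s i)" "s 0 = (\<lambda>u. 0)"
    "\<And>i u. u \<in> vecs (b (Suc i)) \<Longrightarrow> \<theta> (Suc i) u - u - s i (d i u) = d (Suc i) (s (Suc i) u)"
proof -
  define Inv where "Inv i s \<longleftrightarrow> lin (b i) (b (Suc i)) s \<and> (i = 0 \<longrightarrow> s = (\<lambda>u. 0)) \<and>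
    (\<forall>u\<in>vecs (b i). (\<forall>j. i = Suc j \<longrightarrow> d j u \<in> relations P j) \<longrightarrow> \<theta> i u - u - d i (s u) \<in> relations P i)"
    for i s
  define Next where "Next i s s' \<longleftrightarrow>
    (\<forall>u\<in>vecs (b (Suc i)). \<theta> (Suc i) u - u - s (d i u) = d (Suc i) (s' u))"
    for i and s s' :: "(nat \<Rightarrow> 'a) \<Rightarrow> nat \<Rightarrow> 'a"
  have lins: "lin (b (Suc i)) (b i) (d i)" for i
    using r by (auto simp: resolves_def)
  have b0: "b 0 = 1" and P: "ideal_in P"
    using r by (auto simp: resolves_def)
  have sub: "submod (b i) (relations P i)" for i
    using b0 P by (auto intro: submod_relations)
  have "\<exists>s. \<forall>i. Inv i (s i) \<and> Next i (s i) (s (Suc i))"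
  proof (rule dependent_nat_choice)
    show "\<exists>s. Inv 0 s"
      using submod_0[OF sub[of 0]]
      by (intro exI[of _ "\<lambda>u. 0"]) (auto simp: Inv_def lin_zero_map \<theta>(2) lin_0[OF lins])
    fix s i
    assume Inv: "Inv i s"
    then have s: "lin (b i) (b (Suc i)) s"
      by (simp add: Inv_def)
    \<comment> \<open>The part of the homotopy identity still to be written as a boundary. The
      invariant of s and the chain condition show that \<open>d i\<close> maps it into the
      relations, so it lifts through \<open>d (Suc i)\<close>.\<close>
    define f where "f = (\<lambda>u. \<theta> (Suc i) u - u - s (d i u))"
    have f: "lin (b (Suc i)) (b (Suc i)) f"
      unfolding f_def by (intro lin_minus \<theta> lin_id lin_comp[OF lins s])
    obtain s' where s': "lin (b (Suc i)) (b (Suc (Suc i))) s'"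
      "\<And>u. u \<in> vecs (b (Suc i)) \<Longrightarrow> f u - d (Suc i) (s' u) \<in> relations P (Suc i)"
    proof (rule lift_step[OF r f])
      fix j k
      assume "Suc i = Suc j" and k: "k < b (Suc i)"
      then have ij: "j = i" by simp
      let ?e = "unit_vec k :: nat \<Rightarrow> 'a"
      have e: "?e \<in> vecs (b (Suc i))" using k by simp
      have de: "d i ?e \<in> vecs (b i)" using e by (rule lin_in[OF lins])
      have "\<theta> i (d i ?e) - d i ?e - d i (s (d i ?e)) \<in> relations P i"
        using Inv de resolution_dd[OF r, of ?e] e by (auto simp: Inv_def)
      moreover have "d i (f ?e) = d i (\<theta> (Suc i) ?e) - d i ?e - d i (s (d i ?e))"
        unfolding f_def using e de by (simp add: lin_diff[OF lins] lin_in[OF \<theta>(1)] lin_in[OF s])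
      ultimately have "d i (f ?e) = (\<theta> i (d i ?e) - d i ?e - d i (s (d i ?e))) - (\<theta> i (d i ?e) - d i (\<theta> (Suc i) ?e))"
        and "\<theta> i (d i ?e) - d i ?e - d i (s (d i ?e)) \<in> relations P i"
        by simp_all
      then have "d i (f ?e) \<in> relations P i"
        using submod_diff[OF sub _ chain[OF e]] by (simp only:)
      then show "d j (f (unit_vec k)) \<in> relations P j"
        using ij by simp
    qed (use that in blast)
    have eq: "f u = d (Suc i) (s' u)" if "u \<in> vecs (b (Suc i))" for u
      using s'(2)[OF that] by (simp add: relations_def)
    have "\<theta> (Suc i) u - u - d (Suc i) (s' u) \<in> relations P (Suc i)"
      if u: "u \<in> vecs (b (Suc i))" and du: "d i u \<in> relations P i" for u
    proof -
      have "s (d i u) = 0"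
        using Inv du lin_0[OF s] by (cases i) (auto simp: Inv_def relations_def)
      then show ?thesis
        using eq[OF u] by (simp add: f_def relations_def)
    qed
    then show "\<exists>s'. Inv (Suc i) s' \<and> Next i s s'"
      using s'(1) eq by (intro exI[of _ s']) (auto simp: Inv_def Next_def f_def)
  qed
  then obtain s where "\<And>i. Inv i (s i)" "\<And>i. Next i (s i) (s (Suc i))"
    by blast
  with that[of s] show ?thesis
    by (auto simp: Inv_def Next_def)
qed

text \<open>A cocycle h is pulled back along \<psi> to the other resolution, where it has a
  primitive; this primitive is transported back along \<phi>, and a homotopy repairs the fact that
  the composite of \<phi> and \<psi> is not the identity.\<close>

theorem cohomology_independent:
  assumes r: "resolves P b d" and r': "resolves P b' d'" and J: "ideal_in J"
    and van: "cohomology_vanishes b' d' J j"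
  shows "cohomology_vanishes b d J j"
  unfolding cohomology_vanishes_def
proof (intro allI impI, elim conjE)
  fix h
  assume h: "lin (b (Suc j)) 1 h" and cocycle: "\<forall>u\<in>vecs (b (Suc (Suc j))). h (d (Suc j) u) \<in> one_vec J"
  have lins: "lin (b (Suc i)) (b i) (d i)" "lin (b' (Suc i)) (b' i) (d' i)" for i
    using r r' by (auto simp: resolves_def)
  have b0: "b 0 = 1" "b' 0 = 1" and P: "ideal_in P"
    using r r' by (auto simp: resolves_def)
  have sub: "submod (b i) (relations P i)" for i
    using b0 P by (auto intro: submod_relations)
  note sJ = submod_one_vec[OF J]
  obtain \<phi> where \<phi>: "\<And>i. lin (b i) (b' i) (\<phi> i)" "\<phi> 0 = (\<lambda>u. u)"
    "\<And>i u. u \<in> vecs (b (Suc i)) \<Longrightarrow> \<phi> i (d i u) - d' i (\<phi> (Suc i) u) \<in> relations P i"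
    by (rule exists_chain_map[OF r r']) blast
  obtain \<psi> where \<psi>: "\<And>i. lin (b' i) (b i) (\<psi> i)" "\<psi> 0 = (\<lambda>u. u)"
    "\<And>i u. u \<in> vecs (b' (Suc i)) \<Longrightarrow> \<psi> i (d' i u) - d i (\<psi> (Suc i) u) \<in> relations P i"
    by (rule exists_chain_map[OF r' r]) blast
  have \<psi>rel: "\<psi> i w \<in> relations P i" if "w \<in> relations P i" for i w
    using that \<psi>(2) lin_0[OF \<psi>(1)] by (cases i) (auto simp: relations_def)
  define \<theta> where "\<theta> = (\<lambda>i u. \<psi> i (\<phi> i u))"
  have \<theta>: "lin (b i) (b i) (\<theta> i)" for i
    unfolding \<theta>_def by (rule lin_comp[OF \<phi>(1) \<psi>(1)])
  obtain s where s: "\<And>i. lin (b i) (b (Suc i)) (s i)" "s 0 = (\<lambda>u. 0)"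
    "\<And>i u. u \<in> vecs (b (Suc i)) \<Longrightarrow> \<theta> (Suc i) u - u - s i (d i u) = d (Suc i) (s (Suc i) u)"
  proof (rule exists_homotopy[OF r \<theta>])
    show "\<theta> 0 = (\<lambda>u. u)"
      by (simp add: \<theta>_def \<phi> \<psi>)
    fix i u
    assume u: "u \<in> vecs (b (Suc i))"
    note in1 = lin_in[OF \<phi>(1)] lin_in[OF lins(1)] lin_in[OF lins(2)]
    have 1: "\<psi> i (\<phi> i (d i u) - d' i (\<phi> (Suc i) u)) \<in> relations P i"
      by (rule \<psi>rel[OF \<phi>(3)[OF u]])
    have 2: "\<psi> i (d' i (\<phi> (Suc i) u)) - d i (\<psi> (Suc i) (\<phi> (Suc i) u)) \<in> relations P i"
      using u by (intro \<psi>(3)) (simp add: in1)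
    have "\<theta> i (d i u) - d i (\<theta> (Suc i) u) = \<psi> i (\<phi> i (d i u) - d' i (\<phi> (Suc i) u)) +
        (\<psi> i (d' i (\<phi> (Suc i) u)) - d i (\<psi> (Suc i) (\<phi> (Suc i) u)))"
      using u by (simp add: \<theta>_def lin_diff[OF \<psi>(1)] in1)
    then show "\<theta> i (d i u) - d i (\<theta> (Suc i) u) \<in> relations P i"
      using submod_add[OF sub 1 2] by simp
  qed blast
  have "lin (b' (Suc j)) 1 (\<lambda>w. h (\<psi> (Suc j) w))"
    by (rule lin_comp[OF \<psi>(1) h])
  moreover have "h (\<psi> (Suc j) (d' (Suc j) w)) \<in> one_vec J" if "w \<in> vecs (b' (Suc (Suc j)))" for w
  proof -
    have "\<psi> (Suc j) (d' (Suc j) w) = d (Suc j) (\<psi> (Suc (Suc j)) w)"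
      using \<psi>(3)[OF that] by (simp add: relations_def)
    then show ?thesis
      using cocycle that lin_in[OF \<psi>(1)] by simp
  qed
  ultimately obtain g' where g': "lin (b' j) 1 g'" "j = 0 \<longrightarrow> g' = (\<lambda>_. 0)"
    "\<And>w. w \<in> vecs (b' (Suc j)) \<Longrightarrow> h (\<psi> (Suc j) w) - g' (d' j w) \<in> one_vec J"
    using van unfolding cohomology_vanishes_def by blast
  \<comment> \<open>From \<theta> - 1 = s d + d s, and since h maps boundaries into J, one gets h =
    h \<theta> - h s d modulo J. The first term is g' \<phi> d, which gives this primitive.\<close>
  define g where "g = (\<lambda>u. g' (\<phi> j u) - h (s j u))"
  have "lin (b j) 1 g"
    unfolding g_def by (intro lin_minus lin_comp[OF \<phi>(1) g'(1)] lin_comp[OF s(1) h])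
  moreover have "j = 0 \<longrightarrow> g = (\<lambda>_. 0)"
    using g'(2) s(2) lin_0[OF h] by (auto simp: g_def)
  moreover have "h u - g (d j u) \<in> one_vec J" if u: "u \<in> vecs (b (Suc j))" for u
  proof -
    note in1 = lin_in[OF \<phi>(1)] lin_in[OF lins(1)] lin_in[OF lins(2)] lin_in[OF \<theta>] lin_in[OF s(1)]
    have 1: "h (\<theta> (Suc j) u) - g' (d' j (\<phi> (Suc j) u)) \<in> one_vec J"
      using g'(3)[of "\<phi> (Suc j) u"] u by (simp add: in1 \<theta>_def)
    have "h (\<theta> (Suc j) u - u - s j (d j u)) \<in> one_vec J"
      unfolding s(3)[OF u] using cocycle u by (simp add: in1)
    then have 2: "h (\<theta> (Suc j) u) - h u - h (s j (d j u)) \<in> one_vec J"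
      using u by (simp add: in1 lin_diff[OF h])
    have 3: "g' (d' j (\<phi> (Suc j) u)) = g' (\<phi> j (d j u))"
      using g'(2) \<phi>(3)[OF u] by (cases j) (auto simp: relations_def)
    show ?thesis
      using submod_diff[OF sJ 1 2] unfolding g_def 3 by (simp add: algebra_simps)
  qed
  ultimately show "\<exists>g. lin (b j) 1 g \<and> (j = 0 \<longrightarrow> g = (\<lambda>_. 0)) \<and>
      (\<forall>u\<in>vecs (b (Suc j)). h u - g (d j u) \<in> one_vec J)"
    by blast
qed

section \<open>Mapping cones\<close>

definition colon :: "'a set \<Rightarrow> 'a \<Rightarrow> 'a set" where
  "colon J x = {p \<in> A. x * p \<in> J}"

definition adjoin :: "'a set \<Rightarrow> 'a \<Rightarrow> 'a set" where
  "adjoin J x = {p + x * a |p a. p \<in> J \<and> a \<in> A}"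

lemma ideal_in_adjoin:
  assumes x: "x \<in> A" and J: "ideal_in J"
  shows "ideal_in (adjoin J x)"
proof -
  have J': "J \<subseteq> A" "0 \<in> J" "\<And>p q. p \<in> J \<Longrightarrow> q \<in> J \<Longrightarrow> p + q \<in> J" "\<And>a p. a \<in> A \<Longrightarrow> p \<in> J \<Longrightarrow> a * p \<in> J"
    using J by (auto simp: ideal_in_def)
  show ?thesis
    unfolding ideal_in_def
  proof (intro conjI ballI)
    show "adjoin J x \<subseteq> A"
      using x J'(1) by (auto simp: adjoin_def)
    show "0 \<in> adjoin J x"
      unfolding adjoin_def using J'(2) zero_in by (intro CollectI exI[of _ 0]) auto
  next
    fix u w
    assume "u \<in> adjoin J x" "w \<in> adjoin J x"
    then obtain p a q c where "u = p + x * a" "w = q + x * c" "p \<in> J" "a \<in> A" "q \<in> J" "c \<in> A"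
      by (auto simp: adjoin_def)
    then have "u + w = (p + q) + x * (a + c)" "p + q \<in> J" "a + c \<in> A"
      using J'(3) by (auto simp: algebra_simps)
    then show "u + w \<in> adjoin J x"
      unfolding adjoin_def by blast
  next
    fix c w
    assume c: "c \<in> A" and "w \<in> adjoin J x"
    then obtain p a where "w = p + x * a" "p \<in> J" "a \<in> A"
      by (auto simp: adjoin_def)
    then have "c * w = c * p + x * (c * a)" "c * p \<in> J" "c * a \<in> A"
      using J'(4) c by (auto simp: algebra_simps)
    then show "c * w \<in> adjoin J x"
      unfolding adjoin_def by blast
  qed
qed

lemma one_vec_adjoin:
  assumes "x \<in> A" "w \<in> one_vec (adjoin J x)"
  obtains v where "v \<in> vecs 1" "w - smul x v \<in> one_vec J"
proof -
  from assms obtain p a where pa: "p \<in> J" "a \<in> A" "w 0 = p + x * a"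
    by (auto simp: one_vec_def adjoin_def)
  define v where "v = smul a (unit_vec 0)"
  have v: "v \<in> vecs 1"
    unfolding v_def using pa by (intro vecs_smul unit_vec_in) auto
  moreover have "w - smul x v \<in> one_vec J"
    using assms v pa by (auto simp: one_vec_def v_def unit_vec_def)
  ultimately show ?thesis
    by (rule that)
qed

lemma one_vec_adjoinI:
  assumes "x \<in> A" "w \<in> vecs 1" "v \<in> vecs 1" "w - smul x v \<in> one_vec J"
  shows "w \<in> one_vec (adjoin J x)"
proof -
  have "w 0 = (w 0 - x * v 0) + x * v 0" "w 0 - x * v 0 \<in> J" "v 0 \<in> A"
    using assms vecs_in by (auto simp: one_vec_def)
  then show ?thesis
    using assms(2) unfolding one_vec_def adjoin_def by blast
qed

lemma one_vec_adjoin_mono: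
  assumes "x \<in> A" "w \<in> one_vec J"
  shows "w \<in> one_vec (adjoin J x)"
  using assms one_vec_adjoinI[of x w 0] by (auto simp: one_vec_def smul_simps)

lemma one_vec_adjoin_smul:
  assumes "x \<in> A" "w \<in> vecs 1" "ideal_in J"
  shows "smul x w \<in> one_vec (adjoin J x)"
  using assms one_vec_adjoinI[of x "smul x w" w] submod_0[OF submod_one_vec] by (auto simp: smul_simps)

lemma one_vec_colon: "v \<in> vecs 1 \<Longrightarrow> x \<in> A \<Longrightarrow> smul x v \<in> one_vec J \<longleftrightarrow> v \<in> one_vec (colon J x)"
  using vecs_in by (auto simp: one_vec_def colon_def)

text \<open>Above the augmentation d d = 0. At the augmentation the composite vanishes only modulo
  P, but there g is zero.\<close>

lemma coboundary_dd:
  assumes "resolves P b d" "lin (b j) 1 g" "j = 0 \<longrightarrow> g = (\<lambda>_. 0)" "u \<in> vecs (b (Suc (Suc j)))"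
  shows "g (d j (d (Suc j) u)) = 0"
  using assms resolution_dd0[OF assms(1)] lin_0[OF assms(2)] by (cases j) auto

text \<open>The long exact sequence of \<open>0 \<rightarrow> A/(J : x) \<rightarrow> A/J \<rightarrow> A/(J, x) \<rightarrow> 0\<close>.\<close>

lemma vanishes_colon_adjoin:
  assumes r: "resolves P b d" and x: "x \<in> A" and J: "ideal_in J"
    and c: "cohomology_vanishes b d (colon J x) j" and a: "cohomology_vanishes b d (adjoin J x) j"
  shows "cohomology_vanishes b d J j"
  unfolding cohomology_vanishes_def
proof (intro allI impI, elim conjE)
  fix h
  assume h: "lin (b (Suc j)) 1 h" and cocycle: "\<forall>u\<in>vecs (b (Suc (Suc j))). h (d (Suc j) u) \<in> one_vec J"
  have lins: "lin (b (Suc i)) (b i) (d i)" for i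
    using r by (simp add: resolves_def)
  note sJ = submod_one_vec[OF J]
  have "\<forall>u\<in>vecs (b (Suc (Suc j))). h (d (Suc j) u) \<in> one_vec (adjoin J x)"
    using cocycle one_vec_adjoin_mono[OF x] by blast
  then obtain g where g: "lin (b j) 1 g" "j = 0 \<longrightarrow> g = (\<lambda>_. 0)"
    "\<And>u. u \<in> vecs (b (Suc j)) \<Longrightarrow> h u - g (d j u) \<in> one_vec (adjoin J x)"
    using a h unfolding cohomology_vanishes_def by blast
  \<comment> \<open>The values of f lie in (J, x), so modulo J they are x times a map
    \<open>h'\<close>. This quotient is determined only modulo J : x, and there it is again a
    cocycle.\<close>
  define f where "f = (\<lambda>u. h u - g (d j u))"
  have f: "lin (b (Suc j)) 1 f"
    unfolding f_def by (intro lin_minus h lin_comp[OF lins g(1)])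
  obtain h' where h': "lin (b (Suc j)) 1 h'" "\<And>u. u \<in> vecs (b (Suc j)) \<Longrightarrow> f u - smul x (h' u) \<in> one_vec J"
  proof (rule lin_lift[OF f lin_scale[OF x] sJ])
    show "\<exists>y\<in>vecs 1. f (unit_vec k) - smul x y \<in> one_vec J" if "k < b (Suc j)" for k
      using g(3)[of "unit_vec k"] that one_vec_adjoin[OF x] unfolding f_def by (metis unit_vec_in)
  qed blast
  have "h' (d (Suc j) u) \<in> one_vec (colon J x)" if u: "u \<in> vecs (b (Suc (Suc j)))" for u
  proof -
    have du: "d (Suc j) u \<in> vecs (b (Suc j))"
      using u by (rule lin_in[OF lins])
    have "f (d (Suc j) u) \<in> one_vec J"
      using cocycle u coboundary_dd[OF r g(1,2) u] by (simp add: f_def)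
    from submod_diff[OF sJ this h'(2)[OF du]] have "smul x (h' (d (Suc j) u)) \<in> one_vec J"
      by simp
    then show ?thesis
      using one_vec_colon lin_in[OF h'(1) du] x by blast
  qed
  then obtain g' where g': "lin (b j) 1 g'" "j = 0 \<longrightarrow> g' = (\<lambda>_. 0)"
    "\<And>u. u \<in> vecs (b (Suc j)) \<Longrightarrow> h' u - g' (d j u) \<in> one_vec (colon J x)"
    using c h'(1) unfolding cohomology_vanishes_def by blast
  define k where "k = (\<lambda>w. g w + smul x (g' w))"
  have "lin (b j) 1 k"
    unfolding k_def by (intro lin_plus g(1) lin_comp[OF g'(1) lin_scale[OF x]])
  moreover have "j = 0 \<longrightarrow> k = (\<lambda>_. 0)"
    using g(2) g'(2) by (auto simp: k_def smul_simps)
  moreover have "h u - k (d j u) \<in> one_vec J" if u: "u \<in> vecs (b (Suc j))" for u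
  proof -
    have "h' u - g' (d j u) \<in> vecs 1"
      using u by (intro vecs_diff lin_in[OF h'(1)] lin_in[OF g'(1)] lin_in[OF lins])
    then have "smul x (h' u - g' (d j u)) \<in> one_vec J"
      using g'(3)[OF u] one_vec_colon x by blast
    from submod_add[OF sJ h'(2)[OF u] this] show ?thesis
      by (simp add: f_def k_def smul_simps algebra_simps)
  qed
  ultimately show "\<exists>g. lin (b j) 1 g \<and> (j = 0 \<longrightarrow> g = (\<lambda>_. 0)) \<and>
      (\<forall>u\<in>vecs (b (Suc j)). h u - g (d j u) \<in> one_vec J)"
    by blast
qed

section \<open>Block decomposition of vectors and the cone differential\<close>

definition front :: "nat \<Rightarrow> (nat \<Rightarrow> 'a) \<Rightarrow> nat \<Rightarrow> 'a" where
  "front n z = (\<lambda>k. if k < n then z k else 0)"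

definition rear :: "nat \<Rightarrow> (nat \<Rightarrow> 'a) \<Rightarrow> nat \<Rightarrow> 'a" where
  "rear n z = (\<lambda>k. z (k + n))"

definition shift :: "nat \<Rightarrow> (nat \<Rightarrow> 'a) \<Rightarrow> nat \<Rightarrow> 'a" where
  "shift n v = (\<lambda>k. if k < n then 0 else v (k - n))"

lemma front_rear: "front n z + shift n (rear n z) = z"
  by (auto simp: front_def rear_def shift_def fun_eq_iff)

lemma front_simps [simp]:
  "front n (u + w) = front n u + front n w" "front n (- u) = - front n u" "front n (u - w) = front n u - front n w"
  "front n (smul a u) = smul a (front n u)" "front n 0 = 0" "front n (shift n v) = 0"
  by (auto simp: front_def shift_def fun_eq_iff)

lemma rear_simps [simp]:
  "rear n (u + w) = rear n u + rear n w" "rear n (- u) = - rear n u" "rear n (u - w) = rear n u - rear n w"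
  "rear n (smul a u) = smul a (rear n u)" "rear n 0 = 0" "rear n (shift n v) = v"
  by (auto simp: rear_def shift_def fun_eq_iff)

lemma shift_simps [simp]:
  "shift n (u + w) = shift n u + shift n w" "shift n (- u) = - shift n u" "shift n (u - w) = shift n u - shift n w"
  "shift n (smul a u) = smul a (shift n u)" "shift n 0 = 0"
  by (auto simp: shift_def fun_eq_iff)

lemma front_eq: "u \<in> vecs n \<Longrightarrow> front n u = u"
  and rear_eq: "u \<in> vecs n \<Longrightarrow> rear n u = 0"
  by (auto simp: front_def rear_def vecs_def fun_eq_iff)

lemma lin_front: "lin (n + m) n (front n)"
  and lin_rear: "lin (n + m) m (rear n)"
  and lin_shift: "lin m (n + m) (shift n)"
  and lin_inclusion: "n \<le> m \<Longrightarrow> lin n m (\<lambda>u. u)"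
  by (auto simp: lin_def vecs_def front_def rear_def shift_def)

definition cone_rank :: "(nat \<Rightarrow> nat) \<Rightarrow> nat \<Rightarrow> nat" where
  "cone_rank b i = (if i < 2 then 0 else b (i - 1))"

definition cone_tail :: "(nat \<Rightarrow> (nat \<Rightarrow> 'a) \<Rightarrow> nat \<Rightarrow> 'a) \<Rightarrow> nat \<Rightarrow> (nat \<Rightarrow> 'a) \<Rightarrow> nat \<Rightarrow> 'a" where
  "cone_tail d i v = (if i < 2 then 0 else d (i - 1) v)"

text \<open>The mapping cone of multiplication by \<open>x\<close>; the augmentation level \<open>0\<close> is not doubled.\<close>

definition cone_b :: "(nat \<Rightarrow> nat) \<Rightarrow> nat \<Rightarrow> nat" where
  "cone_b b i = b i + cone_rank b i"

text \<open>In block form (u, v) goes to (d u + x v, - d v); the sign makes consecutive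
  differentials compose to zero.\<close>

definition cone_d ::
  "(nat \<Rightarrow> nat) \<Rightarrow> (nat \<Rightarrow> (nat \<Rightarrow> 'a) \<Rightarrow> nat \<Rightarrow> 'a) \<Rightarrow> 'a \<Rightarrow> nat \<Rightarrow> (nat \<Rightarrow> 'a) \<Rightarrow> nat \<Rightarrow> 'a" where
  "cone_d b d x i z = (d i (front (b (Suc i)) z) + smul x (rear (b (Suc i)) z)) +
     shift (b i) (- cone_tail d i (rear (b (Suc i)) z))"

lemma lin_cone_tail:
  "(\<And>i. lin (b (Suc i)) (b i) (d i)) \<Longrightarrow> lin (cone_rank b (Suc i)) (cone_rank b i) (cone_tail d i)"
proof -
  assume l: "\<And>i. lin (b (Suc i)) (b i) (d i)"
  show ?thesis
  proof (cases "i < 2")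
    case True
    then have "cone_tail d i = (\<lambda>_. 0)"
      by (auto simp: cone_tail_def)
    then show ?thesis
      by (simp add: lin_zero_map)
  next
    case False
    then have "cone_tail d i = d (i - 1)" "Suc (i - 1) = i"
      by (auto simp: cone_tail_def)
    then show ?thesis
      using l[of "i - 1"] False by (simp add: cone_rank_def)
  qed
qed

lemma cone_rank_le: "cone_rank b (Suc i) \<le> b i"
  by (simp add: cone_rank_def)

lemma lin_cone_d:
  assumes "\<And>i. lin (b (Suc i)) (b i) (d i)" "x \<in> A"
  shows "lin (cone_b b (Suc i)) (cone_b b i) (cone_d b d x i)"
  unfolding cone_d_def cone_b_def
proof (intro lin_plus)
  let ?c = "cone_rank b"
  show "lin (b (Suc i) + ?c (Suc i)) (b i + ?c i) (\<lambda>z. d i (front (b (Suc i)) z))"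
    by (rule lin_comp[OF lin_front lin_comp[OF assms(1) lin_inclusion]]) simp
  show "lin (b (Suc i) + ?c (Suc i)) (b i + ?c i) (\<lambda>z. smul x (rear (b (Suc i)) z))"
    by (rule lin_comp[OF lin_rear lin_comp[OF lin_scale[OF assms(2)] lin_inclusion]])
      (simp add: trans_le_add1 cone_rank_le)
  show "lin (b (Suc i) + ?c (Suc i)) (b i + ?c i) (\<lambda>z. shift (b i) (- cone_tail d i (rear (b (Suc i)) z)))"
    by (rule lin_comp[OF lin_rear lin_comp[OF lin_neg[OF lin_cone_tail[of b d]] lin_shift]]) (rule assms(1))
qed

lemma cone_d_split:
  assumes lins: "\<And>i. lin (b (Suc i)) (b i) (d i)" and x: "x \<in> A" and z: "z \<in> vecs (cone_b b (Suc i))"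
  shows "front (b i) (cone_d b d x i z) = d i (front (b (Suc i)) z) + smul x (rear (b (Suc i)) z)"
    and "rear (b i) (cone_d b d x i z) = - cone_tail d i (rear (b (Suc i)) z)"
proof -
  have "d i (front (b (Suc i)) z) \<in> vecs (b i)"
    using z unfolding cone_b_def by (intro lin_in[OF lins] lin_in[OF lin_front])
  moreover have "smul x (rear (b (Suc i)) z) \<in> vecs (b i)"
    using lin_in[OF lin_rear z[unfolded cone_b_def]] x vecs_mono[OF _ cone_rank_le] by auto
  ultimately show "front (b i) (cone_d b d x i z) = d i (front (b (Suc i)) z) + smul x (rear (b (Suc i)) z)"
    and "rear (b i) (cone_d b d x i z) = - cone_tail d i (rear (b (Suc i)) z)"
    by (simp_all add: cone_d_def front_eq rear_eq smul_simps del: front_simps(4) rear_simps(4))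
qed

lemma split_eq_iff: "z = w \<longleftrightarrow> front n z = front n w \<and> rear n z = rear n w"
  by (metis front_rear)

text \<open>As x is a nonzerodivisor on A/P, the cone of multiplication by x on a resolution of A/P
  resolves A/(P, x). The lowest level is handled separately, since it is exact only modulo (P, x)
  and its target is not doubled.\<close>

theorem cone_resolves:
  assumes r: "resolves P b d" and x: "x \<in> A" and reg: "\<And>p. p \<in> A \<Longrightarrow> x * p \<in> P \<Longrightarrow> p \<in> P"
  shows "resolves (adjoin P x) (cone_b b) (cone_d b d x)"
proof -
  have lins: "lin (b (Suc i)) (b i) (d i)" for i
    using r by (simp add: resolves_def)
  have P: "ideal_in P" and b0: "b 0 = 1"
    using r by (auto simp: resolves_def)
  note sP = submod_one_vec[OF P]
  note cl = lin_cone_d[of b d x, OF lins x]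
  have surj: "\<exists>u\<in>vecs (b 1). w - d 0 u \<in> one_vec P" if "w \<in> vecs 1" for w
    using r that by (auto simp: resolves_def)
  have exact: "d i u \<in> relations P i \<longleftrightarrow> (\<exists>y\<in>vecs (b (Suc (Suc i))). u = d (Suc i) y)"
    if "u \<in> vecs (b (Suc i))" for i u
    using r that by (auto simp: resolves_def)
  have reg1: "v \<in> one_vec P" if "v \<in> vecs 1" "smul x v \<in> one_vec P" for v
    using that reg vecs_in by (auto simp: one_vec_def)
  have cb: "cone_b b 0 = 1" "cone_b b (Suc 0) = b 1" "cone_b b (Suc (Suc i)) = b (Suc (Suc i)) + b (Suc i)" for i
    by (auto simp: cone_b_def cone_rank_def b0)
  have d0: "cone_d b d x 0 u = d 0 u" if "u \<in> vecs (b 1)" for u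
    using that by (simp add: cone_d_def front_eq rear_eq smul_simps cone_tail_def)
  have ex0: "d 0 u \<in> one_vec (adjoin P x) \<longleftrightarrow> (\<exists>y\<in>vecs (b 2 + b 1). u = cone_d b d x 1 y)"
    if u: "u \<in> vecs (b 1)" for u
  proof
    assume "d 0 u \<in> one_vec (adjoin P x)"
    then obtain v where v: "v \<in> vecs 1" "d 0 u - smul x v \<in> one_vec P"
      by (rule one_vec_adjoin[OF x])
    obtain t where t: "t \<in> vecs (b 1)" "v - d 0 t \<in> one_vec P"
      using surj[OF v(1)] by blast
    have xt: "smul x t \<in> vecs (b 1)"
      using t x by simp
    \<comment> \<open>Here \<open>d 0 u\<close> is x v modulo P and t is a preimage of v, so u - x t
      is a cycle modulo P and therefore a boundary \<open>d 1 y\<close>. Then (y, t) is the preimage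
      of u in the cone.\<close>
    have "d 0 (u - smul x t) = (d 0 u - smul x v) + smul x (v - d 0 t)"
      using u t xt x lin_diff[OF lins[of 0]] lin_smul[OF lins[of 0]] by (simp add: smul_simps)
    then have "d 0 (u - smul x t) \<in> relations P 0"
      using submod_add[OF sP v(2) submod_smul[OF sP x t(2)]] by (simp add: relations_def)
    then obtain y where y: "y \<in> vecs (b 2)" "u - smul x t = d 1 y"
      using exact[of "u - smul x t" 0] u xt by (auto simp: numeral_2_eq_2)
    have "y + shift (b 2) t \<in> vecs (b 2 + b 1)"
      using y t by (intro vecs_add lin_in[OF lin_shift] vecs_mono[OF y(1)]) auto
    moreover have "u = cone_d b d x 1 (y + shift (b 2) t)"
      using y t by (simp add: cone_d_def cone_tail_def front_eq rear_eq algebra_simps numeral_2_eq_2)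
    ultimately show "\<exists>y\<in>vecs (b 2 + b 1). u = cone_d b d x 1 y"
      by blast
  next
    assume "\<exists>y\<in>vecs (b 2 + b 1). u = cone_d b d x 1 y"
    then obtain y where y: "y \<in> vecs (b 2 + b 1)" "u = cone_d b d x 1 y"
      by blast
    define s t where "s = front (b 2) y" and "t = rear (b 2) y"
    have s: "s \<in> vecs (b (Suc (Suc 0)))" and t: "t \<in> vecs (b (Suc 0))"
      using lin_in[OF lin_front y(1)] lin_in[OF lin_rear y(1)] by (simp_all add: s_def t_def numeral_2_eq_2)
    have u_eq: "u = d 1 s + smul x t"
      using y(2) by (simp add: cone_d_def cone_tail_def s_def t_def numeral_2_eq_2)
    have in1: "d 1 s \<in> vecs (b (Suc 0))" "d 0 t \<in> vecs 1"
      using lin_in[OF lins[of 1]] lin_in[OF lins[of 0] t] s b0 by auto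
    have "d 0 u = d 0 (d 1 s) + smul x (d 0 t)"
      using in1 t x unfolding u_eq by (simp add: lin_add[OF lins] lin_smul[OF lins])
    moreover have "d 0 (d 1 s) \<in> one_vec P"
      using resolution_dd[OF r s] by (simp add: relations_def)
    ultimately show "d 0 u \<in> one_vec (adjoin P x)"
      using one_vec_adjoin_mono[OF x] one_vec_adjoin_smul[OF x in1(2) P]
        submod_add[OF submod_one_vec[OF ideal_in_adjoin[OF x P]]] by simp
  qed
  have ex_Suc: "cone_d b d x (Suc k) u = 0 \<longleftrightarrow>
      (\<exists>y\<in>vecs (b (Suc (Suc (Suc k))) + b (Suc (Suc k))). u = cone_d b d x (Suc (Suc k)) y)"
    if u: "u \<in> vecs (b (Suc (Suc k)) + b (Suc k))" for k u
  proof -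
    let ?i = "Suc k"
    define p q where "p = front (b (Suc ?i)) u" and "q = rear (b (Suc ?i)) u"
    have p: "p \<in> vecs (b (Suc ?i))" and q: "q \<in> vecs (b ?i)"
      using lin_in[OF lin_front u] lin_in[OF lin_rear u] by (simp_all add: p_def q_def)
    have u': "u \<in> vecs (cone_b b (Suc ?i))"
      using u by (simp add: cb)
    have zero: "cone_d b d x ?i u = 0 \<longleftrightarrow> d ?i p + smul x q = 0 \<and> cone_tail d ?i q = 0"
      unfolding split_eq_iff[of "cone_d b d x ?i u" 0 "b ?i"] cone_d_split[of b d x u ?i, OF lins x u']
      by (simp add: p_def q_def)
    have image: "u = cone_d b d x (Suc ?i) y \<longleftrightarrow>
        p = d (Suc ?i) (front (b (Suc (Suc ?i))) y) + smul x (rear (b (Suc (Suc ?i))) y) \<and>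
        q = - d ?i (rear (b (Suc (Suc ?i))) y)"
      if "y \<in> vecs (b (Suc (Suc ?i)) + b (Suc ?i))" for y
      unfolding split_eq_iff[of u "cone_d b d x (Suc ?i) y" "b (Suc ?i)"]
        cone_d_split[of b d x y "Suc ?i", OF lins x that[folded cb]]
      by (simp add: p_def q_def cone_tail_def)
    show ?thesis
    proof
      assume "cone_d b d x (Suc k) u = 0"
      then have 1: "d ?i p + smul x q = 0" and 2: "cone_tail d ?i q = 0"
        using zero by auto
      \<comment> \<open>This is where regularity enters. For k = 0 the tail of the cone differential
        is zero and says nothing about q, but x d(q) = - d(d(p)) lies in P, and x can be cancelled
        modulo P.\<close>
      have "d k q \<in> relations P k"
      proof (cases k)
        case 0
        have d0q: "d 0 q \<in> vecs 1"
          using lin_in[OF lins[of 0]] q 0 b0 by simp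
        have p2: "p \<in> vecs (b (Suc (Suc 0)))" and q1: "q \<in> vecs (b (Suc 0))"
          using p q 0 by auto
        have "smul x q = - d 1 p"
          using 1 0 by (simp add: add_eq_0_iff)
        then have "smul x (d 0 q) = - d 0 (d 1 p)"
          using lin_smul[OF lins x q1] lin_uminus[OF lins, of "d 1 p" 0] lin_in[OF lins p2] by simp
        moreover have "d 0 (d 1 p) \<in> one_vec P"
          using resolution_dd[OF r p2] by (simp add: relations_def)
        ultimately show ?thesis
          using reg1[OF d0q] submod_uminus[OF sP] 0 by (simp add: relations_def)
      next
        case (Suc m)
        then show ?thesis
          using 2 by (simp add: relations_def cone_tail_def)
      qed
      then obtain t' where t': "t' \<in> vecs (b (Suc ?i))" "q = d ?i t'"
        using exact[OF q] by blast
      define t where "t = - t'"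
      have t: "t \<in> vecs (b (Suc ?i))" "q = - d ?i t" and xt: "smul x t \<in> vecs (b (Suc ?i))"
        using t' x by (auto simp: t_def lin_uminus[OF lins])
      have "d ?i (p - smul x t) = 0"
        using 1 t by (simp add: lin_diff[OF lins p xt] lin_smul[OF lins x t(1)] smul_simps)
      then obtain s where s: "s \<in> vecs (b (Suc (Suc ?i)))" "p - smul x t = d (Suc ?i) s"
        using exact[of "p - smul x t" ?i] p xt by (auto simp: relations_def)
      let ?y = "s + shift (b (Suc (Suc ?i))) t"
      have y: "?y \<in> vecs (b (Suc (Suc ?i)) + b (Suc ?i))"
        using s t by (intro vecs_add lin_in[OF lin_shift] vecs_mono[OF s(1)]) auto
      have "front (b (Suc (Suc ?i))) ?y = s" "rear (b (Suc (Suc ?i))) ?y = t"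
        using s(1) by (simp_all add: front_eq rear_eq)
      then have "u = cone_d b d x (Suc ?i) ?y"
        using image[OF y] s(2) t(2) by (simp add: algebra_simps)
      with y show "\<exists>y\<in>vecs (b (Suc (Suc (Suc k))) + b (Suc (Suc k))). u = cone_d b d x (Suc (Suc k)) y"
        by blast
    next
      assume "\<exists>y\<in>vecs (b (Suc (Suc (Suc k))) + b (Suc (Suc k))). u = cone_d b d x (Suc (Suc k)) y"
      then obtain y where y: "y \<in> vecs (b (Suc (Suc ?i)) + b (Suc ?i))" "u = cone_d b d x (Suc ?i) y"
        by blast
      define s t where "s = front (b (Suc (Suc ?i))) y" and "t = rear (b (Suc (Suc ?i))) y"
      have s: "s \<in> vecs (b (Suc (Suc ?i)))" and t: "t \<in> vecs (b (Suc ?i))"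
        using lin_in[OF lin_front y(1)] lin_in[OF lin_rear y(1)] by (simp_all add: s_def t_def)
      have pq: "p = d (Suc ?i) s + smul x t" "q = - d ?i t"
        using image[OF y(1)] y(2) by (auto simp: s_def t_def)
      have in1: "d (Suc ?i) s \<in> vecs (b (Suc ?i))" "d ?i t \<in> vecs (b ?i)"
        using lin_in[OF lins] s t by auto
      have "d ?i p = d ?i (d (Suc ?i) s) + smul x (d ?i t)"
        unfolding pq using in1 t x by (simp add: lin_add[OF lins] lin_smul[OF lins])
      then have "d ?i p + smul x q = 0"
        using resolution_dd0[OF r s] by (simp add: pq smul_simps)
      moreover have "cone_tail d ?i q = 0"
      proof (cases k)
        case (Suc m)
        then show ?thesis
          using resolution_dd0[OF r, of t m] t lin_uminus[OF lins in1(2)] by (simp add: cone_tail_def pq)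
      qed (simp add: cone_tail_def)
      ultimately show "cone_d b d x (Suc k) u = 0"
        using zero by simp
    qed
  qed
  have "\<exists>u\<in>vecs (cone_b b 1). w - cone_d b d x 0 u \<in> one_vec (adjoin P x)" if w: "w \<in> vecs 1" for w
    using surj[OF w] d0 one_vec_adjoin_mono[OF x] cb(2) by (metis One_nat_def)
  moreover have "cone_d b d x i u \<in> relations (adjoin P x) i \<longleftrightarrow>
      (\<exists>y\<in>vecs (cone_b b (Suc (Suc i))). u = cone_d b d x (Suc i) y)" if u: "u \<in> vecs (cone_b b (Suc i))" for i u
  proof (cases i)
    case 0
    then show ?thesis
      using ex0[of u] d0[of u] u by (simp add: relations_def cb numeral_2_eq_2)
  next
    case (Suc k)
    then show ?thesis
      using ex_Suc[of u k] u by (simp add: relations_def cb)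
  qed
  ultimately show ?thesis
    unfolding resolves_def using ideal_in_adjoin[OF x P] cb(1) cl by blast
qed

section \<open>Cohomology of mapping cones\<close>

lemma cone_d_front:
  assumes "\<And>i. lin (b (Suc i)) (b i) (d i)" "u \<in> vecs (b (Suc i))"
  shows "cone_d b d x i u = d i u"
  using assms(2) lin_0[OF assms(1)] by (simp add: cone_d_def front_eq rear_eq smul_simps cone_tail_def)

lemma cone_d_shift:
  assumes "\<And>i. lin (b (Suc i)) (b i) (d i)"
  shows "cone_d b d x i (shift (b (Suc i)) v) = smul x v + shift (b i) (- cone_tail d i v)"
  using lin_0[OF assms] by (simp add: cone_d_def)

lemma one_vec_regular:
  assumes "\<And>p. p \<in> A \<Longrightarrow> x * p \<in> J \<Longrightarrow> p \<in> J" "v \<in> vecs 1" "smul x v \<in> one_vec J"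
  shows "v \<in> one_vec J"
  using assms vecs_in by (auto simp: one_vec_def)

text \<open>When the cone resolves A/(P, x), this is the half of Ext^j(A/(P, x), A/J) =
  Ext^(j-1)(A/P, A/(J, x)) that transfers vanishing. For j = 0 regularity of x on A/J is enough,
  because the cocycle condition puts x h into J.\<close>

theorem cone_vanishes:
  assumes r: "resolves P b d" and x: "x \<in> A" and J: "ideal_in J"
    and reg: "\<And>p. p \<in> A \<Longrightarrow> x * p \<in> J \<Longrightarrow> p \<in> J"
    and van: "\<And>i. j = Suc i \<Longrightarrow> cohomology_vanishes b d (adjoin J x) i"
  shows "cohomology_vanishes (cone_b b) (cone_d b d x) J j"
  unfolding cohomology_vanishes_def
proof (intro allI impI, elim conjE)
  fix h
  assume h: "lin (cone_b b (Suc j)) 1 h"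
    and cocycle: "\<forall>u\<in>vecs (cone_b b (Suc (Suc j))). h (cone_d b d x (Suc j) u) \<in> one_vec J"
  have lins: "lin (b (Suc i)) (b i) (d i)" for i
    using r by (simp add: resolves_def)
  note sJ = submod_one_vec[OF J]
  have cb: "cone_b b (Suc (Suc j)) = b (Suc (Suc j)) + b (Suc j)"
    by (simp add: cone_b_def cone_rank_def)
  have shift_in: "shift (b (Suc j)) v \<in> vecs (cone_b b (Suc j))" if "v \<in> vecs (cone_rank b (Suc j))" for v
    unfolding cone_b_def by (rule lin_in[OF lin_shift that])
  have incl: "v \<in> vecs (cone_b b (Suc j))" if "v \<in> vecs (b (Suc j))" for v
    by (rule vecs_mono[OF that]) (simp add: cone_b_def)
  have h1: "lin (b (Suc j)) 1 h"
    using lin_comp[OF lin_inclusion h, of "b (Suc j)"] by (simp add: cone_b_def)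
  have tail: "cone_tail d (Suc j) v \<in> vecs (cone_rank b (Suc j))" if "v \<in> vecs (b (Suc j))" for v
    using lin_in[OF lin_cone_tail[of b d "Suc j", OF lins]] that by (simp add: cone_rank_def)
  have c1: "h (d (Suc j) u) \<in> one_vec J" if "u \<in> vecs (b (Suc (Suc j)))" for u
    using cocycle[rule_format, of u] vecs_mono[OF that] that cone_d_front[of b d u "Suc j", OF lins]
    by (simp add: cb)
  have c2: "smul x (h v) - h (shift (b (Suc j)) (cone_tail d (Suc j) v)) \<in> one_vec J"
    if v: "v \<in> vecs (b (Suc j))" for v
  proof -
    have "h (cone_d b d x (Suc j) (shift (b (Suc (Suc j))) v)) \<in> one_vec J"
      using cocycle lin_in[OF lin_shift v] by (simp add: cb)
    then have "h (smul x v - shift (b (Suc j)) (cone_tail d (Suc j) v)) \<in> one_vec J"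
      by (simp add: cone_d_shift[of b d, OF lins])
    moreover have "smul x v \<in> vecs (cone_b b (Suc j))"
      using incl v x by simp
    ultimately show ?thesis
      using lin_diff[OF h _ shift_in[OF tail[OF v]], of "smul x v"] lin_smul[OF h x incl[OF v]] by simp
  qed
  show "\<exists>g. lin (cone_b b j) 1 g \<and> (j = 0 \<longrightarrow> g = (\<lambda>_. 0)) \<and>
    (\<forall>u\<in>vecs (cone_b b (Suc j)). h u - g (cone_d b d x j u) \<in> one_vec J)"
  proof (cases j)
    case 0
    have "h v \<in> one_vec J" if "v \<in> vecs (cone_b b (Suc j))" for v
    proof -
      have v: "v \<in> vecs (b (Suc j))"
        using that 0 by (simp add: cone_b_def cone_rank_def)
      have "smul x (h v) \<in> one_vec J"
        using c2[OF v] 0 lin_0[OF h] by (simp add: cone_tail_def)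
      then show ?thesis
        using one_vec_regular[OF reg lin_in[OF h that]] by blast
    qed
    then show ?thesis
      by (intro exI[of _ "\<lambda>_. 0"]) (auto simp: lin_zero_map)
  next
    case (Suc i)
    let ?h2 = "\<lambda>v. h (shift (b (Suc j)) v)"
    have rank: "cone_rank b (Suc j) = b (Suc i)"
      using Suc by (simp add: cone_rank_def)
    have h2: "lin (b (Suc i)) 1 ?h2"
      using lin_comp[OF lin_shift h[unfolded cone_b_def]] by (simp add: rank)
    have c2': "smul x (h v) - ?h2 (d j v) \<in> one_vec J" if "v \<in> vecs (b (Suc j))" for v
      using c2[OF that] Suc by (simp add: cone_tail_def)
    have dj: "d j v \<in> vecs (b (Suc i))" if "v \<in> vecs (b (Suc j))" for v
      using lin_in[OF lins that] Suc by simp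
    \<comment> \<open>On the second block, h composed with d is x h modulo J, by the cocycle
      condition \<open>c2'\<close>; so the second block of h is a cocycle modulo (J, x), one degree
      lower.\<close>
    have "?h2 (d (Suc i) v) \<in> one_vec (adjoin J x)" if "v \<in> vecs (b (Suc (Suc i)))" for v
    proof -
      have v: "v \<in> vecs (b (Suc j))"
        using that Suc by simp
      have "?h2 (d j v) - smul x (h v) \<in> one_vec J"
        using submod_uminus[OF sJ c2'[OF v]] by simp
      then show ?thesis
        using one_vec_adjoinI[OF x lin_in[OF h2 dj[OF v]] lin_in[OF h1 v]] Suc by simp
    qed
    then obtain g2 where g2: "lin (b i) 1 g2" "i = 0 \<longrightarrow> g2 = (\<lambda>_. 0)"
      "\<And>v. v \<in> vecs (b (Suc i)) \<Longrightarrow> ?h2 v - g2 (d i v) \<in> one_vec (adjoin J x)"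
      using van[OF Suc] h2 unfolding cohomology_vanishes_def by blast
    have f: "lin (b (Suc i)) 1 (\<lambda>v. ?h2 v - g2 (d i v))"
      by (intro lin_minus h2 lin_comp[OF lins g2(1)])
    obtain g1 where g1: "lin (b (Suc i)) 1 g1"
      "\<And>v. v \<in> vecs (b (Suc i)) \<Longrightarrow> ?h2 v - g2 (d i v) - smul x (g1 v) \<in> one_vec J"
    proof (rule lin_lift[OF f lin_scale[OF x] sJ])
      show "\<exists>y\<in>vecs 1. ?h2 (unit_vec k) - g2 (d i (unit_vec k)) - smul x y \<in> one_vec J"
        if "k < b (Suc i)" for k
        using one_vec_adjoin[OF x g2(3)[of "unit_vec k"]] that by (metis unit_vec_in)
    qed blast
    \<comment> \<open>Modulo J the second block satisfies h2 = g2 d + x g1. So \<open>g1\<close>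
      serves on the first block, where x v produces the term x g1, and \<open>- g2\<close> on the
      second, where the sign of the cone differential turns it into g2 d.\<close>
    define g where "g = (\<lambda>z. g1 (front (b j) z) - g2 (rear (b j) z))"
    have "lin (b j + cone_rank b j) 1 (\<lambda>z. g2 (rear (b j) z))"
    proof (cases "i = 0")
      case True
      then show ?thesis
        using g2(2) by (simp add: lin_zero_map)
    next
      case False
      then have "cone_rank b j = b i"
        using Suc by (simp add: cone_rank_def)
      then show ?thesis
        using lin_comp[OF lin_rear g2(1)] by simp
    qed
    then have g: "lin (cone_b b j) 1 g"
      unfolding g_def cone_b_def using lin_comp[OF lin_front g1(1)[folded Suc]] by (intro lin_minus) auto
    have "h z - g (cone_d b d x j z) \<in> one_vec J" if z: "z \<in> vecs (cone_b b (Suc j))" for z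
    proof -
      define u v where "u = front (b (Suc j)) z" and "v = rear (b (Suc j)) z"
      have u: "u \<in> vecs (b (Suc j))" and v: "v \<in> vecs (b (Suc i))"
        using lin_in[OF lin_front z[unfolded cone_b_def]] lin_in[OF lin_rear z[unfolded cone_b_def]]
        by (simp_all add: u_def v_def rank)
      have "h (u + shift (b (Suc j)) v) = h z"
        unfolding u_def v_def front_rear ..
      then have hz: "h z = h u + ?h2 v"
        using lin_add[OF h incl[OF u] shift_in[unfolded rank, OF v]] by simp
      have vj: "smul x v \<in> vecs (b (Suc i))" and v': "v \<in> vecs (b j)"
        using v x Suc by auto
      have "g2 (- cone_tail d j v) = - g2 (d i v)"
      proof (cases "i = 0")
        case True
        then show ?thesis
          using g2(2) by simp
      next
        case False
        then show ?thesis
          using Suc lin_uminus[OF g2(1)] lin_in[OF lins v] by (simp add: cone_tail_def)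
      qed
      then have gz: "g (cone_d b d x j z) = g1 (d j u) + smul x (g1 v) + g2 (d i v)"
        unfolding g_def cone_d_split[of b d x z j, OF lins x z] u_def[symmetric] v_def[symmetric]
        using lin_add[OF g1(1) dj[OF u] vj] lin_smul[OF g1(1) x v] by simp
      have in1: "h u - g1 (d j u) \<in> vecs 1"
        using lin_in[OF h1 u] lin_in[OF g1(1) dj[OF u]] by simp
      have "g2 (d i (d j u)) = 0"
        using coboundary_dd[OF r g2(1,2)] u Suc by simp
      \<comment> \<open>The relation for the second block is evaluated at d u, where the term with
        g2 drops out; what remains is x times the wanted relation on the first block, and x cancels
        modulo J.\<close>
      then have "smul x (h u - g1 (d j u)) = (smul x (h u) - ?h2 (d j u)) +
          (?h2 (d j u) - g2 (d i (d j u)) - smul x (g1 (d j u)))"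
        by (simp add: smul_simps)
      then have "smul x (h u - g1 (d j u)) \<in> one_vec J"
        using submod_add[OF sJ c2'[OF u] g1(2)[OF dj[OF u]]] by (simp only:)
      then have 1: "h u - g1 (d j u) \<in> one_vec J"
        using one_vec_regular[OF reg in1] by blast
      show ?thesis
        using submod_add[OF sJ 1 g1(2)[OF v]] unfolding hz gz by (simp add: algebra_simps)
    qed
    then show ?thesis
      using g Suc by blast
  qed
qed

text \<open>Exactness of Ext^j(A/P, A/J) -> Ext^j(A/P, A/J) -> Ext^(j+1)(A/(P, x), A/J), the first
  map being multiplication by x: if the last group vanishes, every cocycle h is x times a cocycle up
  to a coboundary.\<close>

theorem cone_vanishes_surj:
  assumes r: "resolves P b d" and x: "x \<in> A" and J: "ideal_in J"
    and van: "cohomology_vanishes (cone_b b) (cone_d b d x) J (Suc j)"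
    and h: "lin (b (Suc j)) 1 h" and cocycle: "\<And>u. u \<in> vecs (b (Suc (Suc j))) \<Longrightarrow> h (d (Suc j) u) \<in> one_vec J"
  obtains g g' where "lin (b (Suc j)) 1 g" "\<And>u. u \<in> vecs (b (Suc (Suc j))) \<Longrightarrow> g (d (Suc j) u) \<in> one_vec J"
    "lin (b j) 1 g'" "j = 0 \<longrightarrow> g' = (\<lambda>_. 0)"
    "\<And>v. v \<in> vecs (b (Suc j)) \<Longrightarrow> h v - smul x (g v) - g' (d j v) \<in> one_vec J"
proof -
  have lins: "lin (b (Suc i)) (b i) (d i)" for i
    using r by (simp add: resolves_def)
  note sJ = submod_one_vec[OF J]
  have cb: "cone_b b (Suc (Suc i)) = b (Suc (Suc i)) + b (Suc i)" for i
    by (simp add: cone_b_def cone_rank_def)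
  have incl: "v \<in> vecs (cone_b b i)" if "v \<in> vecs (b i)" for v i
    by (rule vecs_mono[OF that]) (simp add: cone_b_def)
  \<comment> \<open>The connecting map: h placed on the second block of the cone, one degree
    higher.\<close>
  let ?H = "\<lambda>z. h (rear (b (Suc (Suc j))) z)"
  have "lin (cone_b b (Suc (Suc j))) 1 ?H"
    unfolding cb by (rule lin_comp[OF lin_rear h])
  moreover have "?H (cone_d b d x (Suc (Suc j)) z) \<in> one_vec J" if z: "z \<in> vecs (cone_b b (Suc (Suc (Suc j))))" for z
  proof -
    let ?v = "rear (b (Suc (Suc (Suc j)))) z"
    have v: "?v \<in> vecs (b (Suc (Suc j)))"
      by (rule lin_in[OF lin_rear z[unfolded cb]])
    show ?thesis
      unfolding cone_d_split(2)[of b d x z "Suc (Suc j)", OF lins x z]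
      using submod_uminus[OF sJ cocycle[OF v]] lin_uminus[OF h lin_in[OF lins v]] by (simp add: cone_tail_def)
  qed
  ultimately obtain g where g: "lin (cone_b b (Suc j)) 1 g"
    "\<And>z. z \<in> vecs (cone_b b (Suc (Suc j))) \<Longrightarrow> ?H z - g (cone_d b d x (Suc j) z) \<in> one_vec J"
    using van unfolding cohomology_vanishes_def by blast
  \<comment> \<open>The second block of the primitive, up to the sign of the cone differential. For
    j = 0 this block is empty, as level 1 of the cone is not doubled, so zero is the right
    value.\<close>
  define g' where "g' = (\<lambda>w. if j = 0 then 0 else - g (shift (b (Suc j)) w))"
  have "lin (b (Suc j)) 1 g"
    using lin_comp[OF lin_inclusion g(1), of "b (Suc j)"] by (simp add: cone_b_def)
  moreover have "g (d (Suc j) u) \<in> one_vec J" if u: "u \<in> vecs (b (Suc (Suc j)))" for u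
    using submod_uminus[OF sJ g(2)[OF incl[OF u]]] u cone_d_front[of b d u "Suc j", OF lins u] lin_0[OF h]
    by (simp add: rear_eq)
  moreover have "lin (b j) 1 g'"
  proof (cases j)
    case 0
    then show ?thesis
      by (simp add: g'_def lin_zero_map)
  next
    case (Suc i)
    have "lin (b j) (cone_b b (Suc j)) (shift (b (Suc j)))"
      unfolding cone_b_def cone_rank_def using lin_shift Suc by simp
    then show ?thesis
      using lin_neg[OF lin_comp[OF _ g(1)]] Suc by (simp add: g'_def)
  qed
  moreover have "h v - smul x (g v) - g' (d j v) \<in> one_vec J" if v: "v \<in> vecs (b (Suc j))" for v
  proof -
    have sv: "shift (b (Suc (Suc j))) v \<in> vecs (cone_b b (Suc (Suc j)))"
      unfolding cb by (rule lin_in[OF lin_shift v])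
    have xv: "smul x v \<in> vecs (cone_b b (Suc j))"
      using incl[OF v] x by simp
    have tail: "shift (b (Suc j)) (cone_tail d (Suc j) v) \<in> vecs (cone_b b (Suc j))"
      using lin_in[OF lin_shift lin_in[OF lin_cone_tail[of b d "Suc j", OF lins]]] v
      by (simp add: cone_b_def cone_rank_def)
    have "g' (d j v) = - g (shift (b (Suc j)) (cone_tail d (Suc j) v))"
      using lin_0[OF g(1)] by (simp add: g'_def cone_tail_def)
    then show ?thesis
      using g(2)[OF sv] lin_diff[OF g(1) xv tail] lin_smul[OF g(1) x incl[OF v]]
      by (simp add: cone_d_shift[of b d, OF lins] algebra_simps)
  qed
  ultimately show ?thesis
    using that g'_def by auto
qed

text \<open>The cohomology of the cone controls that of the original complex by a graded Nakayama
  argument: \<open>\<tau> a\<close> truncates to degree less than \<open>a\<close>, and the differentials have degree \<open>0\<close>.\<close>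

theorem cone_vanishes_imp:
  assumes r: "resolves P b d" and x: "x \<in> A" and J: "ideal_in J"
    and van: "cohomology_vanishes (cone_b b) (cone_d b d x) J (Suc j)"
    and \<tau>_in: "\<And>a p. p \<in> A \<Longrightarrow> \<tau> a p \<in> A"
    and \<tau>_add: "\<And>a p q. \<tau> a (p + q) = \<tau> a p + \<tau> a q"
    and \<tau>_J: "\<And>a p. p \<in> J \<Longrightarrow> \<tau> a p \<in> J"
    and \<tau>_0: "\<And>p. \<tau> 0 p = 0"
    and \<tau>_Suc: "\<And>a p. \<tau> (Suc a) (x * p) = x * \<tau> a p"
    and \<tau>_large: "\<And>p. \<exists>a. \<forall>a'\<ge>a. \<tau> a' p = p"
    and \<tau>_d: "\<And>a i k l p. k < b (Suc i) \<Longrightarrow> 0 < i \<Longrightarrow> \<tau> a (d i (unit_vec k) l * p) = d i (unit_vec k) l * \<tau> a p"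
  shows "cohomology_vanishes b d J j"
proof -
  have lins: "lin (b (Suc i)) (b i) (d i)" for i
    using r by (simp add: resolves_def)
  note sJ = submod_one_vec[OF J]
  have \<tau>_zero: "\<tau> a 0 = 0" for a
    using \<tau>_add[of a 0 0] by simp
  have \<tau>_sum: "\<tau> a (sum f S) = (\<Sum>k\<in>S. \<tau> a (f k))" for a and f :: "nat \<Rightarrow> 'a" and S
    by (induction S rule: infinite_finite_induct) (auto simp: \<tau>_zero \<tau>_add)
  have \<tau>_uminus: "\<tau> a (- p) = - \<tau> a p" for a p
    using \<tau>_add[of a p "- p"] by (simp add: \<tau>_zero add_eq_0_iff)
  have \<tau>_diff: "\<tau> a (p - q) = \<tau> a p - \<tau> a q" for a p q
    using \<tau>_add[of a p "- q"] by (simp add: \<tau>_uminus)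
  define T where "T n a h = (\<lambda>u::nat \<Rightarrow> 'a. \<Sum>k<n. smul (u k) (\<lambda>l. \<tau> a (h (unit_vec k) l)))"
    for n a and h :: "(nat \<Rightarrow> 'a) \<Rightarrow> nat \<Rightarrow> 'a"
  have \<tau>_vec: "(\<lambda>l. \<tau> a (w l)) \<in> vecs m" if "w \<in> vecs m" for w a m
    using that \<tau>_in by (auto simp: vecs_def \<tau>_zero)
  have T_lin: "lin n m (T n a h)" if "lin n m h" for n m a h
    unfolding T_def by (rule lin_combination) (rule \<tau>_vec, rule lin_in[OF that], simp)
  have T_unit: "T n a h (unit_vec k) = (\<lambda>l. \<tau> a (h (unit_vec k) l))" if "k < n" for n a h k
    unfolding T_def by (rule combination_unit_vec[OF that])
  have T_comp: "T (b (Suc i)) a (\<lambda>u. h (d i u)) u = T (b i) a h (d i u)"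
    if h: "lin (b i) 1 h" and i: "0 < i" and u: "u \<in> vecs (b (Suc i))" for i a h u
  proof (rule lin_eqI[OF T_lin[OF lin_comp[OF lins h]] lin_comp[OF lins T_lin[OF h]] _ u])
    fix k
    assume k: "k < b (Suc i)"
    let ?w = "d i (unit_vec k)"
    have w: "?w \<in> vecs (b i)"
      using k by (intro lin_in[OF lins]) simp
    show "T (b (Suc i)) a (\<lambda>u. h (d i u)) (unit_vec k) = T (b i) a h ?w"
    proof
      fix l
      have "T (b (Suc i)) a (\<lambda>u. h (d i u)) (unit_vec k) l = \<tau> a (h ?w l)"
        using k by (simp add: T_unit)
      also have "h ?w l = (\<Sum>m<b i. ?w m * h (unit_vec m) l)"
        unfolding lin_expand[OF h w] by (simp add: sum_fun_apply)
      also have "\<tau> a \<dots> = (\<Sum>m<b i. ?w m * \<tau> a (h (unit_vec m) l))"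
        using k i by (simp add: \<tau>_sum \<tau>_d)
      also have "\<dots> = T (b i) a h ?w l"
        by (simp add: T_def sum_fun_apply)
      finally show "T (b (Suc i)) a (\<lambda>u. h (d i u)) (unit_vec k) l = T (b i) a h ?w l" .
    qed
  qed
  have T_J: "T n a h u \<in> one_vec J" if "lin n 1 h" "\<And>u. u \<in> vecs n \<Longrightarrow> h u \<in> one_vec J" "u \<in> vecs n" for n a h u
  proof (rule lin_in_submodI[OF T_lin[OF that(1)] sJ _ that(3)])
    show "T n a h (unit_vec k) \<in> one_vec J" if "k < n" for k
      using that \<open>\<And>u. u \<in> vecs n \<Longrightarrow> h u \<in> one_vec J\<close>[of "unit_vec k"] \<tau>_vec \<tau>_J
      by (simp add: T_unit one_vec_def)
  qed
  \<comment> \<open>Induction on the truncation degree. Since h = x g + g' d modulo J, truncating h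
    below a + 1 amounts to truncating g below a, apart from coboundaries. Below degree 0 nothing is
    left.\<close>
  have step: "\<exists>g. lin (b j) 1 g \<and> (j = 0 \<longrightarrow> g = (\<lambda>_. 0)) \<and>
      (\<forall>u\<in>vecs (b (Suc j)). T (b (Suc j)) a h u - g (d j u) \<in> one_vec J)"
    if "lin (b (Suc j)) 1 h" "\<And>u. u \<in> vecs (b (Suc (Suc j))) \<Longrightarrow> h (d (Suc j) u) \<in> one_vec J" for a h
    using that
  proof (induction a arbitrary: h)
    case 0
    have "T (b (Suc j)) 0 h u = 0" for u
      by (auto simp: T_def \<tau>_0 fun_eq_iff sum_fun_apply)
    then have "T (b (Suc j)) 0 h u - (\<lambda>_. 0) (d j u) \<in> one_vec J" for u
      using submod_0[OF sJ] by (simp only: diff_self)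
    then show ?case
      using lin_zero_map by blast
  next
    case (Suc a)
    note h = Suc.prems
    let ?n = "b (Suc j)"
    obtain g g' where g: "lin (b (Suc j)) 1 g" "\<And>u. u \<in> vecs (b (Suc (Suc j))) \<Longrightarrow> g (d (Suc j) u) \<in> one_vec J"
      and g': "lin (b j) 1 g'" "j = 0 \<longrightarrow> g' = (\<lambda>_. 0)"
      and eq: "\<And>v. v \<in> vecs (b (Suc j)) \<Longrightarrow> h v - smul x (g v) - g' (d j v) \<in> one_vec J"
      using cone_vanishes_surj[OF r x J van h] by metis
    obtain f where f: "lin (b j) 1 f" "j = 0 \<longrightarrow> f = (\<lambda>_. 0)"
      "\<And>u. u \<in> vecs (b (Suc j)) \<Longrightarrow> T ?n a g u - f (d j u) \<in> one_vec J"
      using Suc.IH[OF g] by blast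
    define k where "k = (\<lambda>w. smul x (f w) + T (b j) (Suc a) g' w)"
    have T0: "T m a' (\<lambda>_. 0) = (\<lambda>_. 0)" for m a'
      by (auto simp: T_def \<tau>_zero zero_fun_def[symmetric] smul_simps)
    have "lin (b j) 1 k"
      unfolding k_def by (intro lin_plus lin_comp[OF f(1) lin_scale[OF x]] T_lin g')
    moreover have "j = 0 \<longrightarrow> k = (\<lambda>_. 0)"
      using f(2) g'(2) T0 by (auto simp: k_def smul_simps)
    moreover have "T ?n (Suc a) h u - k (d j u) \<in> one_vec J" if u: "u \<in> vecs ?n" for u
    proof -
      let ?R = "\<lambda>v. h v - smul x (g v) - g' (d j v)"
      have lR: "lin ?n 1 ?R"
        by (intro lin_minus h lin_comp[OF g(1) lin_scale[OF x]] lin_comp[OF lins g'(1)])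
      have 1: "T ?n (Suc a) ?R u \<in> one_vec J"
        by (rule T_J[OF lR eq u])
      have 2: "smul x (T ?n a g u - f (d j u)) \<in> one_vec J"
        by (rule submod_smul[OF sJ x f(3)[OF u]])
      \<comment> \<open>Truncation commutes with the differentials above the augmentation only; in
        degree 0 the term vanishes because \<open>g'\<close> is zero.\<close>
      have 3: "T ?n (Suc a) (\<lambda>v. g' (d j v)) u = T (b j) (Suc a) g' (d j u)"
      proof (cases "j = 0")
        case True
        then show ?thesis
          using g'(2) T0 by simp
      next
        case False
        then show ?thesis
          using T_comp[OF g'(1) _ u] by simp
      qed
      have "T ?n (Suc a) h u = T ?n (Suc a) ?R u + smul x (T ?n a g u) + T ?n (Suc a) (\<lambda>v. g' (d j v)) u"
      proof
        fix l
        have "\<tau> (Suc a) (h w l) = \<tau> (Suc a) (?R w l) + x * \<tau> a (g w l) + \<tau> (Suc a) (g' (d j w) l)" for w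
          by (simp add: \<tau>_diff \<tau>_Suc)
        then show "T ?n (Suc a) h u l = (T ?n (Suc a) ?R u + smul x (T ?n a g u) + T ?n (Suc a) (\<lambda>v. g' (d j v)) u) l"
          unfolding T_def plus_fun_apply smul_apply sum_fun_apply sum_distrib_left sum.distrib[symmetric]
          by (simp add: distrib_left mult.left_commute)
      qed
      then have "T ?n (Suc a) h u - k (d j u) = T ?n (Suc a) ?R u + smul x (T ?n a g u - f (d j u))"
        using 3 by (simp add: k_def smul_simps)
      then show ?thesis
        using submod_add[OF sJ 1 2] by (simp only:)
    qed
    ultimately show ?case
      by blast
  qed
  show ?thesis
    unfolding cohomology_vanishes_def
  proof (intro allI impI, elim conjE)
    fix h
    assume h: "lin (b (Suc j)) 1 h" "\<forall>u\<in>vecs (b (Suc (Suc j))). h (d (Suc j) u) \<in> one_vec J"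
    have "\<forall>k. \<exists>a. \<forall>a'\<ge>a. \<tau> a' (h (unit_vec k) 0) = h (unit_vec k) 0"
      using \<tau>_large by blast
    then obtain a where a: "\<forall>k. \<forall>a'\<ge>a k. \<tau> a' (h (unit_vec k) 0) = h (unit_vec k) 0"
      by (rule choice[THEN exE])
    \<comment> \<open>A linear map has finitely many columns, so one bound works for all of them and
      the truncation at c is h itself.\<close>
    define c where "c = Max (a ` {..<b (Suc j)})"
    have c: "a k \<le> c" if "k < b (Suc j)" for k
      unfolding c_def by (rule Max_ge) (use that in blast)+
    have "T (b (Suc j)) c h u = h u" if u: "u \<in> vecs (b (Suc j))" for u
    proof (rule lin_eqI[OF T_lin[OF h(1)] h(1) _ u])
      fix k
      assume k: "k < b (Suc j)"
      have "h (unit_vec k) \<in> vecs 1"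
        using k by (intro lin_in[OF h(1)]) simp
      then have "h (unit_vec k) l = 0" if "l \<noteq> 0" for l
        using that by (auto simp: vecs_def)
      then have "\<tau> c (h (unit_vec k) l) = h (unit_vec k) l" for l
        using a[rule_format, OF c[OF k]] by (cases "l = 0") (auto simp: \<tau>_zero)
      then show "T (b (Suc j)) c h (unit_vec k) = h (unit_vec k)"
        using k by (simp add: T_unit)
    qed
    then show "\<exists>g. lin (b j) 1 g \<and> (j = 0 \<longrightarrow> g = (\<lambda>_. 0)) \<and>
        (\<forall>u\<in>vecs (b (Suc j)). h u - g (d j u) \<in> one_vec J)"
      using step[OF h(1), of c] h(2) by simp
  qed
qed

end

section \<open>Stanley-Reisner ideals\<close>

abbreviation "lookup \<equiv> Poly_Mapping.lookup"
abbreviation "keys \<equiv> Poly_Mapping.keys"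
abbreviation "single \<equiv> Poly_Mapping.single"

definition polys :: "'v set \<Rightarrow> ('v, 'k::field) mpoly set" where
  "polys V = {p. \<forall>m\<in>keys p. keys m \<subseteq> V}"

lemma keys_add_nat: "keys (m + n) = keys m \<union> keys n" for m n :: "'v \<Rightarrow>\<^sub>0 nat"
  by (auto simp: in_keys_iff lookup_add)

lemma keys_multE:
  fixes p q :: "('v, 'k::field) mpoly"
  assumes "m \<in> keys (p * q)"
  obtains m1 m2 where "m1 \<in> keys p" "m2 \<in> keys q" "m = m1 + m2"
  using assms keys_mult[of p q] by blast

lemma keys_addE:
  fixes p q :: "('v, 'k::field) mpoly"
  assumes "m \<in> keys (p + q)"
  obtains "m \<in> keys p" | "m \<in> keys q"
  using assms Poly_Mapping.keys_add[of p q] by blast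

lemma keys_uminus: "keys (- p) = keys p" for p :: "('v, 'k::field) mpoly"
  by (auto simp: in_keys_iff)

interpretation P: coeff_ring "polys V :: ('v, 'k::field) mpoly set" for V
proof
  show "0 \<in> polys V" "1 \<in> polys V"
    by (auto simp: polys_def)
  show "a + b \<in> polys V" if "a \<in> polys V" "b \<in> polys V" for a b :: "('v, 'k) mpoly"
    using that by (auto simp: polys_def elim!: keys_addE)
  show "a * b \<in> polys V" if "a \<in> polys V" "b \<in> polys V" for a b :: "('v, 'k) mpoly"
    using that by (fastforce simp: polys_def keys_add_nat elim!: keys_multE)
  show "- a \<in> polys V" if "a \<in> polys V" for a :: "('v, 'k) mpoly"
    using that by (auto simp: polys_def keys_uminus)
qed

lemma lookup_single_mult:
  "lookup (single a c * p) (a + m) = c * lookup p m" for p :: "('v, 'k::field) mpoly"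
proof -
  have "lookup (single a c * p) (a + m) =
      (\<Sum>l. lookup (single a c) l * (\<Sum>q. lookup p q when a + m = l + q))"
    by (simp add: lookup_mult)
  also have "\<dots> = (\<Sum>l. c * (\<Sum>q. lookup p q when m = q) when l = a)"
    by (rule Sum_any.cong) (auto simp: lookup_single when_def)
  finally show ?thesis
    by simp
qed

lemma pvar_in [simp]: "pvar x \<in> polys V \<longleftrightarrow> x \<in> V"
  by (auto simp: pvar_def polys_def)

lemma lookup_pvar_mult: "lookup (pvar x * p) (m + single x 1) = lookup p m"
  using lookup_single_mult[of "single x 1" 1 p m] by (simp add: pvar_def add.commute)

lemma keys_add_var: "keys (m + single x (1::nat)) = insert x (keys m)"
  by (auto simp: in_keys_iff lookup_add lookup_single when_def split: if_splits)

lemma monomial_div: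
  assumes "x \<in> keys (m :: 'v \<Rightarrow>\<^sub>0 nat)"
  obtains n where "m = n + single x 1"
proof
  show "m = (m - single x 1) + single x 1"
    using assms by (intro poly_mapping_eqI) (auto simp: lookup_add lookup_minus lookup_single when_def in_keys_iff)
qed

lemma lookup_pvar_mult_0:
  assumes "x \<notin> keys m"
  shows "lookup (pvar x * p) m = 0"
proof (rule ccontr)
  assume "lookup (pvar x * p) m \<noteq> 0"
  then have "m \<in> keys (pvar x * p)"
    by (simp add: in_keys_iff)
  then obtain m1 m2 where "m1 \<in> keys (pvar x :: ('a, 'b) mpoly)" "m = m1 + m2"
    by (rule keys_multE)
  then show False
    using assms by (auto simp: pvar_def keys_add_nat)
qed

lemma keys_pvar_mult: "keys (pvar x * p) = (\<lambda>m. m + single x 1) ` keys p"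
proof (intro Set.set_eqI iffI)
  fix m
  assume m: "m \<in> keys (pvar x * p)"
  then have "x \<in> keys m"
    using lookup_pvar_mult_0[of x m p] by (auto simp: in_keys_iff)
  then obtain n where "m = n + single x 1"
    by (rule monomial_div)
  then show "m \<in> (\<lambda>m. m + single x 1) ` keys p"
    using m lookup_pvar_mult[of x p n] by (auto simp: in_keys_iff)
next
  fix m
  assume "m \<in> (\<lambda>m. m + single x 1) ` keys p"
  then show "m \<in> keys (pvar x * p)"
    using lookup_pvar_mult[of x p] by (auto simp: in_keys_iff)
qed

section \<open>Monomial projections and division by a variable\<close>

definition select :: "(('v \<Rightarrow>\<^sub>0 nat) \<Rightarrow> bool) \<Rightarrow> ('v, 'k::field) mpoly \<Rightarrow> ('v, 'k) mpoly" where
  "select Q p = Abs_poly_mapping (\<lambda>m. if Q m then lookup p m else 0)"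

lemma lookup_select: "lookup (select Q p) m = (if Q m then lookup p m else 0)"
proof -
  have "finite {m. (if Q m then lookup p m else 0) \<noteq> 0}"
    by (rule finite_subset[OF _ finite_lookup[of p]]) auto
  then show ?thesis
    by (simp add: select_def)
qed

lemma keys_select: "keys (select Q p) = {m \<in> keys p. Q m}"
  by (auto simp: in_keys_iff lookup_select split: if_splits)

lemma select_add: "select Q (p + q) = select Q p + select Q q"
  by (rule poly_mapping_eqI) (simp add: lookup_select lookup_add)

lemma select_uminus: "select Q (- p) = - select Q p"
  by (rule poly_mapping_eqI) (simp add: lookup_select)

lemma select_pvar_mult: "select Q (pvar x * p) = pvar x * select (\<lambda>m. Q (m + single x 1)) p"
proof (rule poly_mapping_eqI)
  fix m
  show "lookup (select Q (pvar x * p)) m = lookup (pvar x * select (\<lambda>m. Q (m + single x 1)) p) m"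
  proof (cases "x \<in> keys m")
    case True
    then obtain n where "m = n + single x 1"
      by (rule monomial_div)
    then show ?thesis
      by (simp only: lookup_pvar_mult lookup_select)
  next
    case False
    then show ?thesis
      by (simp add: lookup_pvar_mult_0 lookup_select)
  qed
qed

text \<open>Division with remainder by a variable: the remainder collects the monomials free of x,
  and the coefficient of the quotient at m is that of p at m times x.\<close>

lemma pvar_quotient:
  obtains q where "p = select (\<lambda>m. x \<notin> keys m) p + pvar x * q"
    "\<And>m. m \<in> keys q \<Longrightarrow> m + single x 1 \<in> keys p"
proof
  let ?f = "\<lambda>m. m + single x (1::nat)"
  have inj: "inj ?f"
    by (auto intro!: injI)
  let ?q = "Poly_Mapping.map_key ?f p"
  have look: "lookup ?q m = lookup p (?f m)" for m
    using map_key.rep_eq[OF inj, of p] by (simp add: o_def)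
  show "p = select (\<lambda>m. x \<notin> keys m) p + pvar x * ?q"
  proof (rule poly_mapping_eqI)
    fix m
    show "lookup p m = lookup (select (\<lambda>m. x \<notin> keys m) p + pvar x * ?q) m"
    proof (cases "x \<in> keys m")
      case True
      then obtain n where n: "m = n + single x 1"
        by (rule monomial_div)
      show ?thesis
        unfolding lookup_add lookup_select using True
        unfolding n lookup_pvar_mult look by simp
    next
      case False
      then show ?thesis
        by (simp add: lookup_add lookup_pvar_mult_0 lookup_select)
    qed
  qed
  show "\<And>m. m \<in> keys ?q \<Longrightarrow> ?f m \<in> keys p"
    unfolding in_keys_iff look .
qed

text \<open>The Stanley-Reisner ideal, described by supports of monomials instead of generators, so
  that ideal operations become operations on \<Delta>. Sets in \<Delta> may leave V; the supports
  that occur lie in V.\<close>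

definition sr_ideal :: "'v set \<Rightarrow> 'v set set \<Rightarrow> ('v, 'k::field) mpoly set" where
  "sr_ideal V \<Delta> = {p \<in> polys V. \<forall>m\<in>keys p. keys m \<notin> \<Delta>}"

definition simplicial_complex :: "'v set set \<Rightarrow> bool" where
  "simplicial_complex \<Delta> \<longleftrightarrow> (\<forall>F\<in>\<Delta>. \<forall>F'\<subseteq>F. F' \<in> \<Delta>)"

lemma ideal_sr: "simplicial_complex \<Delta> \<Longrightarrow> P.ideal_in V (sr_ideal V \<Delta> :: ('v, 'k::field) mpoly set)"
proof -
  assume c: "simplicial_complex \<Delta>"
  have "a * p \<in> sr_ideal V \<Delta>" if a: "a \<in> polys V" and p: "p \<in> sr_ideal V \<Delta>" for a p :: "('v, 'k) mpoly"
  proof -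
    have "keys m \<notin> \<Delta>" if "m \<in> keys (a * p)" for m
    proof -
      from that obtain m1 m2 where "m2 \<in> keys p" "m = m1 + m2"
        by (rule keys_multE)
      then have "keys m2 \<notin> \<Delta>" "keys m2 \<subseteq> keys m"
        using p by (auto simp: sr_ideal_def keys_add_nat)
      then show ?thesis
        using c unfolding simplicial_complex_def by blast
    qed
    then show ?thesis
      using a p by (simp add: sr_ideal_def)
  qed
  then show ?thesis
    unfolding P.ideal_in_def by (auto simp: sr_ideal_def elim!: keys_addE)
qed

text \<open>The complex on the right is the star of x: a monomial times x has the same support as
  before with x added.\<close>

lemma colon_sr:
  assumes "x \<in> V"
  shows "P.colon V (sr_ideal V \<Delta>) (pvar x) = sr_ideal V {F. insert x F \<in> \<Delta>}"
  using assms by (auto simp: P.colon_def sr_ideal_def keys_pvar_mult keys_add_var[unfolded One_nat_def])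

text \<open>The complex on the right is the deletion of x. An element splits into its monomials free
  of x, which already lie in the ideal of \<Delta>, and a multiple of x.\<close>

lemma adjoin_sr:
  assumes x: "x \<in> V" and c: "simplicial_complex \<Delta>"
  shows "P.adjoin V (sr_ideal V \<Delta>) (pvar x) = (sr_ideal V {F \<in> \<Delta>. x \<notin> F} :: ('v, 'k::field) mpoly set)"
proof (intro Set.set_eqI iffI)
  fix p :: "('v, 'k) mpoly"
  assume "p \<in> P.adjoin V (sr_ideal V \<Delta>) (pvar x)"
  then obtain q a where qa: "p = q + pvar x * a" "q \<in> sr_ideal V \<Delta>" "a \<in> polys V"
    by (auto simp: P.adjoin_def)
  then have "p \<in> polys V"
    using x by (auto simp: sr_ideal_def)
  moreover have "keys m \<notin> {F \<in> \<Delta>. x \<notin> F}" if "m \<in> keys p" for m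
    using that qa(2) unfolding qa(1)
    by (auto simp: sr_ideal_def keys_pvar_mult keys_add_var[unfolded One_nat_def] elim!: keys_addE)
  ultimately show "p \<in> sr_ideal V {F \<in> \<Delta>. x \<notin> F}"
    by (simp add: sr_ideal_def)
next
  fix p :: "('v, 'k) mpoly"
  assume p: "p \<in> sr_ideal V {F \<in> \<Delta>. x \<notin> F}"
  obtain q where q: "p = select (\<lambda>m. x \<notin> keys m) p + pvar x * q" "\<And>m. m \<in> keys q \<Longrightarrow> m + single x 1 \<in> keys p"
    by (rule pvar_quotient[of p x]) blast
  have "select (\<lambda>m. x \<notin> keys m) p \<in> sr_ideal V \<Delta>"
    using p by (auto simp: sr_ideal_def polys_def keys_select)
  moreover have "q \<in> polys V"
    unfolding polys_def
  proof (intro CollectI ballI)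
    fix m
    assume "m \<in> keys q"
    then have "keys (m + single x 1) \<subseteq> V"
      using q(2) p unfolding sr_ideal_def polys_def by blast
    then show "keys m \<subseteq> V"
      unfolding keys_add_var by blast
  qed
  ultimately show "p \<in> P.adjoin V (sr_ideal V \<Delta>) (pvar x)"
    unfolding P.adjoin_def using q(1) by blast
qed

text \<open>If \<Delta> is a cone with apex x, the star of x is all of \<Delta>, so J : x =
  J.\<close>

lemma sr_regular:
  assumes "x \<in> V" "\<And>F. F \<in> \<Delta> \<Longrightarrow> insert x F \<in> \<Delta>" "p \<in> polys V" "pvar x * p \<in> sr_ideal V \<Delta>"
  shows "p \<in> sr_ideal V \<Delta>"
proof -
  have "p \<in> P.colon V (sr_ideal V \<Delta>) (pvar x)"
    using assms by (simp add: P.colon_def)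
  then show ?thesis
    using assms(2) unfolding colon_sr[OF assms(1)] by (auto simp: sr_ideal_def)
qed

section \<open>Koszul complexes on sets of variables\<close>

abbreviation var_ideal :: "'v set \<Rightarrow> 'v set \<Rightarrow> ('v, 'k::field) mpoly set" where
  "var_ideal V E \<equiv> sr_ideal V {F. F \<inter> E = {}}"

lemma adjoin_var_ideal: "x \<in> V \<Longrightarrow> P.adjoin V (var_ideal V E) (pvar x) = var_ideal V (insert x E)"
  by (subst adjoin_sr) (auto simp: simplicial_complex_def intro!: arg_cong[of _ _ "sr_ideal V"])

text \<open>The possible matrix entries of a Koszul differential on E. They have degree zero in
  every variable outside E, so truncation in such a variable commutes with them.\<close>

definition entries :: "'v set \<Rightarrow> ('v, 'k::field) mpoly set" where
  "entries E = {0} \<union> pvar ` E \<union> (\<lambda>y. - pvar y) ` E"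

lemma entries_uminus: "p \<in> entries E \<Longrightarrow> - p \<in> entries E"
  by (auto simp: entries_def)

lemma entries_mono: "p \<in> entries E \<Longrightarrow> E \<subseteq> E' \<Longrightarrow> p \<in> entries E'"
  by (auto simp: entries_def)

text \<open>The start of the Koszul construction: the ideal is zero, level 1 is S itself and level 0
  is the target of the augmentation.\<close>

lemma trivial_resolution:
  "P.resolves V (var_ideal V {} :: ('v, 'k::field) mpoly set) (\<lambda>i. if i < 2 then 1 else 0) (\<lambda>i u. if i = 0 then u else 0)"
proof -
  have z: "P.vecs V 0 = {0 :: nat \<Rightarrow> ('v, 'k) mpoly}"
    by (auto simp: P.vecs_def)
  have "keys p = {} \<longleftrightarrow> p = 0" for p :: "('v, 'k) mpoly"
    by (metis in_keys_iff keys_zero empty_iff lookup_zero poly_mapping_eqI)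
  then have "var_ideal V {} = {0 :: ('v, 'k) mpoly}"
    by (auto simp: sr_ideal_def)
  moreover have "u = 0" if "u \<in> P.vecs V 1" "u 0 = 0" for u :: "nat \<Rightarrow> ('v, 'k) mpoly"
  proof
    show "u l = 0 l" for l
      using that by (cases l) (auto simp: P.vecs_def)
  qed
  ultimately have o: "P.one_vec V (var_ideal V {}) = {0 :: nat \<Rightarrow> ('v, 'k) mpoly}"
    unfolding P.one_vec_def using P.vecs_0[of V 1] by auto
  have lin: "P.lin V (if Suc i < 2 then 1 else 0) (if i < 2 then 1 else 0)
      (\<lambda>u :: nat \<Rightarrow> ('v, 'k) mpoly. if i = 0 then u else 0)" for i
    using P.lin_id[of V 1] P.lin_zero_map[of V] by (cases "i = 0") auto
  show ?thesis
    unfolding P.resolves_def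
  proof (intro conjI allI ballI)
    show "P.ideal_in V (var_ideal V {} :: ('v, 'k) mpoly set)"
      by (rule ideal_sr) (auto simp: simplicial_complex_def)
  next
    fix w :: "nat \<Rightarrow> ('v, 'k) mpoly"
    assume "w \<in> P.vecs V 1"
    then show "\<exists>u\<in>P.vecs V (if 1 < (2::nat) then 1 else 0). w - (if 0 = (0::nat) then u else 0) \<in> P.one_vec V (var_ideal V {})"
      by (intro bexI[of _ w]) (auto simp: o[simplified])
  next
    fix i and u :: "nat \<Rightarrow> ('v, 'k) mpoly"
    assume "u \<in> P.vecs V (if Suc i < 2 then 1 else 0)"
    then show "((if i = 0 then u else 0) \<in> P.relations V (var_ideal V {}) i) =
      (\<exists>y\<in>P.vecs V (if Suc (Suc i) < 2 then 1 else 0). u = (if Suc i = 0 then y else 0))"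
      by (cases "i = 0") (auto simp: P.relations_def o[simplified] z)
  qed (use lin in auto)
qed

text \<open>The Koszul complex; the augmentation \<open>d 0\<close> is exempt from the condition on the entries.\<close>

lemma koszul_resolution:
  assumes "finite E" "E \<subseteq> V"
  obtains b d where "P.resolves V (var_ideal V E :: ('v, 'k::field) mpoly set) b d"
    "\<And>i k l. 0 < i \<Longrightarrow> k < b (Suc i) \<Longrightarrow> d i (unit_vec k) l \<in> entries E"
proof -
  have "\<exists>b d. P.resolves V (var_ideal V E :: ('v, 'k::field) mpoly set) b d \<and>
    (\<forall>i k l. 0 < i \<longrightarrow> k < b (Suc i) \<longrightarrow> d i (unit_vec k) l \<in> entries E)"
    using assms
  proof (induction E rule: finite_induct)
    case empty
    then show ?case
      using trivial_resolution by (intro exI conjI) auto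
  next
    case (insert x E)
    then obtain b d where bd: "P.resolves V (var_ideal V E :: ('v, 'k) mpoly set) b d"
      and ent: "\<And>i k l. 0 < i \<Longrightarrow> k < b (Suc i) \<Longrightarrow> d i (unit_vec k) l \<in> entries E"
      by blast
    have x: "x \<in> V"
      using insert.prems by simp
    let ?x = "pvar x :: ('v, 'k) mpoly"
    have xin: "?x \<in> polys V"
      using x by simp
    have "P.resolves V (P.adjoin V (var_ideal V E) ?x) (P.cone_b b) (P.cone_d b d ?x)"
      by (rule P.cone_resolves[OF bd xin]) (rule sr_regular[OF x], use insert.hyps in auto)
    then have res: "P.resolves V (var_ideal V (insert x E) :: ('v, 'k) mpoly set) (P.cone_b b) (P.cone_d b d ?x)"
      by (simp add: adjoin_var_ideal[OF x])
    have "P.cone_d b d ?x i (unit_vec k) l \<in> entries (insert x E)"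
      if i: "0 < i" and k: "k < P.cone_b b (Suc i)" for i k l
    proof (cases "k < b (Suc i)")
      case True
      have "P.cone_d b d ?x i (unit_vec k) = d i (unit_vec k)"
        using bd True by (intro P.cone_d_front) (auto simp: P.resolves_def)
      then show ?thesis
        using ent[OF i True] by (auto intro: entries_mono)
    next
      case False
      \<comment> \<open>A unit vector of the second block; its image under the cone differential is
        x times a unit vector of the first block, minus a column of d placed in the second.\<close>
      define k' where "k' = k - b (Suc i)"
      have k': "unit_vec k = P.shift (b (Suc i)) (unit_vec k' :: nat \<Rightarrow> ('v, 'k) mpoly)" "k' < P.cone_rank b (Suc i)"
        using False k by (auto simp: unit_vec_def P.shift_def k'_def fun_eq_iff P.cone_b_def)
      have lins: "\<And>i. P.lin V (b (Suc i)) (b i) (d i)"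
        using bd by (simp add: P.resolves_def)
      have eq: "P.cone_d b d ?x i (unit_vec k) =
          smul ?x (unit_vec k') + P.shift (b i) (- P.cone_tail d i (unit_vec k'))"
        unfolding k'(1) by (rule P.cone_d_shift[of V b d, OF lins])
      show ?thesis
      proof (cases "l < b i")
        case True
        then show ?thesis
          unfolding eq by (auto simp: P.shift_def unit_vec_def entries_def)
      next
        case False
        \<comment> \<open>The entry x stands in row \<open>k'\<close>, which belongs to the first
          block, so below that block only entries of d with reversed sign occur.\<close>
        then have "l \<noteq> k'"
          using k'(2) P.cone_rank_le[of b i] by linarith
        then have "P.cone_d b d ?x i (unit_vec k) l = - P.cone_tail d i (unit_vec k') (l - b i)"
          using False unfolding eq by (auto simp: P.shift_def unit_vec_def)
        moreover have "P.cone_tail d i (unit_vec k') (l - b i) \<in> entries E"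
        proof (cases "i < 2")
          case True
          then show ?thesis
            by (simp add: P.cone_tail_def entries_def)
        next
          case False
          then show ?thesis
            using ent[of "i - 1" k'] k'(2) by (simp add: P.cone_tail_def P.cone_rank_def)
        qed
        ultimately show ?thesis
          using entries_uminus entries_mono by (metis subset_insertI)
      qed
    qed
    with res show ?case
      by blast
  qed
  with that show ?thesis
    by blast
qed

text \<open>Ext^j(S/(E), S/J) = 0 without reference to a particular resolution: one resolution
  suffices to prove it, and any may be taken when it is used.\<close>

definition ext_vanishes :: "'v set \<Rightarrow> 'v set \<Rightarrow> ('v, 'k::field) mpoly set \<Rightarrow> nat \<Rightarrow> bool" where
  "ext_vanishes V E J j \<longleftrightarrow>
     (\<forall>b d. P.resolves V (var_ideal V E :: ('v, 'k) mpoly set) b d \<longrightarrow> P.cohomology_vanishes V b d J j)"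

section \<open>Vanishing of Ext for Stanley-Reisner ideals\<close>

lemma ext_vanishesI:
  assumes "P.ideal_in V J" "P.resolves V (var_ideal V E) b d" "P.cohomology_vanishes V b d J j"
  shows "ext_vanishes V E J j"
  unfolding ext_vanishes_def using P.cohomology_independent[OF _ assms(2,1,3)] by blast

text \<open>The apex x of a cone is regular on S/J, and S/(J, x) belongs to the deletion of x.
  Passing to it drops x from E and lowers the degree by one.\<close>

lemma ext_vanishes_cone:
  fixes \<Delta> :: "'v set set"
  assumes E: "finite E" "E \<subseteq> V" and x: "x \<in> V" "x \<notin> E" and c: "simplicial_complex \<Delta>"
    and cone: "\<And>F. F \<in> \<Delta> \<Longrightarrow> insert x F \<in> \<Delta>"
    and van: "\<And>i. j = Suc i \<Longrightarrow> ext_vanishes V E (sr_ideal V {F \<in> \<Delta>. x \<notin> F} :: ('v, 'k::field) mpoly set) i"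
  shows "ext_vanishes V (insert x E) (sr_ideal V \<Delta> :: ('v, 'k) mpoly set) j"
proof -
  let ?x = "pvar x :: ('v, 'k) mpoly"
  have xin: "?x \<in> polys V"
    using x by simp
  obtain b d where bd: "P.resolves V (var_ideal V E :: ('v, 'k) mpoly set) b d"
    using koszul_resolution[OF E] by metis
  have res: "P.resolves V (var_ideal V (insert x E) :: ('v, 'k) mpoly set) (P.cone_b b) (P.cone_d b d ?x)"
    unfolding adjoin_var_ideal[OF x(1), symmetric]
    by (rule P.cone_resolves[OF bd xin]) (rule sr_regular[OF x(1)], use x in auto)
  show ?thesis
  proof (rule ext_vanishesI[OF ideal_sr[OF c] res])
    show "P.cohomology_vanishes V (P.cone_b b) (P.cone_d b d ?x) (sr_ideal V \<Delta>) j"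
    proof (rule P.cone_vanishes[OF bd xin ideal_sr[OF c]])
      show "p \<in> sr_ideal V \<Delta>" if "p \<in> polys V" "?x * p \<in> sr_ideal V \<Delta>" for p
        by (rule sr_regular[OF x(1) cone that])
      show "P.cohomology_vanishes V b d (P.adjoin V (sr_ideal V \<Delta>) ?x) i" if "j = Suc i" for i
        using van[OF that] bd unfolding adjoin_sr[OF x(1) c] ext_vanishes_def by blast
    qed
  qed
qed

lemma ext_vanishes_colon_adjoin:
  fixes \<Delta> :: "'v set set"
  assumes E: "finite E" "E \<subseteq> V" and x: "x \<in> V" and c: "simplicial_complex \<Delta>"
    and "ext_vanishes V E (sr_ideal V {F. insert x F \<in> \<Delta>} :: ('v, 'k::field) mpoly set) j"
    and "ext_vanishes V E (sr_ideal V {F \<in> \<Delta>. x \<notin> F} :: ('v, 'k) mpoly set) j"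
  shows "ext_vanishes V E (sr_ideal V \<Delta> :: ('v, 'k) mpoly set) j"
proof -
  have xin: "(pvar x :: ('v, 'k) mpoly) \<in> polys V"
    using x by simp
  obtain b d where bd: "P.resolves V (var_ideal V E :: ('v, 'k) mpoly set) b d"
    using koszul_resolution[OF E] by metis
  have "P.cohomology_vanishes V b d (sr_ideal V \<Delta> :: ('v, 'k) mpoly set) j"
    using assms(5,6) bd
    by (intro P.vanishes_colon_adjoin[OF bd xin ideal_sr[OF c]])
      (simp_all add: colon_sr[OF x] adjoin_sr[OF x c] ext_vanishes_def)
  then show ?thesis
    by (rule ext_vanishesI[OF ideal_sr[OF c] bd])
qed

text \<open>The Nakayama step. Vanishing in degree j + 1 for E with x makes multiplication by x onto
  in degree j for E. The grading by the degree in x is used: J is a monomial ideal, and the Koszul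
  entries for E are free of x.\<close>

lemma ext_vanishes_remove_var:
  fixes \<Delta> :: "'v set set"
  assumes E: "finite E" "E \<subseteq> V" and x: "x \<in> V" "x \<notin> E" and c: "simplicial_complex \<Delta>"
    and van: "ext_vanishes V (insert x E) (sr_ideal V \<Delta> :: ('v, 'k::field) mpoly set) (Suc j)"
  shows "ext_vanishes V E (sr_ideal V \<Delta> :: ('v, 'k) mpoly set) j"
proof -
  let ?x = "pvar x :: ('v, 'k) mpoly"
  have xin: "?x \<in> polys V"
    using x by simp
  obtain b d where bd: "P.resolves V (var_ideal V E :: ('v, 'k) mpoly set) b d"
    and ent: "\<And>i k l. 0 < i \<Longrightarrow> k < b (Suc i) \<Longrightarrow> d i (unit_vec k) l \<in> entries E"
    using koszul_resolution[OF E, where 'k = 'k] by metis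
  have res: "P.resolves V (var_ideal V (insert x E) :: ('v, 'k) mpoly set) (P.cone_b b) (P.cone_d b d ?x)"
    unfolding adjoin_var_ideal[OF x(1), symmetric]
    by (rule P.cone_resolves[OF bd xin]) (rule sr_regular[OF x(1)], use x in auto)
  let ?\<tau> = "\<lambda>a. select (\<lambda>m. lookup m x < a) :: ('v, 'k) mpoly \<Rightarrow> ('v, 'k) mpoly"
  show ?thesis
  proof (rule ext_vanishesI[OF ideal_sr[OF c] bd],
      rule P.cone_vanishes_imp[OF bd xin ideal_sr[OF c], of j ?\<tau>])
    show "P.cohomology_vanishes V (P.cone_b b) (P.cone_d b d ?x) (sr_ideal V \<Delta>) (Suc j)"
      using van res unfolding ext_vanishes_def by blast
    fix a p
    show "?\<tau> a p \<in> polys V" if "p \<in> polys V"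
      using that by (auto simp: polys_def keys_select)
    show "?\<tau> a p \<in> sr_ideal V \<Delta>" if "p \<in> sr_ideal V \<Delta>"
      using that by (auto simp: sr_ideal_def polys_def keys_select)
    show "?\<tau> 0 p = 0"
      by (rule poly_mapping_eqI) (simp add: lookup_select)
    show "?\<tau> (Suc a) (?x * p) = ?x * ?\<tau> a p"
      by (simp add: select_pvar_mult lookup_add)
    have "lookup m x < a'" if "m \<in> keys p" "Suc (Max ((\<lambda>m. lookup m x) ` keys p)) \<le> a'" for m a'
    proof -
      have "lookup m x \<le> Max ((\<lambda>m. lookup m x) ` keys p)"
        using that(1) by (intro Max_ge) auto
      then show ?thesis
        using that(2) by simp
    qed
    then show "\<exists>a. \<forall>a'\<ge>a. ?\<tau> a' p = p"
      by (intro exI[of _ "Suc (Max ((\<lambda>m. lookup m x) ` keys p))"] allI impI poly_mapping_eqI)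
        (auto simp: lookup_select in_keys_iff)
    fix i k l
    assume "k < b (Suc i)" "0 < i"
    then have "d i (unit_vec k) l \<in> entries E"
      using ent by blast
    moreover have "?\<tau> a (pvar y * p) = pvar y * ?\<tau> a p" if "y \<in> E" for y
    proof -
      have "y \<noteq> x"
        using that x by blast
      then show ?thesis
        by (simp add: select_pvar_mult lookup_add lookup_single)
    qed
    moreover have "?\<tau> a 0 = 0"
      by (rule poly_mapping_eqI) (simp add: lookup_select)
    ultimately show "?\<tau> a (d i (unit_vec k) l * p) = d i (unit_vec k) l * ?\<tau> a p"
      by (auto simp: entries_def select_uminus)
  qed (simp add: select_add)
qed

text \<open>Let f be the product of the variables of the facet D. Multiplying f by a variable
  outside D gives a nonface, so multiplication by f is a homomorphism from S/(V - D) to S/J; it is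
  nonzero because D itself is a face.\<close>

lemma ext_not_vanishes_facet:
  fixes \<Delta> :: "'v set set"
  assumes V: "finite V" and c: "simplicial_complex \<Delta>" and D: "D \<in> \<Delta>" "D \<subseteq> V" "\<And>x. x \<in> V - D \<Longrightarrow> insert x D \<notin> \<Delta>"
  shows "\<not> ext_vanishes V (V - D) (sr_ideal V \<Delta> :: ('v, 'k::field) mpoly set) 0"
proof
  assume van: "ext_vanishes V (V - D) (sr_ideal V \<Delta> :: ('v, 'k) mpoly set) 0"
  let ?J = "sr_ideal V \<Delta> :: ('v, 'k) mpoly set" and ?P = "var_ideal V (V - D) :: ('v, 'k) mpoly set"
  have finD: "finite D"
    using D V finite_subset by blast
  define m where "m = (\<Sum>x\<in>D. single x (1::nat))"
  define f where "f = (single m 1 :: ('v, 'k) mpoly)"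
  have km: "keys m = D"
    using finD by (auto simp: m_def in_keys_iff lookup_sum lookup_single when_def split: if_splits)
  have f: "f \<in> polys V"
    using D km by (auto simp: f_def polys_def)
  have fP: "f * q \<in> ?J" if q: "q \<in> ?P" for q
  proof -
    have "keys n \<notin> \<Delta>" if n: "n \<in> keys (f * q)" for n
    proof -
      from n obtain n1 n2 where n12: "n1 \<in> keys f" "n2 \<in> keys q" "n = n1 + n2"
        by (rule keys_multE)
      then obtain x where "x \<in> V - D" "x \<in> keys n2"
        using q by (auto simp: sr_ideal_def)
      moreover have "keys n = D \<union> keys n2"
        using n12 km by (auto simp: f_def keys_add_nat split: if_splits)
      ultimately have "insert x D \<subseteq> keys n" "insert x D \<notin> \<Delta>"
        using D by auto
      then show ?thesis
        using c unfolding simplicial_complex_def by blast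
    qed
    then show ?thesis
      using f q by (auto simp: sr_ideal_def)
  qed
  have one_vec: "smul f w \<in> P.one_vec V ?J" if "w \<in> P.one_vec V ?P" for w
    using that f fP by (auto simp: P.one_vec_def)
  obtain b d where bd: "P.resolves V ?P b d"
    using koszul_resolution[of "V - D" V, where 'k = 'k] V by (metis Diff_subset finite_Diff)
  have lins: "P.lin V (b (Suc i)) (b i) (d i)" and b0: "b 0 = 1" for i
    using bd by (auto simp: P.resolves_def)
  have "P.lin V (b (Suc 0)) 1 (\<lambda>u. smul f (d 0 u))"
    using P.lin_comp[OF lins P.lin_scale[OF f], of 0] b0 by simp
  moreover have "smul f (d 0 (d (Suc 0) u)) \<in> P.one_vec V ?J" if "u \<in> P.vecs V (b (Suc (Suc 0)))" for u
    using P.resolution_dd[OF bd that] by (intro one_vec) (simp add: P.relations_def)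
  ultimately have "\<forall>u\<in>P.vecs V (b (Suc 0)). smul f (d 0 u) \<in> P.one_vec V ?J"
    using van bd unfolding ext_vanishes_def P.cohomology_vanishes_def by fastforce
  \<comment> \<open>In degree 0 a vanishing class is zero modulo J. Evaluated at a vector u that the
    augmentation sends to 1 modulo (V - D), the cocycle would put f into J.\<close>
  moreover obtain u where u: "u \<in> P.vecs V (b (Suc 0))" "unit_vec 0 - d 0 u \<in> P.one_vec V ?P"
    using bd P.unit_vec_in[of 0 1 V] unfolding P.resolves_def by fastforce
  ultimately have "smul f (d 0 u) + smul f (unit_vec 0 - d 0 u) \<in> P.one_vec V ?J"
    using P.submod_add[OF P.submod_one_vec[OF ideal_sr[OF c]]] one_vec by blast
  then have "f \<in> ?J"
    by (auto simp: P.one_vec_def unit_vec_def algebra_simps)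
  then show False
    using D km by (auto simp: f_def sr_ideal_def)
qed

theorem ext_nonvanishing:
  fixes \<Delta> :: "'v set set"
  assumes V: "finite V" and c: "simplicial_complex \<Delta>" and D: "D \<in> \<Delta>" "D \<subseteq> V" "\<And>x. x \<in> V - D \<Longrightarrow> insert x D \<notin> \<Delta>"
  shows "\<exists>j\<le>card D. \<not> ext_vanishes V V (sr_ideal V \<Delta> :: ('v, 'k::field) mpoly set) j"
proof (rule ccontr)
  assume "\<not> (\<exists>j\<le>card D. \<not> ext_vanishes V V (sr_ideal V \<Delta> :: ('v, 'k) mpoly set) j)"
  then have all: "ext_vanishes V V (sr_ideal V \<Delta> :: ('v, 'k) mpoly set) j" if "j \<le> card D" for j
    using that by blast
  have finD: "finite D"
    using D V finite_subset by blast
  \<comment> \<open>Each variable taken out of the resolved ideal costs one degree; for S = D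
    exactly degree 0 is left.\<close>
  have "ext_vanishes V (V - S) (sr_ideal V \<Delta> :: ('v, 'k) mpoly set) j"
    if "finite S" "S \<subseteq> D" "j + card S \<le> card D" for S j
    using that
  proof (induction S arbitrary: j rule: finite_induct)
    case empty
    then show ?case
      using all by simp
  next
    case (insert x S)
    have "insert x (V - insert x S) = V - S"
      using insert D by auto
    then have "ext_vanishes V (insert x (V - insert x S)) (sr_ideal V \<Delta> :: ('v, 'k) mpoly set) (Suc j)"
      using insert by simp
    moreover have "finite (V - insert x S)" "V - insert x S \<subseteq> V" "x \<in> V" "x \<notin> V - insert x S"
      using insert.prems D V by auto
    ultimately show ?case
      by (intro ext_vanishes_remove_var[of "V - insert x S" V x, OF _ _ _ _ c])
  qed
  then have "ext_vanishes V (V - D) (sr_ideal V \<Delta> :: ('v, 'k) mpoly set) 0"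
    using finD by simp
  with ext_not_vanishes_facet[OF V c D] show False
    by blast
qed

text \<open>Here S/J is the polynomial ring on U, on which the variables of U are regular one after
  another. E shrinks together with U, since each variable is spent once.\<close>

lemma ext_vanishes_simplex:
  assumes "finite U" "U \<subseteq> E" "finite E" "E \<subseteq> V" "j < card U"
  shows "ext_vanishes V E (sr_ideal V {F. F \<subseteq> U} :: ('v, 'k::field) mpoly set) j"
  using assms
proof (induction U arbitrary: E j rule: finite_induct)
  case empty
  then show ?case
    by simp
next
  case (insert x U)
  let ?E = "E - {x}" and ?\<Delta> = "{F. F \<subseteq> insert x U}"
  have eq: "{F \<in> ?\<Delta>. x \<notin> F} = {F. F \<subseteq> U}"
    using insert.hyps by auto
  have "ext_vanishes V (insert x ?E) (sr_ideal V ?\<Delta> :: ('v, 'k) mpoly set) j"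
  proof (rule ext_vanishes_cone)
    show "ext_vanishes V ?E (sr_ideal V {F \<in> ?\<Delta>. x \<notin> F} :: ('v, 'k) mpoly set) i" if "j = Suc i" for i
      unfolding eq using insert that by (intro insert.IH) auto
  qed (use insert in \<open>auto simp: simplicial_complex_def\<close>)
  then show ?case
    using insert.prems by (simp add: insert_absorb)
qed

section \<open>Independence complexes of chordal graphs\<close>

definition indep :: "'v set set \<Rightarrow> 'v set \<Rightarrow> bool" where
  "indep E F \<longleftrightarrow> (\<forall>u\<in>F. \<forall>w\<in>F. {u, w} \<notin> E)"

definition ind_complex :: "'v set \<Rightarrow> 'v set set \<Rightarrow> 'v set set" where
  "ind_complex U E = {F. F \<subseteq> U \<and> indep E F}"

definition max_indep :: "'v set \<Rightarrow> 'v set set \<Rightarrow> 'v set \<Rightarrow> bool" where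
  "max_indep U E D \<longleftrightarrow> D \<subseteq> U \<and> indep E D \<and> (\<forall>w\<in>U - D. \<exists>u\<in>D. {u, w} \<in> E)"

text \<open>A perfect elimination ordering, given by a rank function that may have ties.\<close>

definition elimination_rank :: "'v set \<Rightarrow> 'v set set \<Rightarrow> ('v \<Rightarrow> nat) \<Rightarrow> bool" where
  "elimination_rank U E r \<longleftrightarrow>
     (\<forall>u\<in>U. \<forall>w\<in>U. \<forall>w'\<in>U. {u, w} \<in> E \<longrightarrow> {u, w'} \<in> E \<longrightarrow> w \<noteq> w' \<longrightarrow> r u \<le> r w \<longrightarrow> r u \<le> r w' \<longrightarrow> {w, w'} \<in> E)"

lemma simplicial_complex_ind_complex: "simplicial_complex (ind_complex U E)"
  by (auto simp: simplicial_complex_def ind_complex_def indep_def)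

theorem ext_vanishes_below:
  fixes E :: "'v set set"
  assumes V: "finite V" and loop: "\<And>u. {u} \<notin> E" and rank: "elimination_rank V E r"
    and U: "U \<subseteq> V" and c: "\<And>D. max_indep U E D \<Longrightarrow> c \<le> card D" and j: "j < c"
  shows "ext_vanishes V V (sr_ideal V (ind_complex U E) :: ('v, 'k::field) mpoly set) j"
  using U c
proof (induction "card U" arbitrary: U rule: less_induct)
  case less
  have finU: "finite U"
    using less.prems V finite_subset by blast
  show ?case
  proof (cases "\<exists>u\<in>U. \<exists>w\<in>U. {u, w} \<in> E")
    case False
    then have "ind_complex U E = {F. F \<subseteq> U}" "max_indep U E U"
      by (auto simp: ind_complex_def indep_def max_indep_def)
    then show ?thesis
      using ext_vanishes_simplex[OF finU less.prems(1) V subset_refl, of j] less.prems(2)[of U] j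
      by (simp add: less_le_trans)
  next
    case True
    \<comment> \<open>The vertices that are not isolated in the graph induced on U. One of least
      rank has a neighbour, and its neighbours, lying in B as well, form a clique.\<close>
    define B where "B = {u \<in> U. \<exists>w\<in>U. {u, w} \<in> E}"
    obtain s where s: "s \<in> B" "\<And>u. u \<in> B \<Longrightarrow> r s \<le> r u"
    proof
      have "finite B" "B \<noteq> {}"
        using True finU by (auto simp: B_def)
      then show "arg_min_on r B \<in> B" "\<And>u. u \<in> B \<Longrightarrow> r (arg_min_on r B) \<le> r u"
        using arg_min_if_finite(1)[of B r] arg_min_least[of B _ r] by auto
    qed
    then obtain x where x: "x \<in> U" "{s, x} \<in> E" and sU: "s \<in> U"
      by (auto simp: B_def)
    have sx: "s \<noteq> x"
      using loop[of s] x by auto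
    have simplicial: "{u, x} \<in> E" if "u \<in> U" "{s, u} \<in> E" "u \<noteq> x" for u
    proof -
      have "u \<in> B" "x \<in> B"
        using that x sU by (auto simp: B_def insert_commute)
      then show ?thesis
        using rank that x sU s less.prems(1) unfolding elimination_rank_def by blast
    qed
    \<comment> \<open>The non-neighbours of x, with x among them as an isolated vertex. Their
      independence complex is the star of x, and each of their maximal independent sets contains x,
      so it dominates the deleted neighbours too.\<close>
    let ?W = "{w \<in> U. {x, w} \<notin> E}"
    have sub: "?W \<subset> U" "U - {x} \<subset> U"
      using x sU by (auto simp: insert_commute)
    have mis1: "max_indep U E D" if D: "max_indep ?W E D" for D
    proof -
      have "x \<in> D"
      proof (rule ccontr)
        assume "x \<notin> D"
        moreover have "x \<in> ?W"
          using x loop[of x] by simp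
        ultimately obtain u where "u \<in> D" "{u, x} \<in> E"
          using D unfolding max_indep_def by blast
        then show False
          using D unfolding max_indep_def by (auto simp: insert_commute)
      qed
      then show ?thesis
        using D unfolding max_indep_def by blast
    qed
    \<comment> \<open>D contains s or a neighbour of s, and each of these is adjacent to x; so D
      dominates x although x was deleted.\<close>
    have mis2: "max_indep U E D" if D: "max_indep (U - {x}) E D" for D
    proof -
      have "\<exists>u\<in>D. {u, x} \<in> E"
      proof (cases "s \<in> D")
        case True
        then show ?thesis
          using x by blast
      next
        case False
        then obtain u where u: "u \<in> D" "{u, s} \<in> E"
          using D sU sx unfolding max_indep_def by blast
        then have "u \<in> U" "u \<noteq> x"
          using D unfolding max_indep_def by auto
        then show ?thesis
          using simplicial[of u] u by (auto simp: insert_commute)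
      qed
      then show ?thesis
        using D unfolding max_indep_def by blast
    qed
    have "{F. insert x F \<in> ind_complex U E} = ind_complex ?W E"
      using x loop[of x] by (auto simp: ind_complex_def indep_def insert_commute)
    moreover have "{F \<in> ind_complex U E. x \<notin> F} = ind_complex (U - {x}) E"
      by (auto simp: ind_complex_def)
    moreover have "ext_vanishes V V (sr_ideal V (ind_complex ?W E) :: ('v, 'k) mpoly set) j"
    proof (rule less.hyps)
      show "card ?W < card U"
        using sub finU by (intro psubset_card_mono)
      show "?W \<subseteq> V"
        using less.prems by auto
      show "c \<le> card D" if "max_indep ?W E D" for D
        by (rule less.prems(2)[OF mis1[OF that]])
    qed
    moreover have "ext_vanishes V V (sr_ideal V (ind_complex (U - {x}) E) :: ('v, 'k) mpoly set) j"
    proof (rule less.hyps)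
      show "card (U - {x}) < card U"
        using sub finU by (intro psubset_card_mono)
      show "U - {x} \<subseteq> V"
        using less.prems by auto
      show "c \<le> card D" if "max_indep (U - {x}) E D" for D
        by (rule less.prems(2)[OF mis2[OF that]])
    qed
    ultimately show ?thesis
      using x less.prems(1) by (intro ext_vanishes_colon_adjoin[OF V subset_refl _ simplicial_complex_ind_complex, of x]) auto
  qed
qed

theorem ext_nonvanishing_max_indep:
  fixes E :: "'v set set"
  assumes "finite V" "max_indep V E D"
  shows "\<exists>j\<le>card D. \<not> ext_vanishes V V (sr_ideal V (ind_complex V E) :: ('v, 'k::field) mpoly set) j"
proof (rule ext_nonvanishing[OF assms(1) simplicial_complex_ind_complex])
  show "D \<in> ind_complex V E" "D \<subseteq> V"
    using assms by (auto simp: max_indep_def ind_complex_def)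
  show "insert x D \<notin> ind_complex V E" if "x \<in> V - D" for x
    using assms that unfolding max_indep_def ind_complex_def indep_def by blast
qed

section \<open>Comparison with Ext\<close>

lemma poly_ring_simps [simp]:
  "carrier (poly_ring V) = polys V" "mult (poly_ring V) = (*)" "one (poly_ring V) = 1"
  "zero (poly_ring V) = 0" "add (poly_ring V) = (+)"
  by (simp_all add: poly_ring_def polys_def)

lemma residue_field_simps [simp]:
  "carrier residue_field = UNIV" "zero residue_field = 0" "add residue_field = (+)"
  "smult residue_field p c = lookup p 0 * c"
  by (simp_all add: residue_field_def)

lemma lookup_mult_0: "lookup (p * q) 0 = lookup p 0 * lookup q 0" for p q :: "('v, 'k::field) mpoly"
proof -
  have zero: "0 = l + q \<longleftrightarrow> l = 0 \<and> q = 0" for l q :: "'v \<Rightarrow>\<^sub>0 nat"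
    by (auto simp: poly_mapping_eq_iff fun_eq_iff lookup_add)
  have "(\<Sum>l. lookup p l * (\<Sum>r. lookup q r when 0 = l + r)) = (\<Sum>l. lookup p 0 * lookup q 0 when l = (0 :: 'v \<Rightarrow>\<^sub>0 nat))"
    by (rule Sum_any.cong) (auto simp: zero when_def)
  then show ?thesis
    by (simp add: lookup_mult)
qed

text \<open>Identifies S modulo all variables with the field by means of the constant term, which is
  how \<open>residue_field\<close> lets polynomials act.\<close>

lemma in_var_ideal_iff: "p \<in> var_ideal V V \<longleftrightarrow> p \<in> polys V \<and> lookup p 0 = 0" for p :: "('v, 'k::field) mpoly"
proof -
  have "keys m = {} \<longleftrightarrow> m = 0" for m :: "'v \<Rightarrow>\<^sub>0 nat"
    by (metis in_keys_iff keys_zero empty_iff lookup_zero poly_mapping_eqI)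
  then have inter: "keys m \<inter> V = {} \<longleftrightarrow> m = 0" if "p \<in> polys V" "m \<in> keys p" for m
    using that unfolding polys_def by blast
  show ?thesis
  proof
    assume p: "p \<in> var_ideal V V"
    then have "0 \<notin> keys p"
      by (auto simp: sr_ideal_def)
    then show "p \<in> polys V \<and> lookup p 0 = 0"
      using p by (simp add: sr_ideal_def in_keys_iff)
  next
    assume p: "p \<in> polys V \<and> lookup p 0 = 0"
    then have "keys m \<inter> V \<noteq> {}" if "m \<in> keys p" for m
      using inter[of m] that by (auto simp: in_keys_iff)
    then show "p \<in> var_ideal V V"
      using p by (simp add: sr_ideal_def)
  qed
qed

text \<open>\<open>free_mod\<close> consists of functions that are undefined beyond the rank,
  whereas \<open>vecs\<close> uses zero there; \<open>pad\<close> and \<open>crop\<close> translate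
  and are inverse to each other on the two carriers.\<close>

definition pad :: "nat \<Rightarrow> (nat \<Rightarrow> 'a::zero) \<Rightarrow> nat \<Rightarrow> 'a" where
  "pad n x = (\<lambda>k. if k < n then x k else 0)"

definition crop :: "nat \<Rightarrow> (nat \<Rightarrow> 'a) \<Rightarrow> nat \<Rightarrow> 'a" where
  "crop n u = restrict u {..<n}"

lemma carrier_free_mod: "carrier (free_mod (poly_ring V) n) = {..<n} \<rightarrow>\<^sub>E polys V"
  by (simp add: free_mod_def)

lemma pad_in: "x \<in> carrier (free_mod (poly_ring V) n) \<Longrightarrow> pad n x \<in> P.vecs V n"
  by (auto simp: carrier_free_mod P.vecs_def pad_def)

lemma crop_in: "u \<in> P.vecs V n \<Longrightarrow> crop n u \<in> carrier (free_mod (poly_ring V) n)"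
  by (auto simp: carrier_free_mod P.vecs_def crop_def)

lemma pad_crop: "u \<in> P.vecs V n \<Longrightarrow> pad n (crop n u) = u"
  by (auto simp: P.vecs_def pad_def crop_def fun_eq_iff)

lemma crop_pad: "x \<in> carrier (free_mod (poly_ring V) n) \<Longrightarrow> crop n (pad n x) = x"
  unfolding carrier_free_mod by (rule extensionalityI[of _ "{..<n}"]) (auto simp: pad_def crop_def PiE_def)

lemma pad_add: "pad n (x \<oplus>\<^bsub>free_mod (poly_ring V) n\<^esub> y) = pad n x + pad n y"
  and pad_smult: "pad n (a \<odot>\<^bsub>free_mod (poly_ring V) n\<^esub> x) = smul a (pad n x)"
  and pad_zero: "pad n \<zero>\<^bsub>free_mod (poly_ring V) n\<^esub> = 0"
  by (auto simp: pad_def free_mod_def fun_eq_iff)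

lemma crop_add: "crop n (u + w) = crop n u \<oplus>\<^bsub>free_mod (poly_ring V) n\<^esub> crop n w"
  and crop_smul: "crop n (smul a u) = a \<odot>\<^bsub>free_mod (poly_ring V) n\<^esub> crop n u"
  and crop_zero: "crop n 0 = \<zero>\<^bsub>free_mod (poly_ring V) n\<^esub>"
  by (auto simp: crop_def free_mod_def fun_eq_iff)

lemma free_mod_closed:
  "x \<in> carrier (free_mod (poly_ring V) n) \<Longrightarrow> y \<in> carrier (free_mod (poly_ring V) n) \<Longrightarrow>
    x \<oplus>\<^bsub>free_mod (poly_ring V) n\<^esub> y \<in> carrier (free_mod (poly_ring V) n)"
  "a \<in> polys V \<Longrightarrow> x \<in> carrier (free_mod (poly_ring V) n) \<Longrightarrow>
    a \<odot>\<^bsub>free_mod (poly_ring V) n\<^esub> x \<in> carrier (free_mod (poly_ring V) n)"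
  using PiE_mem[of x "{..<n}" "\<lambda>_. polys V"] PiE_mem[of y "{..<n}" "\<lambda>_. polys V"]
  by (simp_all add: free_mod_def restrict_PiE_iff)

lemma module_hom_lin:
  assumes "h \<in> module_hom (poly_ring V) (free_mod (poly_ring V) n) (free_mod (poly_ring V) m)"
  shows "P.lin V n m (\<lambda>u. pad m (h (crop n u)))"
  using assms unfolding P.lin_def module_hom_def
  by (auto simp: crop_add[of _ _ _ V] crop_smul[of _ _ _ V] crop_in pad_add pad_smult intro!: pad_in)

lemma lin_module_hom:
  assumes f: "P.lin V n m f"
  shows "(\<lambda>x\<in>carrier (free_mod (poly_ring V) n). crop m (f (pad n x))) \<in>
    module_hom (poly_ring V) (free_mod (poly_ring V) n) (free_mod (poly_ring V) m)"
  unfolding module_hom_def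
  by (auto simp: free_mod_closed pad_add pad_smult pad_in P.lin_add[OF f] P.lin_smul[OF f]
      crop_add[of _ _ _ V] crop_smul[of _ _ _ V] intro!: crop_in P.lin_in[OF f])

text \<open>For augmentations: their values lie in the field, so the expansion of linear maps
  between vector modules cannot be quoted.\<close>

lemma additive_expand:
  fixes \<phi> :: "(nat \<Rightarrow> ('v, 'k::field) mpoly) \<Rightarrow> 'b::ab_group_add"
  assumes add: "\<And>u w. u \<in> P.vecs V n \<Longrightarrow> w \<in> P.vecs V n \<Longrightarrow> \<phi> (u + w) = \<phi> u + \<phi> w"
    and u: "u \<in> P.vecs V n"
  shows "\<phi> u = (\<Sum>k<n. \<phi> (smul (u k) (unit_vec k)))"
proof -
  have zero: "\<phi> 0 = 0"
    using add[of 0 0] by simp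
  have "\<phi> (\<Sum>k\<in>S. smul (u k) (unit_vec k)) = (\<Sum>k\<in>S. \<phi> (smul (u k) (unit_vec k)))" if "S \<subseteq> {..<n}" for S
    using finite_subset[OF that finite_lessThan] that
  proof (induction S rule: finite_induct)
    case (insert k S)
    have "smul (u k) (unit_vec k) \<in> P.vecs V n"
      using insert.prems P.vecs_in[OF u] by (intro P.vecs_smul) auto
    moreover have "(\<Sum>k\<in>S. smul (u k) (unit_vec k)) \<in> P.vecs V n"
      using insert.prems P.vecs_in[OF u] by (intro P.submod_sum[OF P.submod_vecs] P.vecs_smul) auto
    ultimately have "\<phi> (smul (u k) (unit_vec k) + (\<Sum>k\<in>S. smul (u k) (unit_vec k))) =
        \<phi> (smul (u k) (unit_vec k)) + \<phi> (\<Sum>k\<in>S. smul (u k) (unit_vec k))"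
      by (rule add)
    then show ?case
      using insert by (simp only: sum.insert insert_subset simp_thms)
  qed (simp add: zero)
  from this[of "{..<n}"] show ?thesis
    using P.vec_expand[OF u] by simp
qed

text \<open>A lift of the augmentation \<epsilon> to a linear map into S: the unit vectors go to the
  constant polynomials with the values of \<epsilon>, so that constant terms recover
  \<epsilon>.\<close>

definition aug :: "nat \<Rightarrow> ((nat \<Rightarrow> ('v, 'k::field) mpoly) \<Rightarrow> 'k) \<Rightarrow> (nat \<Rightarrow> ('v, 'k) mpoly) \<Rightarrow> nat \<Rightarrow> ('v, 'k) mpoly" where
  "aug n \<epsilon> u = (\<Sum>k<n. smul (u k) (smul (single 0 (\<epsilon> (crop n (unit_vec k)))) (unit_vec 0)))"

definition aug_b :: "(nat \<Rightarrow> nat) \<Rightarrow> nat \<Rightarrow> nat" where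
  "aug_b b i = (case i of 0 \<Rightarrow> 1 | Suc j \<Rightarrow> b j)"

definition aug_d ::
  "(nat \<Rightarrow> nat) \<Rightarrow> (nat \<Rightarrow> (nat \<Rightarrow> ('v, 'k::field) mpoly) \<Rightarrow> nat \<Rightarrow> ('v, 'k) mpoly) \<Rightarrow>
   ((nat \<Rightarrow> ('v, 'k) mpoly) \<Rightarrow> 'k) \<Rightarrow> nat \<Rightarrow> (nat \<Rightarrow> ('v, 'k) mpoly) \<Rightarrow> nat \<Rightarrow> ('v, 'k) mpoly" where
  "aug_d b d \<epsilon> i u = (case i of 0 \<Rightarrow> aug (b 0) \<epsilon> u | Suc j \<Rightarrow> pad (b j) (d j (crop (b (Suc j)) u)))"

lemma single_0_in [simp]: "single 0 c \<in> polys V"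
  by (auto simp: polys_def)

text \<open>Whatever resolution the choice inside \<open>Ext\<close> returns becomes one of S modulo
  all variables, with the lifted augmentation as its lowest map and the other maps moved up by one
  index.\<close>

lemma aug_d_resolves:
  fixes d :: "nat \<Rightarrow> (nat \<Rightarrow> ('v, 'k::field) mpoly) \<Rightarrow> nat \<Rightarrow> ('v, 'k) mpoly"
  assumes r: "free_resolution (poly_ring V) residue_field b d \<epsilon>"
  shows "P.resolves V (var_ideal V V) (aug_b b) (aug_d b d \<epsilon>)"
proof -
  let ?R = "poly_ring V :: ('v, 'k) mpoly ring" and ?P = "var_ideal V V :: ('v, 'k) mpoly set"
  let ?F = "\<lambda>n. free_mod ?R n"
  have hom: "d i \<in> module_hom ?R (?F (b (Suc i))) (?F (b i))" and \<epsilon>: "\<epsilon> \<in> module_hom ?R (?F (b 0)) residue_field"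
    and surj: "\<epsilon> ` carrier (?F (b 0)) = UNIV"
    and ex0: "d 0 ` carrier (?F (b 1)) = {x \<in> carrier (?F (b 0)). \<epsilon> x = 0}"
    and ex: "d (Suc i) ` carrier (?F (b (Suc (Suc i)))) = {x \<in> carrier (?F (b (Suc i))). d i x = \<zero>\<^bsub>?F (b i)\<^esub>}" for i
    using r unfolding free_resolution_def by auto
  have \<epsilon>_add: "\<epsilon> (crop (b 0) (u + w)) = \<epsilon> (crop (b 0) u) + \<epsilon> (crop (b 0) w)"
    if "u \<in> P.vecs V (b 0)" "w \<in> P.vecs V (b 0)" for u w
    using \<epsilon> that unfolding module_hom_def by (simp add: crop_add[of _ _ _ V] crop_in)
  have \<epsilon>_smul: "\<epsilon> (crop (b 0) (smul a u)) = lookup a 0 * \<epsilon> (crop (b 0) u)"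
    if "u \<in> P.vecs V (b 0)" "a \<in> polys V" for u a
    using \<epsilon> that unfolding module_hom_def by (simp add: crop_smul[of _ _ _ V] crop_in)
  have lin0: "P.lin V (b 0) 1 (aug (b 0) \<epsilon>)"
    unfolding aug_def by (intro P.lin_combination P.vecs_smul P.unit_vec_in) auto
  have aug: "lookup (aug (b 0) \<epsilon> u 0) 0 = \<epsilon> (crop (b 0) u)" if u: "u \<in> P.vecs V (b 0)" for u
  proof -
    have "\<epsilon> (crop (b 0) u) = (\<Sum>k<b 0. \<epsilon> (crop (b 0) (smul (u k) (unit_vec k))))"
      by (rule additive_expand[of V "b 0" "\<lambda>u. \<epsilon> (crop (b 0) u)", OF \<epsilon>_add u])
    also have "\<dots> = (\<Sum>k<b 0. lookup (u k) 0 * \<epsilon> (crop (b 0) (unit_vec k)))"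
      using P.vecs_in[OF u] by (intro sum.cong refl \<epsilon>_smul) auto
    finally show ?thesis
      by (simp add: aug_def sum_fun_apply lookup_sum lookup_mult_0 unit_vec_def)
  qed
  have aug_iff: "w - aug (b 0) \<epsilon> u \<in> P.one_vec V ?P \<longleftrightarrow> lookup (w 0) 0 = \<epsilon> (crop (b 0) u)"
    if "w \<in> P.vecs V 1" "u \<in> P.vecs V (b 0)" for w u
    using P.vecs_diff[OF that(1) P.lin_in[OF lin0 that(2)]] P.vecs_in[OF P.vecs_diff[OF that(1) P.lin_in[OF lin0 that(2)]], of 0]
      aug[OF that(2)]
    by (auto simp: P.one_vec_def in_var_ideal_iff lookup_minus)
  have image: "(\<exists>y\<in>P.vecs V (b (Suc i)). u = pad (b i) (d i (crop (b (Suc i)) y))) \<longleftrightarrow> crop (b i) u \<in> d i ` carrier (?F (b (Suc i)))"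
    if u: "u \<in> P.vecs V (b i)" for u i
  proof
    assume "\<exists>y\<in>P.vecs V (b (Suc i)). u = pad (b i) (d i (crop (b (Suc i)) y))"
    then obtain y where y: "y \<in> P.vecs V (b (Suc i))" "u = pad (b i) (d i (crop (b (Suc i)) y))"
      by blast
    have "d i (crop (b (Suc i)) y) \<in> carrier (?F (b i))"
      using hom[of i] crop_in[OF y(1)] unfolding module_hom_def by auto
    then have "crop (b i) u = d i (crop (b (Suc i)) y)"
      using y(2) crop_pad by simp
    then show "crop (b i) u \<in> d i ` carrier (?F (b (Suc i)))"
      using crop_in[OF y(1)] by blast
  next
    assume "crop (b i) u \<in> d i ` carrier (?F (b (Suc i)))"
    then obtain x where x: "x \<in> carrier (?F (b (Suc i)))" "crop (b i) u = d i x"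
      by blast
    then have "u = pad (b i) (d i (crop (b (Suc i)) (pad (b (Suc i)) x)))"
      using pad_crop[OF u] crop_pad[OF x(1)] by simp
    then show "\<exists>y\<in>P.vecs V (b (Suc i)). u = pad (b i) (d i (crop (b (Suc i)) y))"
      using pad_in[OF x(1)] by blast
  qed
  show ?thesis
    unfolding P.resolves_def
  proof (intro conjI allI ballI)
    show "P.ideal_in V ?P"
      by (rule ideal_sr) (auto simp: simplicial_complex_def)
    show "aug_b b 0 = 1"
      by (simp add: aug_b_def)
    show "P.lin V (aug_b b (Suc i)) (aug_b b i) (aug_d b d \<epsilon> i)" for i
      using lin0 module_hom_lin[OF hom] by (cases i) (simp_all add: aug_b_def aug_d_def[abs_def])
  next
    fix w :: "nat \<Rightarrow> ('v, 'k) mpoly"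
    assume w: "w \<in> P.vecs V 1"
    obtain x where x: "x \<in> carrier (?F (b 0))" "\<epsilon> x = lookup (w 0) 0"
      using surj by (metis UNIV_I imageE)
    then show "\<exists>u\<in>P.vecs V (aug_b b 1). w - aug_d b d \<epsilon> 0 u \<in> P.one_vec V ?P"
      using aug_iff[OF w pad_in[OF x(1)]] crop_pad[OF x(1)]
      by (intro bexI[of _ "pad (b 0) x"]) (simp_all add: aug_b_def aug_d_def pad_in)
  next
    fix i and u :: "nat \<Rightarrow> ('v, 'k) mpoly"
    assume u: "u \<in> P.vecs V (aug_b b (Suc i))"
    show "aug_d b d \<epsilon> i u \<in> P.relations V ?P i \<longleftrightarrow>
      (\<exists>y\<in>P.vecs V (aug_b b (Suc (Suc i))). u = aug_d b d \<epsilon> (Suc i) y)"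
    proof (cases i)
      case 0
      have u0: "u \<in> P.vecs V (b 0)"
        using u 0 by (simp add: aug_b_def)
      have "aug (b 0) \<epsilon> u \<in> P.one_vec V ?P \<longleftrightarrow> \<epsilon> (crop (b 0) u) = 0"
        using P.lin_in[OF lin0 u0] P.vecs_in aug[OF u0] by (auto simp: P.one_vec_def in_var_ideal_iff)
      also have "\<dots> \<longleftrightarrow> crop (b 0) u \<in> d 0 ` carrier (?F (b 1))"
        using ex0 crop_in[OF u0] by simp
      finally show ?thesis
        using image[OF u0] 0 by (simp add: P.relations_def aug_d_def aug_b_def)
    next
      case (Suc j)
      have uj: "u \<in> P.vecs V (b (Suc j))"
        using u Suc by (simp add: aug_b_def)
      have dj: "d j (crop (b (Suc j)) u) \<in> carrier (?F (b j))"
        using hom[of j] crop_in[OF uj] unfolding module_hom_def by auto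
      have "pad (b j) (d j (crop (b (Suc j)) u)) = 0 \<longleftrightarrow> d j (crop (b (Suc j)) u) = \<zero>\<^bsub>?F (b j)\<^esub>"
        using crop_pad[OF dj] pad_zero[of "b j" V] crop_zero[of "b j" V] by metis
      also have "\<dots> \<longleftrightarrow> crop (b (Suc j)) u \<in> d (Suc j) ` carrier (?F (b (Suc (Suc j))))"
        unfolding ex using crop_in[OF uj] by simp
      finally show ?thesis
        using image[OF uj] Suc by (simp add: P.relations_def aug_d_def aug_b_def)
    qed
  qed
qed

text \<open>Gives the choice inside \<open>Ext\<close> its meaning. The Koszul complex on all
  variables is translated back, and the augmentation takes the constant term.\<close>

lemma exists_free_resolution:
  assumes V: "finite V"
  shows "\<exists>b d \<epsilon>. free_resolution (poly_ring V :: ('v, 'k::field) mpoly ring) residue_field b d \<epsilon>"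
proof -
  let ?R = "poly_ring V :: ('v, 'k) mpoly ring" and ?P = "var_ideal V V :: ('v, 'k) mpoly set"
  let ?F = "\<lambda>n. free_mod ?R n"
  obtain b0 d0 where r: "P.resolves V ?P b0 d0"
    using koszul_resolution[OF V subset_refl, where 'k = 'k] by metis
  have lins: "P.lin V (b0 (Suc i)) (b0 i) (d0 i)" and b00: "b0 0 = 1" for i
    using r by (auto simp: P.resolves_def)
  have surj: "\<exists>u\<in>P.vecs V (b0 1). w - d0 0 u \<in> P.one_vec V ?P" if "w \<in> P.vecs V 1" for w
    using r that by (auto simp: P.resolves_def)
  have exact: "d0 i u \<in> P.relations V ?P i \<longleftrightarrow> (\<exists>y\<in>P.vecs V (b0 (Suc (Suc i))). u = d0 (Suc i) y)"
    if "u \<in> P.vecs V (b0 (Suc i))" for i u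
    using r that by (auto simp: P.resolves_def)
  define b where "b = (\<lambda>i. b0 (Suc i))"
  define d where "d = (\<lambda>i. \<lambda>x\<in>carrier (?F (b (Suc i))). crop (b i) (d0 (Suc i) (pad (b (Suc i)) x)))"
  define \<epsilon> where "\<epsilon> = (\<lambda>x\<in>carrier (?F (b 0)). lookup (d0 0 (pad (b 0) x) 0) 0)"
  have image: "d i ` carrier (?F (b (Suc i))) = {x \<in> carrier (?F (b i)). d0 i (pad (b i) x) \<in> P.relations V ?P i}" for i
  proof (intro Set.set_eqI iffI)
    fix x
    assume "x \<in> d i ` carrier (?F (b (Suc i)))"
    then obtain y where y: "y \<in> carrier (?F (b (Suc i)))" "x = crop (b i) (d0 (Suc i) (pad (b (Suc i)) y))"
      by (auto simp: d_def)
    have u: "d0 (Suc i) (pad (b (Suc i)) y) \<in> P.vecs V (b i)"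
      using P.lin_in[OF lins] pad_in[OF y(1)] unfolding b_def by blast
    have "d0 i (d0 (Suc i) (pad (b (Suc i)) y)) \<in> P.relations V ?P i"
      using P.resolution_dd[OF r] pad_in[OF y(1)] unfolding b_def by blast
    then show "x \<in> {x \<in> carrier (?F (b i)). d0 i (pad (b i) x) \<in> P.relations V ?P i}"
      using y(2) crop_in[OF u] pad_crop[OF u] by simp
  next
    fix x
    assume x: "x \<in> {x \<in> carrier (?F (b i)). d0 i (pad (b i) x) \<in> P.relations V ?P i}"
    then obtain y where y: "y \<in> P.vecs V (b (Suc i))" "pad (b i) x = d0 (Suc i) y"
      using exact[of "pad (b i) x" i] pad_in[of x V "b i"] unfolding b_def by auto
    then have "x = d i (crop (b (Suc i)) y)"
      using x crop_pad[of x V "b i"] pad_crop[OF y(1)] crop_in[OF y(1)] by (simp add: d_def)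
    then show "x \<in> d i ` carrier (?F (b (Suc i)))"
      using crop_in[OF y(1)] by blast
  qed
  have "free_resolution ?R residue_field b d \<epsilon>"
    unfolding free_resolution_def
  proof (intro conjI allI)
    show "d i \<in> module_hom ?R (?F (b (Suc i))) (?F (b i))" for i
      unfolding d_def using lin_module_hom[OF lins[of "Suc i"]] by (simp add: b_def)
    have lin0: "P.lin V (b 0) 1 (d0 0)"
      using lins[of 0] b00 by (simp add: b_def)
    show "\<epsilon> \<in> module_hom ?R (?F (b 0)) residue_field"
      unfolding module_hom_def \<epsilon>_def
      by (auto simp: free_mod_closed pad_add pad_smult pad_in P.lin_add[OF lin0] P.lin_smul[OF lin0] lookup_add
          lookup_mult_0)
    show "\<epsilon> ` carrier (?F (b 0)) = carrier residue_field"
    proof -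
      have "c \<in> \<epsilon> ` carrier (?F (b 0))" for c
      proof -
        have "smul (single 0 c) (unit_vec 0) \<in> P.vecs V 1"
          by (intro P.vecs_smul P.unit_vec_in) auto
        then obtain u where u: "u \<in> P.vecs V (b 0)" "smul (single 0 c) (unit_vec 0) - d0 0 u \<in> P.one_vec V ?P"
          using surj unfolding b_def by (metis One_nat_def)
        then have "lookup (d0 0 u 0) 0 = c"
          by (simp add: P.one_vec_def in_var_ideal_iff lookup_minus unit_vec_def)
        then have "c = \<epsilon> (crop (b 0) u)"
          using crop_in[OF u(1)] pad_crop[OF u(1)] by (simp add: \<epsilon>_def)
        then show ?thesis
          using crop_in[OF u(1)] by blast
      qed
      then show ?thesis
        by auto
    qed
    show "d 0 ` carrier (?F (b 1)) = {x \<in> carrier (?F (b 0)). \<epsilon> x = \<zero>\<^bsub>residue_field\<^esub>}"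
    proof -
      have "d0 0 (pad (b 0) x) \<in> P.relations V ?P 0 \<longleftrightarrow> \<epsilon> x = 0" if x: "x \<in> carrier (?F (b 0))" for x
        using P.lin_in[OF lin0 pad_in[OF x]] P.vecs_in[OF P.lin_in[OF lin0 pad_in[OF x]], of 0] x
        by (simp add: \<epsilon>_def P.relations_def P.one_vec_def in_var_ideal_iff)
      then show ?thesis
        using image[of 0] by auto
    qed
    show "d (Suc i) ` carrier (?F (b (Suc (Suc i)))) =
      {x \<in> carrier (?F (b (Suc i))). d i x = \<zero>\<^bsub>?F (b i)\<^esub>}" for i
    proof -
      have "d i x = \<zero>\<^bsub>?F (b i)\<^esub> \<longleftrightarrow> d0 (Suc i) (pad (b (Suc i)) x) = 0" if x: "x \<in> carrier (?F (b (Suc i)))" for x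
      proof -
        let ?w = "d0 (Suc i) (pad (b (Suc i)) x)"
        have w: "?w \<in> P.vecs V (b i)"
          using P.lin_in[OF lins] pad_in[OF x] unfolding b_def by blast
        have dx: "d i x = crop (b i) ?w"
          using x by (simp add: d_def)
        show ?thesis
        proof
          assume "d i x = \<zero>\<^bsub>?F (b i)\<^esub>"
          then show "?w = 0"
            using pad_crop[OF w] unfolding dx by (simp add: pad_zero)
        next
          assume "?w = 0"
          then show "d i x = \<zero>\<^bsub>?F (b i)\<^esub>"
            unfolding dx by (simp only: crop_zero[of _ V])
        qed
      qed
      then show ?thesis
        using image[of "Suc i"] by (auto simp: P.relations_def)
    qed
  qed
  then show ?thesis
    by blast
qed

section \<open>Homomorphisms from free modules into S/I\<close>

locale poly_quotient =
  fixes V :: "'v set" and I :: "('v, 'k::field) mpoly set"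
  assumes ideal: "P.ideal_in V I"
begin

abbreviation "R \<equiv> poly_ring V :: ('v, 'k) mpoly ring"
abbreviation "F n \<equiv> free_mod R n"
abbreviation "M \<equiv> quot_module R I"

definition coset :: "('v, 'k) mpoly \<Rightarrow> ('v, 'k) mpoly set" where
  "coset p = (\<lambda>i. i + p) ` I"

lemma I_sub: "I \<subseteq> polys V" and I_zero [simp]: "0 \<in> I"
  and I_add: "p \<in> I \<Longrightarrow> q \<in> I \<Longrightarrow> p + q \<in> I"
  and I_mult: "a \<in> polys V \<Longrightarrow> p \<in> I \<Longrightarrow> a * p \<in> I"
  using ideal by (auto simp: P.ideal_in_def)

lemma I_uminus: "p \<in> I \<Longrightarrow> - p \<in> I"
  using I_mult[of "- 1" p] by simp

lemma I_diff: "p \<in> I \<Longrightarrow> q \<in> I \<Longrightarrow> p - q \<in> I"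
  using I_add[of p "- q"] I_uminus by simp

lemma coset_eq_iff: "coset p = coset q \<longleftrightarrow> p - q \<in> I"
proof
  assume "coset p = coset q"
  moreover have "p \<in> coset p"
    unfolding coset_def by (rule image_eqI[of _ _ 0]) auto
  ultimately show "p - q \<in> I"
    by (auto simp: coset_def)
next
  assume pq: "p - q \<in> I"
  show "coset p = coset q"
    unfolding coset_def
  proof (intro equalityI image_subsetI)
    show "i + p \<in> (\<lambda>i. i + q) ` I" if "i \<in> I" for i
      using I_add[OF that pq] by (intro image_eqI[of _ _ "i + (p - q)"]) auto
    show "i + q \<in> (\<lambda>i. i + p) ` I" if "i \<in> I" for i
      using I_diff[OF that pq] by (intro image_eqI[of _ _ "i - (p - q)"]) auto
  qed
qed

lemma a_r_coset: "I +>\<^bsub>R\<^esub> p = coset p"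
  by (auto simp: a_r_coset_def r_coset_def coset_def)

lemma carrier_M: "carrier M = coset ` polys V"
  by (auto simp: quot_module_def FactRing_def A_RCOSETS_def RCOSETS_def a_r_coset[unfolded a_r_coset_def, simplified])

lemma add_M: "coset p \<oplus>\<^bsub>M\<^esub> coset q = coset (p + q)"
proof -
  have "coset p \<oplus>\<^bsub>M\<^esub> coset q = (\<Union>h\<in>coset p. \<Union>k\<in>coset q. {h + k})"
    by (simp add: quot_module_def FactRing_def set_add_def set_mult_def)
  also have "\<dots> = coset (p + q)"
  proof (intro equalityI subsetI)
    fix x
    assume "x \<in> (\<Union>h\<in>coset p. \<Union>k\<in>coset q. {h + k})"
    then obtain i j where "i \<in> I" "j \<in> I" "x = (i + j) + (p + q)"
      by (auto simp: coset_def algebra_simps)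
    then show "x \<in> coset (p + q)"
      using I_add by (auto simp: coset_def)
  next
    fix x
    assume "x \<in> coset (p + q)"
    then obtain i where "i \<in> I" "x = (i + p) + (0 + q)"
      by (auto simp: coset_def algebra_simps)
    then show "x \<in> (\<Union>h\<in>coset p. \<Union>k\<in>coset q. {h + k})"
      unfolding coset_def using I_zero by blast
  qed
  finally show ?thesis .
qed

lemma zero_M: "\<zero>\<^bsub>M\<^esub> = coset 0"
  by (simp add: quot_module_def FactRing_def coset_def)

lemma smult_M:
  assumes "a \<in> polys V" "p \<in> polys V"
  shows "a \<odot>\<^bsub>M\<^esub> coset p = coset (a * p)"
proof -
  have "coset (a' * p') = coset (a * p)" if "a' \<in> coset a" "p' \<in> coset p" for a' p'
  proof -
    from that obtain i j where ij: "i \<in> I" "j \<in> I" "a' = i + a" "p' = j + p"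
      by (auto simp: coset_def)
    then have "a' * p' - a * p = (j + p) * i + a * j"
      by (simp add: algebra_simps)
    also have "\<dots> \<in> I"
      using ij I_sub assms by (intro I_add I_mult) auto
    finally show ?thesis
      by (simp add: coset_eq_iff)
  qed
  moreover have "a \<in> coset a" "p \<in> coset p"
    by (auto simp: coset_def intro!: image_eqI[of _ _ 0])
  ultimately have "(\<Union>a'\<in>coset a. \<Union>p'\<in>coset p. coset (a' * p')) = coset (a * p)"
    by blast
  then show ?thesis
    by (simp add: quot_module_def FactRing_def rcoset_mult_def a_r_coset)
qed

definition hom_of :: "nat \<Rightarrow> ((nat \<Rightarrow> ('v, 'k) mpoly) \<Rightarrow> nat \<Rightarrow> ('v, 'k) mpoly) \<Rightarrow>
    (nat \<Rightarrow> ('v, 'k) mpoly) \<Rightarrow> ('v, 'k) mpoly set" where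
  "hom_of n H = (\<lambda>x\<in>carrier (F n). coset (H (pad n x) 0))"

lemma hom_of_in:
  assumes H: "P.lin V n 1 H"
  shows "hom_of n H \<in> module_hom R (F n) M"
  unfolding module_hom_def hom_of_def
  using P.vecs_in[OF P.lin_in[OF H pad_in]]
  by (auto simp: free_mod_closed pad_add pad_smult pad_in P.lin_add[OF H] P.lin_smul[OF H] add_M smult_M carrier_M)

text \<open>Representatives of the images of the unit vectors define the lift. Agreement is proved
  by induction on finite sets of indices, because the cosets carry only the operations of the module
  record and no type class sums.\<close>

lemma hom_of_surj:
  assumes h: "h \<in> module_hom R (F n) M"
  obtains H where "P.lin V n 1 H" "h = hom_of n H"
proof -
  have hC: "h x \<in> carrier M" if "x \<in> carrier (F n)" for x
    using h that by (auto simp: module_hom_def)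
  have "\<exists>p\<in>polys V. h (crop n (unit_vec k)) = coset p" if "k < n" for k
    using hC[OF crop_in[OF P.unit_vec_in[OF that]]] by (auto simp: carrier_M)
  then obtain p where p: "\<And>k. k < n \<Longrightarrow> p k \<in> polys V \<and> h (crop n (unit_vec k)) = coset (p k)"
    by metis
  define H where "H = (\<lambda>u :: nat \<Rightarrow> ('v, 'k) mpoly. \<Sum>k<n. smul (u k) (smul (p k) (unit_vec 0)))"
  have H: "P.lin V n 1 H"
    unfolding H_def using p by (intro P.lin_combination P.vecs_smul P.unit_vec_in) auto
  have eq: "h (crop n u) = coset (H u 0)" if u: "u \<in> P.vecs V n" for u
  proof -
    have "h (crop n (\<Sum>k\<in>S. smul (u k) (unit_vec k))) = coset (\<Sum>k\<in>S. u k * p k)" if "S \<subseteq> {..<n}" for S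
      using finite_subset[OF that finite_lessThan] that
    proof (induction S rule: finite_induct)
      case empty
      obtain p' where p': "p' \<in> polys V" "h (crop n 0) = coset p'"
        using hC[OF crop_in[OF P.vecs_0]] by (auto simp: carrier_M)
      have c0: "crop n 0 \<in> carrier (F n)"
        by (rule crop_in) simp
      have "h (crop n (smul 0 0)) = 0 \<odot>\<^bsub>M\<^esub> h (crop n 0)"
        using h c0 unfolding crop_smul[of _ _ _ V] module_hom_def by simp
      then show ?case
        using p' smult_M[of 0 p'] by (simp only: smul_simps(7) P.zero_in sum.empty mult_zero_left)
    next
      case (insert k S)
      have k: "k < n"
        using insert.prems by simp
      have uk: "u k \<in> polys V"
        by (rule P.vecs_in[OF u])
      have c1: "crop n (unit_vec k) \<in> carrier (F n)"
        using k by (intro crop_in) simp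
      have 1: "h (crop n (smul (u k) (unit_vec k))) = coset (u k * p k)"
        using h c1 p[OF k] uk smult_M[of "u k" "p k"] unfolding crop_smul[of _ _ _ V] module_hom_def by simp
      have in1: "smul (u k) (unit_vec k) \<in> P.vecs V n"
        using uk k by (intro P.vecs_smul) auto
      have in2: "(\<Sum>k\<in>S. smul (u k) (unit_vec k)) \<in> P.vecs V n"
        using insert.prems P.vecs_in[OF u] by (intro P.submod_sum[OF P.submod_vecs] P.vecs_smul) auto
      have "h (crop n (smul (u k) (unit_vec k) + (\<Sum>k\<in>S. smul (u k) (unit_vec k)))) =
          h (crop n (smul (u k) (unit_vec k))) \<oplus>\<^bsub>M\<^esub> h (crop n (\<Sum>k\<in>S. smul (u k) (unit_vec k)))"
        using h crop_in[OF in1] crop_in[OF in2] unfolding crop_add[of _ _ _ V] by (simp add: module_hom_def)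
      then show ?case
        using insert 1 by (simp only: sum.insert insert_subset simp_thms add_M)
    qed
    from this[of "{..<n}"] show ?thesis
      using P.vec_expand[OF u] by (simp add: H_def sum_fun_apply unit_vec_def)
  qed
  have "h = hom_of n H"
  proof (rule extensionalityI[of _ "carrier (F n)"])
    show "h \<in> extensional (carrier (F n))"
      using h by (auto simp: module_hom_def PiE_def)
    show "hom_of n H \<in> extensional (carrier (F n))"
      by (simp add: hom_of_def)
    show "h x = hom_of n H x" if "x \<in> carrier (F n)" for x
      using eq[OF pad_in[OF that]] crop_pad[OF that] that by (simp add: hom_of_def)
  qed
  with H that show ?thesis
    by blast
qed

lemma hom_of_eq_iff:
  assumes H: "P.lin V n 1 H" and H': "P.lin V n 1 H'"
  shows "hom_of n H = hom_of n H' \<longleftrightarrow> (\<forall>u\<in>P.vecs V n. H u - H' u \<in> P.one_vec V I)"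
proof -
  have "hom_of n H = hom_of n H' \<longleftrightarrow> (\<forall>x\<in>carrier (F n). coset (H (pad n x) 0) = coset (H' (pad n x) 0))"
    by (auto simp: hom_of_def fun_eq_iff restrict_def)
  also have "\<dots> \<longleftrightarrow> (\<forall>u\<in>P.vecs V n. coset (H u 0) = coset (H' u 0))"
    using pad_in pad_crop crop_in by metis
  also have "\<dots> \<longleftrightarrow> (\<forall>u\<in>P.vecs V n. H u - H' u \<in> P.one_vec V I)"
    using P.lin_in[OF P.lin_minus[OF H H']] by (auto simp: coset_eq_iff P.one_vec_def)
  finally show ?thesis .
qed

lemma hom_of_mult:
  assumes H: "P.lin V n 1 H" and H': "P.lin V n 1 H'"
  shows "hom_of n H \<otimes>\<^bsub>hom_group R (F n) M\<^esub> hom_of n H' = hom_of n (\<lambda>u. H u + H' u)"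
  by (auto simp: hom_group_def hom_of_def fun_eq_iff add_M)

lemma hom_of_one: "\<one>\<^bsub>hom_group R (F n) M\<^esub> = hom_of n (\<lambda>_. 0)"
  by (auto simp: hom_group_def hom_of_def fun_eq_iff zero_M)

context
  fixes b d \<epsilon>
  assumes res: "free_resolution R residue_field b d \<epsilon>"
begin

abbreviation "b' \<equiv> aug_b b"
abbreviation "d' \<equiv> aug_d b d \<epsilon>"

lemma b'_simps: "b' 0 = 1" "b' (Suc i) = b i"
  by (simp_all add: aug_b_def)

lemma d'_Suc: "d' (Suc i) u = pad (b i) (d i (crop (b (Suc i)) u))"
  by (simp add: aug_d_def)

lemma lin_d': "P.lin V (b' (Suc i)) (b' i) (d' i)"
  using aug_d_resolves[OF res] by (simp add: P.resolves_def)

lemma d_hom: "d i \<in> module_hom R (F (b (Suc i))) (F (b i))"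
  using res by (simp add: free_resolution_def)

lemma d_in: "x \<in> carrier (F (b (Suc i))) \<Longrightarrow> d i x \<in> carrier (F (b i))"
  using d_hom[of i] by (auto simp: module_hom_def)

lemma cocycles_eq:
  "cocycles R M b d i = hom_of (b i) ` {H. P.lin V (b i) 1 H \<and>
     (\<forall>u\<in>P.vecs V (b (Suc i)). H (d' (Suc i) u) \<in> P.one_vec V I)}"
proof -
  have "(\<forall>x\<in>carrier (F (b (Suc i))). hom_of (b i) H (d i x) = \<zero>\<^bsub>M\<^esub>) \<longleftrightarrow>
      (\<forall>u\<in>P.vecs V (b (Suc i)). H (d' (Suc i) u) \<in> P.one_vec V I)" if H: "P.lin V (b i) 1 H" for H
  proof -
    have "(\<forall>x\<in>carrier (F (b (Suc i))). hom_of (b i) H (d i x) = \<zero>\<^bsub>M\<^esub>) \<longleftrightarrow>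
        (\<forall>x\<in>carrier (F (b (Suc i))). H (pad (b i) (d i x)) 0 \<in> I)"
      by (auto simp: hom_of_def d_in zero_M coset_eq_iff)
    also have "\<dots> \<longleftrightarrow> (\<forall>u\<in>P.vecs V (b (Suc i)). H (d' (Suc i) u) 0 \<in> I)"
      unfolding d'_Suc using pad_in pad_crop crop_in crop_pad by metis
    also have "\<dots> \<longleftrightarrow> (\<forall>u\<in>P.vecs V (b (Suc i)). H (d' (Suc i) u) \<in> P.one_vec V I)"
      using P.lin_in[OF H] P.lin_in[OF lin_d'[of "Suc i"]] by (auto simp: P.one_vec_def b'_simps)
    finally show ?thesis .
  qed
  note iff = this
  show ?thesis
  proof (intro Set.set_eqI iffI)
    fix h
    assume h: "h \<in> cocycles R M b d i"
    then obtain H where "P.lin V (b i) 1 H" "h = hom_of (b i) H"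
      using hom_of_surj[of h "b i"] unfolding cocycles_def by blast
    then show "h \<in> hom_of (b i) ` {H. P.lin V (b i) 1 H \<and>
        (\<forall>u\<in>P.vecs V (b (Suc i)). H (d' (Suc i) u) \<in> P.one_vec V I)}"
      using h iff unfolding cocycles_def by blast
  next
    fix h
    assume "h \<in> hom_of (b i) ` {H. P.lin V (b i) 1 H \<and>
        (\<forall>u\<in>P.vecs V (b (Suc i)). H (d' (Suc i) u) \<in> P.one_vec V I)}"
    then show "h \<in> cocycles R M b d i"
      using hom_of_in[of "b i"] iff unfolding cocycles_def by blast
  qed
qed

text \<open>In degree 0 the definition provides only the zero map, which corresponds to the clause G
  = 0; in higher degrees the primitives are lifted like all homomorphisms.\<close>

lemma coboundaries_eq:
  "coboundaries R M b d i = hom_of (b i) ` {\<lambda>u. G (d' i u) |G. P.lin V (b' i) 1 G \<and> (i = 0 \<longrightarrow> G = (\<lambda>_. 0))}"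
proof (cases i)
  case 0
  have "{\<lambda>u. G (d' i u) |G. P.lin V (b' i) 1 G \<and> (i = 0 \<longrightarrow> G = (\<lambda>_. 0))} = {\<lambda>_. 0}"
  proof (intro equalityI subsetI)
    fix H
    assume "H \<in> {\<lambda>u. G (d' i u) |G. P.lin V (b' i) 1 G \<and> (i = 0 \<longrightarrow> G = (\<lambda>_. 0))}"
    then show "H \<in> {\<lambda>_. 0}"
      using 0 by auto
  next
    fix H
    assume "H \<in> {\<lambda>_ :: nat \<Rightarrow> ('v, 'k) mpoly. 0 :: nat \<Rightarrow> ('v, 'k) mpoly}"
    then show "H \<in> {\<lambda>u. G (d' i u) |G. P.lin V (b' i) 1 G \<and> (i = 0 \<longrightarrow> G = (\<lambda>_. 0))}"
      using P.lin_zero_map[of V "b' i" 1] by (intro CollectI exI[of _ "\<lambda>_. 0"]) auto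
  qed
  then show ?thesis
    unfolding coboundaries_def using 0 hom_of_one[of "b 0"] by (simp only: nat.case image_insert image_empty)
next
  case (Suc j)
  have comp: "compose (carrier (F (b i))) (hom_of (b j) G) (d j) = hom_of (b i) (\<lambda>u. G (d' i u))" for G
    using Suc d_in by (auto simp: compose_def hom_of_def fun_eq_iff d'_Suc crop_pad)
  have "coboundaries R M b d i = (\<lambda>h. compose (carrier (F (b i))) h (d j)) ` hom_of (b j) ` {G. P.lin V (b j) 1 G}"
    unfolding coboundaries_def Suc nat.case using hom_of_in hom_of_surj[of _ "b j"]
    by (intro arg_cong[of _ _ "(`) _"]) blast
  then show ?thesis
    using Suc comp by (auto simp: image_image b'_simps)
qed

lemma image_Collect_iff: "x \<in> f ` {g z |z. Q z} \<longleftrightarrow> (\<exists>z. Q z \<and> x = f (g z))"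
  by blast

text \<open>Triviality of the quotient means that every cocycle is a coboundary. This is checked
  directly on cosets: the lifted coboundaries contain zero and are closed under sums and
  differences.\<close>

lemma hom_cohomology_trivial_iff:
  "carrier (hom_cohomology R M b d i) = {\<one>\<^bsub>hom_cohomology R M b d i\<^esub>} \<longleftrightarrow> P.cohomology_vanishes V b' d' I i"
proof -
  let ?Z = "{H. P.lin V (b i) 1 H \<and> (\<forall>u\<in>P.vecs V (b (Suc i)). H (d' (Suc i) u) \<in> P.one_vec V I)}"
  let ?B = "{\<lambda>u. G (d' i u) |G. P.lin V (b' i) 1 G \<and> (i = 0 \<longrightarrow> G = (\<lambda>_. 0))}"
  let ?G = "(hom_group R (F (b i)) M)\<lparr>carrier := cocycles R M b d i\<rparr>"
  let ?cob = "coboundaries R M b d i"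
  have B_lin: "P.lin V (b i) 1 H" if "H \<in> ?B" for H
    using that P.lin_comp[OF lin_d'] by (auto simp: b'_simps)
  have B_zero: "(\<lambda>_. 0) \<in> ?B"
    using P.lin_zero_map[of V "b' i" 1] by fastforce
  have B_add: "(\<lambda>u. H u + H' u) \<in> ?B" "(\<lambda>u. H u - H' u) \<in> ?B" if "H \<in> ?B" "H' \<in> ?B" for H H'
  proof -
    from that obtain G G' where G: "P.lin V (b' i) 1 G" "i = 0 \<longrightarrow> G = (\<lambda>_. 0)" "H = (\<lambda>u. G (d' i u))"
      "P.lin V (b' i) 1 G'" "i = 0 \<longrightarrow> G' = (\<lambda>_. 0)" "H' = (\<lambda>u. G' (d' i u))"
      by blast
    have "P.lin V (b' i) 1 (\<lambda>u. G u + G' u)" "P.lin V (b' i) 1 (\<lambda>u. G u - G' u)"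
      using P.lin_plus[OF G(1,4)] P.lin_minus[OF G(1,4)] .
    moreover have "i = 0 \<longrightarrow> (\<lambda>u. G u + G' u) = (\<lambda>_. 0)" "i = 0 \<longrightarrow> (\<lambda>u. G u - G' u) = (\<lambda>_. 0)"
      using G by auto
    ultimately show "(\<lambda>u. H u + H' u) \<in> ?B" "(\<lambda>u. H u - H' u) \<in> ?B"
      unfolding G(3,6)
      by (intro CollectI exI[of _ "\<lambda>u. G u + G' u"] exI[of _ "\<lambda>u. G u - G' u"] conjI refl; simp)+
  qed
  have carr: "carrier (hom_cohomology R M b d i) = (\<lambda>a. ?cob #>\<^bsub>?G\<^esub> a) ` cocycles R M b d i"
    by (simp add: hom_cohomology_def carrier_FactGroup)
  have one: "\<one>\<^bsub>hom_cohomology R M b d i\<^esub> = ?cob"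
    by (simp add: hom_cohomology_def)
  have coset: "?cob #>\<^bsub>?G\<^esub> hom_of (b i) H = (\<lambda>K. hom_of (b i) (\<lambda>u. K u + H u)) ` ?B" if H: "P.lin V (b i) 1 H" for H
    unfolding r_coset_def coboundaries_eq using hom_of_mult[OF B_lin H] by auto
  have in_cob: "hom_of (b i) H \<in> ?cob \<longleftrightarrow> (\<exists>G. P.lin V (b' i) 1 G \<and> (i = 0 \<longrightarrow> G = (\<lambda>_. 0)) \<and>
      (\<forall>u\<in>P.vecs V (b' (Suc i)). H u - G (d' i u) \<in> P.one_vec V I))" if H: "P.lin V (b i) 1 H" for H
  proof -
    have "hom_of (b i) H \<in> ?cob \<longleftrightarrow> (\<exists>G. P.lin V (b' i) 1 G \<and> (i = 0 \<longrightarrow> G = (\<lambda>_. 0)) \<and>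
        hom_of (b i) H = hom_of (b i) (\<lambda>u. G (d' i u)))"
      unfolding coboundaries_eq image_Collect_iff by (simp only: conj_assoc)
    also have "\<dots> \<longleftrightarrow> (\<exists>G. P.lin V (b' i) 1 G \<and> (i = 0 \<longrightarrow> G = (\<lambda>_. 0)) \<and>
        (\<forall>u\<in>P.vecs V (b' (Suc i)). H u - G (d' i u) \<in> P.one_vec V I))"
      using hom_of_eq_iff[OF H P.lin_comp[OF lin_d'[of i], unfolded b'_simps(2)]]
      by (simp only: b'_simps(2) cong: conj_cong)
    finally show ?thesis .
  qed
  have van: "P.cohomology_vanishes V b' d' I i \<longleftrightarrow> (\<forall>H\<in>?Z. hom_of (b i) H \<in> ?cob)"
    unfolding P.cohomology_vanishes_def b'_simps(2)[of i] using in_cob[unfolded b'_simps(2)]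
    by (auto simp: b'_simps(2))
  show ?thesis
  proof
    assume triv: "carrier (hom_cohomology R M b d i) = {\<one>\<^bsub>hom_cohomology R M b d i\<^esub>}"
    have "hom_of (b i) H \<in> ?cob" if H: "H \<in> ?Z" for H
    proof -
      have "?cob #>\<^bsub>?G\<^esub> hom_of (b i) H = ?cob"
        using triv H unfolding carr one cocycles_eq by blast
      moreover have "hom_of (b i) (\<lambda>u. 0 + H u) \<in> (\<lambda>K. hom_of (b i) (\<lambda>u. K u + H u)) ` ?B"
        using B_zero by (rule image_eqI[rotated]) simp
      ultimately show ?thesis
        using coset[of H] H by simp
    qed
    then show "P.cohomology_vanishes V b' d' I i"
      unfolding van by blast
  next
    assume "P.cohomology_vanishes V b' d' I i"
    then have sub: "hom_of (b i) H \<in> ?cob" if "H \<in> ?Z" for H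
      using van that by blast
    have "?cob #>\<^bsub>?G\<^esub> a = ?cob" if a: "a \<in> cocycles R M b d i" for a
    proof -
      have "a \<in> ?cob"
        using a sub unfolding cocycles_eq by blast
      then obtain K where K: "K \<in> ?B" "a = hom_of (b i) K"
        unfolding coboundaries_eq by blast
      have "(\<lambda>L. hom_of (b i) (\<lambda>u. L u + K u)) ` ?B = hom_of (b i) ` ?B"
      proof (intro equalityI image_subsetI)
        show "hom_of (b i) (\<lambda>u. L u + K u) \<in> hom_of (b i) ` ?B" if "L \<in> ?B" for L
          using B_add(1)[OF that K(1)] by (rule imageI)
        show "hom_of (b i) L \<in> (\<lambda>L. hom_of (b i) (\<lambda>u. L u + K u)) ` ?B" if "L \<in> ?B" for L
          using B_add(2)[OF that K(1)] by (rule image_eqI[rotated]) simp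
      qed
      then show ?thesis
        unfolding K(2) coset[OF B_lin[OF K(1)]] unfolding coboundaries_eq .
    qed
    moreover have "cocycles R M b d i \<noteq> {}"
    proof -
      have "(\<lambda>_. 0) \<in> ?Z"
        using P.lin_zero_map P.submod_0[OF P.submod_one_vec[OF ideal]] by auto
      then show ?thesis
        unfolding cocycles_eq by blast
    qed
    ultimately show "carrier (hom_cohomology R M b d i) = {\<one>\<^bsub>hom_cohomology R M b d i\<^esub>}"
      unfolding carr one by blast
  qed
qed

end

theorem Ext_trivial_iff:
  assumes V: "finite V"
  shows "carrier (Ext R residue_field M i) = {\<one>\<^bsub>Ext R residue_field M i\<^esub>} \<longleftrightarrow> ext_vanishes V V I i"
proof -
  obtain b d where bd: "(SOME (b, d). \<exists>\<epsilon>. free_resolution R residue_field b d \<epsilon>) = (b, d)"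
    by fastforce
  have "\<exists>p. case p of (b, d) \<Rightarrow> \<exists>\<epsilon>. free_resolution R residue_field b d \<epsilon>"
    using exists_free_resolution[OF V] by auto
  from someI_ex[OF this] obtain \<epsilon> where \<epsilon>: "free_resolution R residue_field b d \<epsilon>"
    unfolding bd by auto
  have "Ext R residue_field M i = hom_cohomology R M b d i"
    unfolding Ext_def bd by simp
  moreover have "P.cohomology_vanishes V (aug_b b) (aug_d b d \<epsilon>) I i \<longleftrightarrow> ext_vanishes V V I i"
    using ext_vanishesI[OF ideal aug_d_resolves[OF \<epsilon>]] aug_d_resolves[OF \<epsilon>] unfolding ext_vanishes_def by blast
  ultimately show ?thesis
    using hom_cohomology_trivial_iff[OF \<epsilon>] by simp
qed

end

section \<open>Depth of edge ideals\<close>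

definition edges_on :: "'v set \<Rightarrow> 'v set set \<Rightarrow> bool" where
  "edges_on V E \<longleftrightarrow> (\<forall>e\<in>E. \<exists>u\<in>V. \<exists>w\<in>V. u \<noteq> w \<and> e = {u, w})"

lemma cring_poly_ring: "cring (poly_ring V :: ('v, 'k::field) mpoly ring)"
proof (rule cringI)
  show "abelian_group (poly_ring V :: ('v, 'k) mpoly ring)"
  proof (rule abelian_groupI)
    show "\<exists>y\<in>carrier (poly_ring V). y \<oplus>\<^bsub>poly_ring V\<^esub> x = \<zero>\<^bsub>poly_ring V\<^esub>"
      if "x \<in> carrier (poly_ring V)" for x :: "('v, 'k) mpoly"
      using that by (intro bexI[of _ "- x"]) auto
  qed (auto simp: add.assoc add.commute)
  show "comm_monoid (poly_ring V :: ('v, 'k) mpoly ring)"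
    by (rule comm_monoidI) (auto simp: mult.assoc mult.commute)
qed (auto simp: distrib_right)

lemma ideal_poly_ring:
  assumes "P.ideal_in V (J :: ('v, 'k::field) mpoly set)"
  shows "ideal J (poly_ring V)"
proof (rule idealI)
  interpret poly_quotient V J
    by standard (rule assms)
  interpret R: cring R
    by (rule cring_poly_ring)
  show "ring R"
    by (rule R.ring_axioms)
  have "inv\<^bsub>add_monoid R\<^esub> p = - p" if "p \<in> J" for p
    using that I_sub R.minus_equality[of "- p" p] by (auto simp: a_inv_def)
  then show "subgroup J (add_monoid R)"
    using I_sub I_add I_uminus by unfold_locales auto
  show "x \<otimes>\<^bsub>R\<^esub> a \<in> J" "a \<otimes>\<^bsub>R\<^esub> x \<in> J" if "a \<in> J" "x \<in> carrier R" for a x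
    using I_mult[of x a] that by (simp_all add: mult.commute)
qed

lemma sum_monomials: "p = (\<Sum>m\<in>keys p. single m (lookup p m))"
proof (rule poly_mapping_eqI)
  fix m
  have "(\<Sum>n\<in>keys p. lookup (single n (lookup p n)) m) = (\<Sum>n\<in>keys p. if n = m then lookup p m else 0)"
    by (intro sum.cong) (auto simp: lookup_single when_def)
  then show "lookup p m = lookup (\<Sum>m\<in>keys p. single m (lookup p m)) m"
    by (simp add: lookup_sum in_keys_iff)
qed

text \<open>A monomial whose support is not independent is divisible by the product of the ends of
  an edge, so it lies in the generated ideal; conversely that ideal is the least one containing the
  generators.\<close>

lemma edge_ideal_eq:
  assumes E: "edges_on (gverts H) (gedges H)"
  shows "(edge_ideal H :: ('v, 'k::field) mpoly set) = sr_ideal (gverts H) (ind_complex (gverts H) (gedges H))"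
proof -
  let ?V = "gverts H" and ?E = "gedges H"
  let ?R = "poly_ring ?V :: ('v, 'k) mpoly ring"
  let ?S = "{pvar u * pvar w |u w. {u, w} \<in> ?E} :: ('v, 'k) mpoly set"
  let ?J = "sr_ideal ?V (ind_complex ?V ?E) :: ('v, 'k) mpoly set"
  interpret R: cring ?R
    by (rule cring_poly_ring)
  have edge: "u \<in> ?V" "w \<in> ?V" if "{u, w} \<in> ?E" for u w
    using E that unfolding edges_on_def by (metis doubleton_eq_iff)+
  have S: "?S \<subseteq> carrier ?R"
    using edge by auto
  have "?S \<subseteq> ?J"
  proof
    fix p
    assume "p \<in> ?S"
    then obtain u w where uw: "{u, w} \<in> ?E" "p = pvar u * pvar w"
      by blast
    have "p \<in> polys ?V"
      using S uw by auto
    moreover have "keys m \<notin> ind_complex ?V ?E" if "m \<in> keys p" for m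
    proof -
      have "m \<in> (\<lambda>m. m + single u 1) ` keys (pvar w :: ('v, 'k) mpoly)"
        using that unfolding uw(2) keys_pvar_mult .
      then have "keys m = {u, w}"
        by (auto simp: pvar_def keys_add_var[unfolded One_nat_def])
      then show ?thesis
        using uw(1) by (auto simp: ind_complex_def indep_def)
    qed
    ultimately show "p \<in> ?J"
      by (simp add: sr_ideal_def)
  qed
  then have "genideal ?R ?S \<subseteq> ?J"
    by (intro R.genideal_minimal ideal_poly_ring ideal_sr simplicial_complex_ind_complex)
  moreover have "?J \<subseteq> genideal ?R ?S"
  proof
    interpret G: ideal "genideal ?R ?S" ?R
      by (rule R.genideal_ideal[OF S])
    fix p
    assume p: "p \<in> ?J"
    have "single m (lookup p m) \<in> genideal ?R ?S" if m: "m \<in> keys p" for m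
    proof -
      have mV: "keys m \<subseteq> ?V" "keys m \<notin> ind_complex ?V ?E"
        using p m by (auto simp: sr_ideal_def polys_def)
      then obtain u w where uw: "u \<in> keys m" "w \<in> keys m" "{u, w} \<in> ?E"
        by (auto simp: ind_complex_def indep_def)
      obtain n where n: "m = n + single u 1"
        using monomial_div[OF uw(1)] .
      \<comment> \<open>As the ends of an edge are distinct, dividing by the variable of u leaves w
        in the support, and the second division is possible.\<close>
      have "u \<noteq> w"
        using E uw(3) unfolding edges_on_def by (metis doubleton_eq_iff)
      then have "w \<in> keys n"
        using uw(2) unfolding n keys_add_var by blast
      then obtain n' where n': "n = n' + single w 1"
        by (rule monomial_div)
      let ?q = "single n' (lookup p m) :: ('v, 'k) mpoly"
      have "keys n' \<subseteq> ?V"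
        using mV(1) unfolding n n' keys_add_var by blast
      then have q: "?q \<in> polys ?V"
        by (auto simp: polys_def)
      have "pvar u * pvar w \<in> genideal ?R ?S"
        using R.genideal_self[OF S] uw(3) by blast
      from G.I_l_closed[OF this, of ?q] have "?q * (pvar u * pvar w) \<in> genideal ?R ?S"
        using q by simp
      moreover have "?q * (pvar u * pvar w) = single m (lookup p m)"
        by (simp add: pvar_def mult_single n n' ac_simps)
      ultimately show ?thesis
        by simp
    qed
    note monomial = this
    have "(\<Sum>m\<in>K. single m (lookup p m)) \<in> genideal ?R ?S" if "K \<subseteq> keys p" for K
      using finite_subset[OF that finite_keys] that
    proof (induction K rule: finite_induct)
      case empty
      then show ?case
        using G.zero_closed by simp
    next
      case (insert m K)
      then show ?case
        using G.a_closed monomial by simp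
    qed
    from this[of "keys p"] show "p \<in> genideal ?R ?S"
      using sum_monomials[of p] by simp
  qed
  ultimately show ?thesis
    by (simp add: edge_ideal_def)
qed

text \<open>The elimination ordering excludes degrees below \<open>card D\<close>, while D itself
  yields a nonzero group in some degree at most \<open>card D\<close>; the two bounds meet.\<close>

theorem edge_depth_eq:
  fixes H :: "'v graph"
  assumes V: "finite (gverts H)" and E: "edges_on (gverts H) (gedges H)"
    and rank: "elimination_rank (gverts H) (gedges H) r"
    and D: "max_indep (gverts H) (gedges H) D"
    and min: "\<And>D'. max_indep (gverts H) (gedges H) D' \<Longrightarrow> card D \<le> card D'"
  shows "edge_depth TYPE('k::field) H = card D"
proof -
  let ?V = "gverts H" and ?E = "gedges H"
  let ?J = "sr_ideal ?V (ind_complex ?V ?E) :: ('v, 'k) mpoly set"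
  interpret poly_quotient ?V ?J
    by standard (rule ideal_sr[OF simplicial_complex_ind_complex])
  have "edge_depth TYPE('k) H = (LEAST i. \<not> ext_vanishes ?V ?V ?J i)"
    by (simp add: edge_depth_def depth_def Let_def edge_ideal_eq[OF E] Ext_trivial_iff[OF V])
  also have "\<dots> = card D"
  proof -
    have loop: "{u} \<notin> ?E" for u
      using E unfolding edges_on_def by (metis doubleton_eq_iff insert_absorb2)
    have below: "ext_vanishes ?V ?V ?J j" if "j < card D" for j
      by (rule ext_vanishes_below[OF V loop rank subset_refl min that])
    obtain j where j: "j \<le> card D" "\<not> ext_vanishes ?V ?V ?J j"
      using ext_nonvanishing_max_indep[OF V D] by blast
    then have "j = card D"
      using below by (meson le_neq_implies_less)
    then show ?thesis
      using j below by (intro Least_equality) (auto simp: not_less[symmetric])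
  qed
  finally show ?thesis .
qed

section \<open>Maximal independent sets of fan graphs\<close>

definition fan_verts :: "'v set \<Rightarrow> 'q set \<Rightarrow> ('q \<Rightarrow> 'v set) \<Rightarrow> 'v set" where
  "fan_verts N Q C = N \<union> (\<Union>q\<in>Q. C q)"

definition fan_edges :: "'v set \<Rightarrow> 'q set \<Rightarrow> ('q \<Rightarrow> 'v set) \<Rightarrow> 'v set set" where
  "fan_edges N Q C = clique_edges N \<union> (\<Union>q\<in>Q. clique_edges (C q))"

lemma clique_edges_iff: "{u, w} \<in> clique_edges C \<longleftrightarrow> u \<in> C \<and> w \<in> C \<and> u \<noteq> w"
  by (auto simp: clique_edges_def doubleton_eq_iff)

lemma fan_edges_iff:
  "{u, w} \<in> fan_edges N Q C \<longleftrightarrow> u \<noteq> w \<and> (u \<in> N \<and> w \<in> N \<or> (\<exists>q\<in>Q. u \<in> C q \<and> w \<in> C q))"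
  by (auto simp: fan_edges_def clique_edges_iff)

text \<open>A core clique N with attached cliques, each having vertices of its own outside N. The
  numbers sought depend only on how many attached cliques contain a given core vertex.\<close>

locale clique_fan =
  fixes N :: "'v set" and Q :: "'q set" and C :: "'q \<Rightarrow> 'v set"
  assumes finite_N: "finite N" and finite_Q: "finite Q" and finite_C: "\<And>q. q \<in> Q \<Longrightarrow> finite (C q)"
    and new_vertex: "\<And>q. q \<in> Q \<Longrightarrow> C q - N \<noteq> {}"
    and disjoint_new: "\<And>q q' y. q \<in> Q \<Longrightarrow> q' \<in> Q \<Longrightarrow> y \<in> C q \<Longrightarrow> y \<in> C q' \<Longrightarrow> y \<notin> N \<Longrightarrow> q = q'"
begin

abbreviation "X \<equiv> fan_verts N Q C"
abbreviation "E \<equiv> fan_edges N Q C"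

lemma finite_X: "finite X"
  using finite_N finite_Q finite_C by (simp add: fan_verts_def)

lemma edges_on_X: "edges_on X E"
  by (force simp: edges_on_def fan_edges_def fan_verts_def clique_edges_def)

lemma adjacent_new:
  assumes "q \<in> Q" "y \<in> C q" "y \<notin> N"
  shows "{u, y} \<in> E \<longleftrightarrow> u \<noteq> y \<and> u \<in> C q" and "{y, u} \<in> E \<longleftrightarrow> u \<noteq> y \<and> u \<in> C q"
  using assms disjoint_new unfolding fan_edges_iff by blast+

text \<open>New vertices are simplicial, and after them only the clique N remains, where every order
  is fine. The root v is put strictly on top so that the ordering survives attaching something at
  v.\<close>

lemma elimination_rank_X:
  assumes "v \<in> N"
  defines "r \<equiv> \<lambda>u. if u = v then 2 else if u \<in> N then 1 else (0 :: nat)"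
  shows "elimination_rank X E r" and "\<And>u. u \<noteq> v \<Longrightarrow> r u < r v"
proof -
  show "elimination_rank X E r"
    unfolding elimination_rank_def
  proof (intro ballI impI)
    fix u w w'
    assume *: "u \<in> X" "w \<in> X" "w' \<in> X" "{u, w} \<in> E" "{u, w'} \<in> E" "w \<noteq> w'" "r u \<le> r w" "r u \<le> r w'"
    show "{w, w'} \<in> E"
    proof (cases "u \<in> N")
      case True
      then have "w \<in> N" "w' \<in> N"
        using * assms(1) by (auto simp: r_def split: if_splits)
      then show ?thesis
        using * by (simp add: fan_edges_iff)
    next
      case False
      then obtain q where q: "q \<in> Q" "u \<in> C q"
        using * by (auto simp: fan_verts_def)
      then have "w \<in> C q" "w' \<in> C q"
        using * unfolding adjacent_new(2)[OF q False] by blast+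
      then show ?thesis
        using * q by (auto simp: fan_edges_iff)
    qed
  qed
  show "\<And>u. u \<noteq> v \<Longrightarrow> r u < r v"
    by (simp add: r_def)
qed

text \<open>All neighbours of a new vertex lie in its own clique. If D avoids the core part of that
  clique, D must contain one of its new vertices, and these differ from clique to clique.\<close>

lemma card_lower_bound:
  assumes D: "D \<subseteq> X" and dom: "\<And>y. y \<in> X - N - D \<Longrightarrow> \<exists>u\<in>D. {u, y} \<in> E"
    and S: "S \<subseteq> Q" "\<And>q. q \<in> S \<Longrightarrow> D \<inter> N \<inter> C q = {}"
  shows "card (D \<inter> N) + card S \<le> card D"
proof -
  have finD: "finite D"
    using D finite_X finite_subset by blast
  have "\<exists>y\<in>D. y \<in> C q - N" if q: "q \<in> S" for q
  proof -
    obtain y where y: "y \<in> C q" "y \<notin> N"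
      using new_vertex q S by blast
    have "y \<in> X"
      using y q S by (auto simp: fan_verts_def)
    then show ?thesis
      using y q S adjacent_new(1)[of q y] dom[of y] by blast
  qed
  then obtain y where y: "\<And>q. q \<in> S \<Longrightarrow> y q \<in> D \<and> y q \<in> C q - N"
    by metis
  have "inj_on y S"
    using y S disjoint_new by (intro inj_onI) (metis DiffD1 DiffD2 subsetD)
  then have "card S = card (y ` S)"
    by (simp add: card_image)
  also have "\<dots> \<le> card (D - N)"
    using y finD by (intro card_mono) auto
  finally show ?thesis
    using card_Int_Diff[OF finD, of N] by simp
qed

lemma indep_core: "indep E D \<Longrightarrow> u \<in> D \<inter> N \<Longrightarrow> D \<inter> N = {u}"
  by (auto simp: indep_def fan_edges_iff)

text \<open>The set consists of w and one new vertex from each clique that misses w.\<close>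

lemma exists_max_indep:
  assumes w: "w \<in> N"
  shows "\<exists>D. max_indep X E D \<and> D \<inter> N = {w} \<and> card D = 1 + card {q \<in> Q. w \<notin> C q}"
proof -
  have "\<forall>q\<in>Q. \<exists>y. y \<in> C q - N"
    using new_vertex by blast
  then obtain y where y: "\<And>q. q \<in> Q \<Longrightarrow> y q \<in> C q - N"
    by metis
  let ?S = "{q \<in> Q. w \<notin> C q}"
  let ?D = "insert w (y ` ?S)"
  have inj: "inj_on y ?S"
    using y disjoint_new by (intro inj_onI) (metis (lifting) DiffD1 DiffD2 mem_Collect_eq)
  have "w \<notin> y ` ?S"
    using w y by auto
  then have "card ?D = 1 + card ?S"
    using finite_Q by (simp add: card_image[OF inj])
  moreover have "?D \<inter> N = {w}"
    using w y by auto
  moreover have "max_indep X E ?D"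
    unfolding max_indep_def
  proof (intro conjI ballI)
    show "?D \<subseteq> X"
      using w y by (auto simp: fan_verts_def)
    have "{w, y q} \<notin> E" "{y q', y q} \<notin> E" if "q \<in> ?S" "q' \<in> ?S" for q q'
      using that y[of q] y[of q'] adjacent_new(1)[of q "y q"] disjoint_new[of q q' "y q'"] by auto
    then show "indep E ?D"
      unfolding indep_def by (auto simp: insert_commute fan_edges_iff)
    fix x
    assume x: "x \<in> X - ?D"
    show "\<exists>u\<in>?D. {u, x} \<in> E"
    proof (cases "x \<in> N")
      case True
      then show ?thesis
        using w x by (auto simp: fan_edges_iff)
    next
      case False
      then obtain q where q: "q \<in> Q" "x \<in> C q"
        using x by (auto simp: fan_verts_def)
      show ?thesis
      proof (cases "w \<in> C q")
        case True
        then show ?thesis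
          using w False unfolding adjacent_new(1)[OF q False] by (intro bexI[of _ w]) auto
      next
        case False': False
        then have "y q \<in> ?D" "y q \<noteq> x"
          using q x by auto
        then show ?thesis
          using y[OF q(1)] unfolding adjacent_new(1)[OF q False] by (intro bexI[of _ "y q"]) auto
      qed
    qed
  qed
  ultimately show ?thesis
    by blast
qed

end

text \<open>The data of a graph \<open>(X, E)\<close> with a marked vertex \<open>v\<close> that determine what happens when a leaf
  is attached at \<open>v\<close>: the least sizes \<open>\<beta>\<close> and \<open>\<alpha>\<close> of maximal independent sets with and without \<open>v\<close>.\<close>

definition rooted_profile :: "'v set \<Rightarrow> 'v set set \<Rightarrow> 'v \<Rightarrow> nat \<Rightarrow> nat \<Rightarrow> bool" where
  "rooted_profile X E v \<alpha> \<beta> \<longleftrightarrow> finite X \<and> edges_on X E \<and> v \<in> X \<and>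
     (\<exists>r. elimination_rank X E r \<and> (\<forall>u\<in>X. u \<noteq> v \<longrightarrow> r u < r v)) \<and>
     (\<exists>D. max_indep X E D \<and> v \<in> D \<and> card D = \<beta>) \<and> (\<forall>D. max_indep X E D \<longrightarrow> v \<in> D \<longrightarrow> \<beta> \<le> card D) \<and>
     (\<exists>D. max_indep X E D \<and> v \<notin> D \<and> card D = \<alpha>) \<and> (\<forall>D. max_indep (X - {v}) E D \<longrightarrow> \<alpha> \<le> card D)"

section \<open>Attaching a leaf and gluing at leaves\<close>

lemma max_indepI:
  assumes "D \<subseteq> U" "\<And>u w. u \<in> D \<Longrightarrow> w \<in> D \<Longrightarrow> {u, w} \<notin> E"
    and "\<And>w. w \<in> U \<Longrightarrow> w \<notin> D \<Longrightarrow> \<exists>u\<in>D. {u, w} \<in> E"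
  shows "max_indep U E D"
  using assms by (simp add: max_indep_def indep_def)

lemma
  assumes "max_indep U E D"
  shows max_indep_sub: "D \<subseteq> U"
    and max_indep_not_adjacent: "\<And>u w. u \<in> D \<Longrightarrow> w \<in> D \<Longrightarrow> {u, w} \<notin> E"
    and max_indep_dominated: "\<And>w. w \<in> U \<Longrightarrow> w \<notin> D \<Longrightarrow> \<exists>u\<in>D. {u, w} \<in> E"
  using assms by (auto simp: max_indep_def indep_def)

lemma edges_onD: "edges_on X E \<Longrightarrow> {u, w} \<in> E \<Longrightarrow> u \<in> X \<and> w \<in> X \<and> u \<noteq> w"
  unfolding edges_on_def by (metis doubleton_eq_iff)

lemma edges_on_mono: "edges_on X E \<Longrightarrow> X \<subseteq> X' \<Longrightarrow> edges_on X' E"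
  unfolding edges_on_def by (meson subsetD)

lemma edges_on_insert: "edges_on X E \<Longrightarrow> u \<in> X \<Longrightarrow> w \<in> X \<Longrightarrow> u \<noteq> w \<Longrightarrow> edges_on X (insert {u, w} E)"
  unfolding edges_on_def by auto

lemma edges_on_Un: "edges_on X E \<Longrightarrow> edges_on X E' \<Longrightarrow> edges_on X (E \<union> E')"
  unfolding edges_on_def by (meson UnE)

text \<open>A maximal independent set contains exactly one of f and v. With v it is a maximal
  independent set of X; with f the remainder is one of X - v.\<close>

lemma edge_depth_leaf:
  fixes H :: "'v graph"
  assumes prof: "rooted_profile X E v \<alpha> \<beta>" and f: "f \<notin> X"
    and H: "gverts H = insert f X" "gedges H = insert {f, v} E"
  shows "edge_depth TYPE('k::field) H = min \<beta> (Suc \<alpha>)"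
proof -
  obtain r A B where X: "finite X" "edges_on X E" "v \<in> X"
    and r: "elimination_rank X E r" "\<And>u. u \<in> X \<Longrightarrow> u \<noteq> v \<Longrightarrow> r u < r v"
    and B: "max_indep X E B" "v \<in> B" "card B = \<beta>" and \<beta>: "\<And>D. max_indep X E D \<Longrightarrow> v \<in> D \<Longrightarrow> \<beta> \<le> card D"
    and A: "max_indep X E A" "v \<notin> A" "card A = \<alpha>" and \<alpha>: "\<And>D. max_indep (X - {v}) E D \<Longrightarrow> \<alpha> \<le> card D"
    using prof unfolding rooted_profile_def by blast
  let ?V = "insert f X" and ?E = "insert {f, v} E"
  have fv: "f \<noteq> v"
    using f X by blast
  have edge_iff: "{u, w} \<in> ?E \<longleftrightarrow> {u, w} \<in> E \<or> u = f \<and> w = v \<or> u = v \<and> w = f" for u w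
    by (auto simp: doubleton_eq_iff)
  have E_in: "u \<in> X" "w \<in> X" "u \<noteq> w" if "{u, w} \<in> E" for u w
    using edges_onD[OF X(2) that] by auto
  have edges: "edges_on ?V ?E"
    using X fv by (intro edges_on_insert edges_on_mono[OF X(2)]) auto
  \<comment> \<open>Ranking f above v leaves f as the only later neighbour of v, and f has no
    neighbour except v.\<close>
  have rank: "elimination_rank ?V ?E (\<lambda>u. if u = f then Suc (r v) else r u)" (is "elimination_rank _ _ ?r")
    unfolding elimination_rank_def
  proof (intro ballI impI)
    fix u w w'
    assume *: "u \<in> ?V" "w \<in> ?V" "w' \<in> ?V" "{u, w} \<in> ?E" "{u, w'} \<in> ?E" "w \<noteq> w'" "?r u \<le> ?r w" "?r u \<le> ?r w'"
    have uf: "u \<noteq> f"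
    proof
      assume "u = f"
      then have "w = v" "w' = v"
        using * E_in f unfolding edge_iff by auto
      then show False
        using * by blast
    qed
    have "w \<noteq> f \<and> w' \<noteq> f"
    proof (cases "u = v")
      case True
      have "z = f" if "{v, z} \<in> ?E" "?r v \<le> ?r z" for z
        using that E_in[of v z] r(2)[of z] f unfolding edge_iff by (auto split: if_splits)
      then show ?thesis
        using * True by metis
    next
      case False
      then show ?thesis
        using * uf E_in f unfolding edge_iff by blast
    qed
    then have uE: "{u, w} \<in> E" "{u, w'} \<in> E" and in_X: "u \<in> X" "w \<in> X" "w' \<in> X"
      using * uf unfolding edge_iff by blast+
    have "r u \<le> r w" "r u \<le> r w'"
      using *(7,8) in_X f by (auto split: if_splits)
    then have "{w, w'} \<in> E"
      using r(1) uE in_X *(6) unfolding elimination_rank_def by blast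
    then show "{w, w'} \<in> ?E"
      by simp
  qed
  note A' = max_indep_sub[OF A(1)] max_indep_not_adjacent[OF A(1)] max_indep_dominated[OF A(1)]
  note B' = max_indep_sub[OF B(1)] max_indep_not_adjacent[OF B(1)] max_indep_dominated[OF B(1)]
  have mB: "max_indep ?V ?E B"
  proof (rule max_indepI)
    show "{u, w} \<notin> ?E" if "u \<in> B" "w \<in> B" for u w
      using that B'(1,2) f unfolding edge_iff by blast
    show "\<exists>u\<in>B. {u, w} \<in> ?E" if "w \<in> ?V" "w \<notin> B" for w
      using that B'(3)[of w] B(2) unfolding edge_iff by blast
  qed (use B' in blast)
  have mA: "max_indep ?V ?E (insert f A)"
  proof (rule max_indepI)
    show "{u, w} \<notin> ?E" if "u \<in> insert f A" "w \<in> insert f A" for u w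
      using that A'(2)[of u w] A(2) f fv E_in[of u w] unfolding edge_iff by blast
    show "\<exists>u\<in>insert f A. {u, w} \<in> ?E" if "w \<in> ?V" "w \<notin> insert f A" for w
      using that A'(3)[of w] unfolding edge_iff by blast
  qed (use A' in blast)
  have cA: "card (insert f A) = Suc \<alpha>"
    using A X(1) f finite_subset unfolding max_indep_def by (metis card_insert_disjoint subsetD)
  have lower: "min \<beta> (Suc \<alpha>) \<le> card D" if D: "max_indep ?V ?E D" for D
  proof (cases "v \<in> D")
    case True
    then have fD: "f \<notin> D"
      using max_indep_not_adjacent[OF D, of f v] by auto
    have "max_indep X E D"
    proof (rule max_indepI)
      show "{u, w} \<notin> E" if "u \<in> D" "w \<in> D" for u w
        using max_indep_not_adjacent[OF D that] by simp
      show "\<exists>u\<in>D. {u, w} \<in> E" if "w \<in> X" "w \<notin> D" for w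
        using max_indep_dominated[OF D, of w] that fD f unfolding edge_iff by blast
    qed (use max_indep_sub[OF D] fD in blast)
    then show ?thesis
      using \<beta> True by (simp add: min.coboundedI1)
  next
    case False
    have fD: "f \<in> D"
    proof (rule ccontr)
      assume "f \<notin> D"
      then obtain u where "u \<in> D" "{u, f} \<in> ?E"
        using max_indep_dominated[OF D, of f] by blast
      then show False
        using False E_in[of u f] f unfolding edge_iff by blast
    qed
    \<comment> \<open>Since f dominates v, the remainder of D need not dominate v inside X. Hence
      \<alpha> is required to bound the maximal independent sets of X - v as well.\<close>
    have "max_indep (X - {v}) E (D - {f})"
    proof (rule max_indepI)
      show "{u, w} \<notin> E" if "u \<in> D - {f}" "w \<in> D - {f}" for u w
        using max_indep_not_adjacent[OF D, of u w] that by blast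
      show "\<exists>u\<in>D - {f}. {u, w} \<in> E" if w: "w \<in> X - {v}" "w \<notin> D - {f}" for w
      proof -
        have "w \<noteq> f" "w \<notin> D"
          using w f by auto
        then obtain u where "u \<in> D" "{u, w} \<in> ?E"
          using max_indep_dominated[OF D, of w] w by blast
        then show ?thesis
          using w \<open>w \<noteq> f\<close> E_in[of u w] f unfolding edge_iff by blast
      qed
    qed (use max_indep_sub[OF D] False in blast)
    then have "\<alpha> \<le> card (D - {f})"
      by (rule \<alpha>)
    moreover have "finite D"
      using D X(1) finite_subset unfolding max_indep_def by blast
    ultimately show ?thesis
      using fD card_Suc_Diff1[of D f] by linarith
  qed
  show ?thesis
  proof (cases "\<beta> \<le> Suc \<alpha>")
    case True
    then show ?thesis
      using edge_depth_eq[of H _ B, unfolded H, OF _ edges rank mB] X(1) lower B(3) by simp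
  next
    case False
    then show ?thesis
      using edge_depth_eq[of H _ "insert f A", unfolded H, OF _ edges rank mA] X(1) lower cA by simp
  qed
qed

text \<open>If f is in the set, both roots are excluded and each side costs at least its \<alpha>.
  If not, f must be dominated by a root, so at least one side contains its root and costs its
  \<beta>.\<close>

lemma edge_depth_glue:
  fixes H :: "'v graph"
  assumes prof1: "rooted_profile X1 E1 v1 \<alpha>1 \<beta>1" and prof2: "rooted_profile X2 E2 v2 \<alpha>2 \<beta>2"
    and f: "f \<notin> X1" "f \<notin> X2" and disj: "X1 \<inter> X2 = {}" and le: "\<alpha>1 \<le> \<beta>1" "\<alpha>2 \<le> \<beta>2"
    and H: "gverts H = insert f (X1 \<union> X2)" "gedges H = insert {f, v1} (insert {f, v2} (E1 \<union> E2))"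
  shows "edge_depth TYPE('k::field) H = min (Suc (\<alpha>1 + \<alpha>2)) (min (\<beta>1 + \<alpha>2) (\<alpha>1 + \<beta>2))"
proof -
  obtain r1 A1 B1 where X1: "finite X1" "edges_on X1 E1" "v1 \<in> X1"
    and r1: "elimination_rank X1 E1 r1" "\<And>u. u \<in> X1 \<Longrightarrow> u \<noteq> v1 \<Longrightarrow> r1 u < r1 v1"
    and B1: "max_indep X1 E1 B1" "v1 \<in> B1" "card B1 = \<beta>1" and \<beta>1: "\<And>D. max_indep X1 E1 D \<Longrightarrow> v1 \<in> D \<Longrightarrow> \<beta>1 \<le> card D"
    and A1: "max_indep X1 E1 A1" "v1 \<notin> A1" "card A1 = \<alpha>1" and \<alpha>1: "\<And>D. max_indep (X1 - {v1}) E1 D \<Longrightarrow> \<alpha>1 \<le> card D"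
    using prof1 unfolding rooted_profile_def by blast
  obtain r2 A2 B2 where X2: "finite X2" "edges_on X2 E2" "v2 \<in> X2"
    and r2: "elimination_rank X2 E2 r2" "\<And>u. u \<in> X2 \<Longrightarrow> u \<noteq> v2 \<Longrightarrow> r2 u < r2 v2"
    and B2: "max_indep X2 E2 B2" "v2 \<in> B2" "card B2 = \<beta>2" and \<beta>2: "\<And>D. max_indep X2 E2 D \<Longrightarrow> v2 \<in> D \<Longrightarrow> \<beta>2 \<le> card D"
    and A2: "max_indep X2 E2 A2" "v2 \<notin> A2" "card A2 = \<alpha>2" and \<alpha>2: "\<And>D. max_indep (X2 - {v2}) E2 D \<Longrightarrow> \<alpha>2 \<le> card D"
    using prof2 unfolding rooted_profile_def by blast
  let ?V = "insert f (X1 \<union> X2)" and ?E = "insert {f, v1} (insert {f, v2} (E1 \<union> E2))"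
  have fv: "f \<noteq> v1" "f \<noteq> v2"
    using f X1 X2 by auto
  have edge_iff: "{u, w} \<in> ?E \<longleftrightarrow> {u, w} \<in> E1 \<or> {u, w} \<in> E2 \<or> u = f \<and> w = v1 \<or> u = v1 \<and> w = f \<or>
      u = f \<and> w = v2 \<or> u = v2 \<and> w = f" for u w
    by (auto simp: doubleton_eq_iff)
  have E1_in: "u \<in> X1" "w \<in> X1" "u \<noteq> w" if "{u, w} \<in> E1" for u w
    using edges_onD[OF X1(2) that] by auto
  have E2_in: "u \<in> X2" "w \<in> X2" "u \<noteq> w" if "{u, w} \<in> E2" for u w
    using edges_onD[OF X2(2) that] by auto
  have edges: "edges_on ?V ?E"
    using X1 X2 fv by (intro edges_on_insert edges_on_Un edges_on_mono[OF X1(2)] edges_on_mono[OF X2(2)]) auto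
  \<comment> \<open>There are no edges between X1 and X2, so their ranks need not be related; f is
    placed above both roots.\<close>
  define r where "r u = (if u = f then Suc (r1 v1 + r2 v2) else if u \<in> X1 then r1 u else r2 u)" for u
  have edge1: "{u, w} \<in> ?E \<longleftrightarrow> {u, w} \<in> E1 \<or> u = v1 \<and> w = f" if "u \<in> X1" for u w
    using that disj f fv X2(3) E2_in unfolding edge_iff by blast
  have edge2: "{u, w} \<in> ?E \<longleftrightarrow> {u, w} \<in> E2 \<or> u = v2 \<and> w = f" if "u \<in> X2" for u w
    using that disj f fv X1(3) E1_in unfolding edge_iff by blast
  have edgef: "{f, w} \<in> ?E \<longleftrightarrow> w = v1 \<or> w = v2" for w
    using f fv E1_in E2_in unfolding edge_iff by blast
  have rX1: "r u = r1 u" if "u \<in> X1" for u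
    using that f by (auto simp: r_def)
  have rX2: "r u = r2 u" if "u \<in> X2" for u
    using that f disj by (auto simp: r_def)
  have rank: "elimination_rank ?V ?E r"
    unfolding elimination_rank_def
  proof (intro ballI impI)
    fix u w w'
    assume *: "u \<in> ?V" "w \<in> ?V" "w' \<in> ?V" "{u, w} \<in> ?E" "{u, w'} \<in> ?E" "w \<noteq> w'" "r u \<le> r w" "r u \<le> r w'"
    consider "u = f" | "u \<in> X1" | "u \<in> X2"
      using * by blast
    then show "{w, w'} \<in> ?E"
    proof cases
      case 1
      then have "r u > r w"
        using * X1(3) X2(3) rX1[of v1] rX2[of v2] unfolding 1 edgef by (auto simp: r_def)
      then show ?thesis
        using * by simp
    next
      case 2
      \<comment> \<open>The only vertex of X1 adjacent to f is the root v1, which outranks all its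
        neighbours in X1. So two neighbours of rank at least that of u cannot be divided between f
        and X1.\<close>
      have nf: "z \<noteq> f" if "{u, w} \<in> E1 \<or> {u, w'} \<in> E1" "z = w \<or> z = w'" for z
      proof
        assume "z = f"
        then have "u = v1"
          using that * 2 f E1_in unfolding edge1[OF 2] by blast
        moreover have "r1 z' < r1 v1" if "{v1, z'} \<in> E1" for z'
          using E1_in[OF that] r1(2) by blast
        ultimately show False
          using that * 2 rX1 E1_in \<open>z = f\<close> f unfolding edge1[OF 2] by (metis leD)
      qed
      have "{u, w} \<in> E1" "{u, w'} \<in> E1"
        using * nf unfolding edge1[OF 2] by blast+
      moreover have "r1 u \<le> r1 w" "r1 u \<le> r1 w'"
        using * 2 rX1 calculation E1_in by metis+
      ultimately show ?thesis
        using r1(1) * E1_in unfolding elimination_rank_def by (meson UnI1 insertI2)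
    next
      case 3
      have nf: "z \<noteq> f" if "{u, w} \<in> E2 \<or> {u, w'} \<in> E2" "z = w \<or> z = w'" for z
      proof
        assume "z = f"
        then have "u = v2"
          using that * 3 f E2_in unfolding edge2[OF 3] by blast
        moreover have "r2 z' < r2 v2" if "{v2, z'} \<in> E2" for z'
          using E2_in[OF that] r2(2) by blast
        ultimately show False
          using that * 3 rX2 E2_in \<open>z = f\<close> f unfolding edge2[OF 3] by (metis leD)
      qed
      have "{u, w} \<in> E2" "{u, w'} \<in> E2"
        using * nf unfolding edge2[OF 3] by blast+
      moreover have "r2 u \<le> r2 w" "r2 u \<le> r2 w'"
        using * 3 rX2 calculation E2_in by metis+
      ultimately show ?thesis
        using r2(1) * E2_in unfolding elimination_rank_def by (meson UnI2 insertI2)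
    qed
  qed
  have finite_V: "finite ?V"
    using X1 X2 by simp
  have union: "max_indep ?V ?E (D1 \<union> D2)"
    if D1: "max_indep X1 E1 D1" and D2: "max_indep X2 E2 D2" and v12: "v1 \<in> D1 \<or> v2 \<in> D2" for D1 D2
  proof (rule max_indepI)
    note D1' = max_indep_sub[OF D1] max_indep_not_adjacent[OF D1] max_indep_dominated[OF D1]
    note D2' = max_indep_sub[OF D2] max_indep_not_adjacent[OF D2] max_indep_dominated[OF D2]
    show "D1 \<union> D2 \<subseteq> ?V"
      using D1'(1) D2'(1) by blast
    show "{u, w} \<notin> ?E" if uw: "u \<in> D1 \<union> D2" "w \<in> D1 \<union> D2" for u w
    proof -
      have "u \<noteq> f" "w \<noteq> f"
        using uw D1'(1) D2'(1) f by blast+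
      moreover have "{u, w} \<notin> E1"
        using uw E1_in[of u w] D1'(2)[of u w] D2'(1) disj by blast
      moreover have "{u, w} \<notin> E2"
        using uw E2_in[of u w] D2'(2)[of u w] D1'(1) disj by blast
      ultimately show ?thesis
        unfolding edge_iff by blast
    qed
    show "\<exists>u\<in>D1 \<union> D2. {u, w} \<in> ?E" if "w \<in> ?V" "w \<notin> D1 \<union> D2" for w
      using D1'(3)[of w] D2'(3)[of w] that v12 unfolding edge_iff by blast
  qed
  have union_f: "max_indep ?V ?E (insert f (A1 \<union> A2))"
  proof (rule max_indepI)
    note A1' = max_indep_sub[OF A1(1)] max_indep_not_adjacent[OF A1(1)] max_indep_dominated[OF A1(1)]
    note A2' = max_indep_sub[OF A2(1)] max_indep_not_adjacent[OF A2(1)] max_indep_dominated[OF A2(1)]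
    show "insert f (A1 \<union> A2) \<subseteq> ?V"
      using A1'(1) A2'(1) by blast
    show "{u, w} \<notin> ?E" if uw: "u \<in> insert f (A1 \<union> A2)" "w \<in> insert f (A1 \<union> A2)" for u w
    proof -
      have v: "v1 \<notin> insert f (A1 \<union> A2)" "v2 \<notin> insert f (A1 \<union> A2)"
        using A1(2) A2(2) A1'(1) A2'(1) X1(3) X2(3) disj f by blast+
      moreover have "{u, w} \<notin> E1"
        using uw E1_in[of u w] A1'(2)[of u w] A2'(1) disj f by blast
      moreover have "{u, w} \<notin> E2"
        using uw E2_in[of u w] A2'(2)[of u w] A1'(1) disj f by blast
      ultimately show ?thesis
        using uw unfolding edge_iff by metis
    qed
    show "\<exists>u\<in>insert f (A1 \<union> A2). {u, w} \<in> ?E" if "w \<in> ?V" "w \<notin> insert f (A1 \<union> A2)" for w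
      using A1'(3)[of w] A2'(3)[of w] that unfolding edge_iff by blast
  qed
  have card_union: "card (D1 \<union> D2) = card D1 + card D2" "finite (D1 \<union> D2)" "f \<notin> D1 \<union> D2"
    if "D1 \<subseteq> X1" "D2 \<subseteq> X2" for D1 D2
    using that X1(1) X2(1) disj f finite_subset[OF that(1)] finite_subset[OF that(2)]
    by (auto intro!: card_Un_disjoint)
  have sub: "A1 \<subseteq> X1" "A2 \<subseteq> X2" "B1 \<subseteq> X1" "B2 \<subseteq> X2"
    using A1 A2 B1 B2 unfolding max_indep_def by blast+
  have lower: "min (Suc (\<alpha>1 + \<alpha>2)) (min (\<beta>1 + \<alpha>2) (\<alpha>1 + \<beta>2)) \<le> card D" if D: "max_indep ?V ?E D" for D
  proof -
    let ?D1 = "D \<inter> X1" and ?D2 = "D \<inter> X2"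
    note DV = max_indep_sub[OF D] and ind = max_indep_not_adjacent[OF D] and dom = max_indep_dominated[OF D]
    have dom1: "\<exists>u\<in>?D1. {u, w} \<in> E1" if w: "w \<in> X1" "w \<notin> D" "w \<noteq> v1 \<or> f \<notin> D" for w
    proof -
      obtain u where u: "u \<in> D" "{w, u} \<in> ?E"
        using dom[of w] w by (auto simp: insert_commute)
      then have "{w, u} \<in> E1"
        using w unfolding edge1[OF w(1)] by blast
      then show ?thesis
        using u(1) E1_in[of w u] by (auto simp: insert_commute)
    qed
    have dom2: "\<exists>u\<in>?D2. {u, w} \<in> E2" if w: "w \<in> X2" "w \<notin> D" "w \<noteq> v2 \<or> f \<notin> D" for w
    proof -
      obtain u where u: "u \<in> D" "{w, u} \<in> ?E"
        using dom[of w] w by (auto simp: insert_commute)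
      then have "{w, u} \<in> E2"
        using w unfolding edge2[OF w(1)] by blast
      then show ?thesis
        using u(1) E2_in[of w u] by (auto simp: insert_commute)
    qed
    have ind1: "{u, w} \<notin> E1" and ind2: "{u, w} \<notin> E2" if "u \<in> D" "w \<in> D" for u w
      using ind[OF that] by simp_all
    have 1: "\<alpha>1 \<le> card ?D1" if "v1 \<notin> D"
      using that dom1 ind1 by (intro \<alpha>1 max_indepI) auto
    have 2: "\<alpha>2 \<le> card ?D2" if "v2 \<notin> D"
      using that dom2 ind2 by (intro \<alpha>2 max_indepI) auto
    have 3: "\<beta>1 \<le> card ?D1" if "v1 \<in> D" "f \<notin> D"
      using that dom1 ind1 X1(3) by (intro \<beta>1 max_indepI) auto
    have 4: "\<beta>2 \<le> card ?D2" if "v2 \<in> D" "f \<notin> D"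
      using that dom2 ind2 X2(3) by (intro \<beta>2 max_indepI) auto
    note c = card_union[of ?D1 ?D2]
    show ?thesis
    proof (cases "f \<in> D")
      case True
      then have "v1 \<notin> D" "v2 \<notin> D"
        using ind edgef by blast+
      moreover have "D = insert f (?D1 \<union> ?D2)"
        using True DV by blast
      then have "card D = Suc (card (?D1 \<union> ?D2))"
        using c by (metis Int_lower2 card_insert_disjoint)
      ultimately show ?thesis
        using 1 2 c by simp
    next
      case False
      then have "v1 \<in> D \<or> v2 \<in> D"
        using dom[of f] edgef by (auto simp: insert_commute)
      moreover have "D = ?D1 \<union> ?D2"
        using False DV by blast
      then have "card D = card ?D1 + card ?D2"
        using c by simp
      \<comment> \<open>If both roots lie in D the cost is at least \<beta>1 + \<beta>2, and
        \<alpha> \<le> \<beta> on one side reduces this to a set with a single root.\<close>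
      ultimately show ?thesis
        using 1 2 3 4 False le by (cases "v1 \<in> D"; cases "v2 \<in> D") auto
    qed
  qed
  have "\<exists>D. max_indep ?V ?E D \<and> card D = min (Suc (\<alpha>1 + \<alpha>2)) (min (\<beta>1 + \<alpha>2) (\<alpha>1 + \<beta>2))"
  proof -
    have "card (insert f (A1 \<union> A2)) = Suc (\<alpha>1 + \<alpha>2)"
      using card_union[OF sub(1,2)] A1 A2 by simp
    moreover have "card (B1 \<union> A2) = \<beta>1 + \<alpha>2" "card (A1 \<union> B2) = \<alpha>1 + \<beta>2"
      using card_union(1) sub A1 A2 B1 B2 by auto
    ultimately show ?thesis
      using union_f union[OF B1(1) A2(1)] union[OF A1(1) B2(1)] B1(2) B2(2) unfolding min_def by metis
  qed
  then obtain D where D: "max_indep ?V ?E D" "card D = min (Suc (\<alpha>1 + \<alpha>2)) (min (\<beta>1 + \<alpha>2) (\<alpha>1 + \<beta>2))"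
    by blast
  have "edge_depth TYPE('k) H = card D"
    by (rule edge_depth_eq[of H r D, unfolded H, OF finite_V edges rank D(1)]) (use lower D(2) in simp)
  then show ?thesis
    using D(2) by simp
qed

section \<open>Depth of fan graphs and their gluings\<close>

context clique_fan
begin

lemma card_cells_split: "card {q \<in> Q. u \<in> C q} + card {q \<in> Q. u \<notin> C q} = card Q"
  using card_Int_Diff[OF finite_Q, of "{q. u \<in> C q}"] by (simp add: Int_def set_diff_eq)

text \<open>A maximal independent set through v meets the core in v alone, so every clique missing v
  contributes a new vertex; this settles \<beta> and leaves \<alpha> to be found.\<close>

lemma rooted_profileI:
  assumes v: "v \<in> N"
    and A: "\<exists>D. max_indep X E D \<and> v \<notin> D \<and> card D = \<alpha>" "\<And>D. max_indep (X - {v}) E D \<Longrightarrow> \<alpha> \<le> card D"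
  shows "rooted_profile X E v \<alpha> (1 + card {q \<in> Q. v \<notin> C q})"
  unfolding rooted_profile_def
proof (intro conjI)
  show "v \<in> X"
    using v by (simp add: fan_verts_def)
  show "\<exists>r. elimination_rank X E r \<and> (\<forall>u\<in>X. u \<noteq> v \<longrightarrow> r u < r v)"
    using elimination_rank_X[OF v] by blast
  show "\<exists>D. max_indep X E D \<and> v \<in> D \<and> card D = 1 + card {q \<in> Q. v \<notin> C q}"
    using exists_max_indep[OF v] by blast
  show "\<forall>D. max_indep X E D \<longrightarrow> v \<in> D \<longrightarrow> 1 + card {q \<in> Q. v \<notin> C q} \<le> card D"
  proof (intro allI impI)
    fix D
    assume D: "max_indep X E D" "v \<in> D"
    then have DN: "D \<inter> N = {v}"
      using v by (intro indep_core) (auto simp: max_indep_def)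
    have "card (D \<inter> N) + card {q \<in> Q. v \<notin> C q} \<le> card D"
      using max_indep_sub[OF D(1)] max_indep_dominated[OF D(1)] DN by (intro card_lower_bound) auto
    then show "1 + card {q \<in> Q. v \<notin> C q} \<le> card D"
      using DN by simp
  qed
qed (use finite_X edges_on_X A in auto)

text \<open>Among sets avoiding v the best use a core vertex w lying in the largest number \<tau> of
  cliques, at cost 1 + |Q| - \<tau>.\<close>

lemma rooted_profile_core:
  assumes v: "v \<in> N" and w: "w \<in> N" "w \<noteq> v" "card {q \<in> Q. w \<in> C q} = \<tau>"
    and max: "\<And>u. u \<in> N \<Longrightarrow> u \<noteq> v \<Longrightarrow> card {q \<in> Q. u \<in> C q} \<le> \<tau>" and zero: "\<tau> = 0 \<Longrightarrow> Q = {}"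
  shows "rooted_profile X E v (1 + card Q - \<tau>) (1 + card {q \<in> Q. v \<notin> C q})"
proof (rule rooted_profileI[OF v])
  obtain D where D: "max_indep X E D" "D \<inter> N = {w}" "card D = 1 + card {q \<in> Q. w \<notin> C q}"
    using exists_max_indep[OF w(1)] by blast
  have "v \<notin> D" "card D = 1 + card Q - \<tau>"
    using D v w card_cells_split[of w] by auto
  then show "\<exists>D. max_indep X E D \<and> v \<notin> D \<and> card D = 1 + card Q - \<tau>"
    using D by blast
next
  fix D
  assume D: "max_indep (X - {v}) E D"
  have dom: "\<exists>u\<in>D. {u, y} \<in> E" if "y \<in> X - N - D" for y
    using max_indep_dominated[OF D, of y] that v by auto
  have DX: "D \<subseteq> X" "v \<notin> D"
    using max_indep_sub[OF D] by auto
  show "1 + card Q - \<tau> \<le> card D"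
  \<comment> \<open>A set without core vertices needs a new vertex in each of the |Q| cliques, which
    is no cheaper when \<tau> is positive. For \<tau> = 0 there are no cliques, and the bound 1
    holds because D is nonempty.\<close>
  proof (cases "D \<inter> N = {}")
    case True
    have *: "card (D \<inter> N) + card Q \<le> card D"
      using True by (intro card_lower_bound[OF DX(1) dom]) auto
    have "w \<in> X" "w \<notin> D"
      using w True by (auto simp: fan_verts_def)
    then have "D \<noteq> {}"
      using max_indep_dominated[OF D, of w] w by blast
    then have "1 \<le> card D"
      using DX(1) finite_X finite_subset by (simp add: Suc_le_eq card_gt_0_iff)
    then show ?thesis
      using * True zero by (cases "\<tau> = 0") auto
  next
    case False
    then obtain u where u: "u \<in> D" "u \<in> N"
      by blast
    have DN: "D \<inter> N = {u}"
      using D u by (intro indep_core) (auto simp: max_indep_def)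
    have "card (D \<inter> N) + card {q \<in> Q. u \<notin> C q} \<le> card D"
      using DN by (intro card_lower_bound[OF DX(1) dom]) auto
    moreover have "u \<noteq> v"
      using u DX by blast
    ultimately show ?thesis
      using DN max[OF u(2)] card_cells_split[of u] by simp
  qed
qed

text \<open>The degenerate case with no core vertex besides v, met when the leaf itself belongs to
  the complete graph K_n. The whole graph is one clique.\<close>

lemma rooted_profile_single_clique:
  assumes N: "N = {v}" and Q: "Q = {q}" and v: "v \<in> C q"
  shows "rooted_profile X E v 1 1"
proof -
  obtain y where y: "y \<in> C q" "y \<noteq> v"
    using new_vertex[of q] N Q by blast
  have X: "X = C q"
    using N Q v by (auto simp: fan_verts_def)
  have E: "{u, w} \<in> E \<longleftrightarrow> u \<noteq> w \<and> u \<in> C q \<and> w \<in> C q" for u w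
    using N Q v by (auto simp: fan_edges_iff)
  have "rooted_profile X E v 1 (1 + card {q \<in> Q. v \<notin> C q})"
  proof (rule rooted_profileI)
    have "max_indep X E {y}"
      using y E[of y y] by (intro max_indepI) (auto simp: X E)
    then show "\<exists>D. max_indep X E D \<and> v \<notin> D \<and> card D = 1"
      using y by (intro exI[of _ "{y}"]) auto
    fix D
    assume D: "max_indep (X - {v}) E D"
    then have "D \<noteq> {}"
      using max_indep_dominated[OF D, of y] y X by blast
    moreover have "finite D"
      using max_indep_sub[OF D] finite_X finite_subset by blast
    ultimately show "1 \<le> card D"
      by (simp add: Suc_le_eq card_gt_0_iff)
  qed (use N in simp)
  moreover have "{q \<in> Q. v \<notin> C q} = {}"
    using Q v by auto
  ultimately show ?thesis
    by (simp only: card.empty add_0_right)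
qed

end

section \<open>Profiles of fan graphs\<close>

lemma set_take_nth_iff:
  assumes "distinct us" "p < length us" "i \<le> length us"
  shows "us ! p \<in> set (take i us) \<longleftrightarrow> p < i"
  using assms by (auto simp: in_set_conv_nth nth_eq_iff_index_eq)

text \<open>A leaf f is either a vertex of K_n, and then n = 2 and W = {v}, or a new vertex of a
  clique {f, v}, which is the smallest clique of the branch on P 1. The second case is reduced to
  \<open>rooted_profile_core\<close> by omitting that clique.\<close>

lemma fan_rooted_profile:
  fixes H :: "'v graph"
  assumes fan: "is_fan_graph N W k P H" and N2: "card N \<ge> 2" and k: "k \<ge> 1"
    and leaf: "is_leaf H f" and nbr: "{f, v} \<in> gedges H" and v: "v \<in> P 1"
    and T: "T = Max ((\<lambda>j. card (P j)) ` {1..k})"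
    and T': "T' = Max (insert (card (P 1) - 1) ((\<lambda>j. card (P j)) ` {2..k}))"
  obtains X E \<alpha> \<beta> where "rooted_profile X E v \<alpha> \<beta>" "f \<notin> X" "gverts H = insert f X"
    "gedges H = insert {f, v} E" "\<alpha> \<le> \<beta>" "T' = T - 1 \<Longrightarrow> \<alpha> = \<beta>" "T' \<noteq> T - 1 \<Longrightarrow> \<alpha> < \<beta>"
proof -
  note fan' = fan[unfolded is_fan_graph_def]
  note finN = fan'[THEN conjunct1]
  note WN = fan'[THEN conjunct2, THEN conjunct1]
  note W = fan'[THEN conjunct2, THEN conjunct2, THEN conjunct1]
  note disjP = fan'[THEN conjunct2, THEN conjunct2, THEN conjunct2, THEN conjunct1]
  note neP = fan'[THEN conjunct2, THEN conjunct2, THEN conjunct2, THEN conjunct2, THEN conjunct1]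
  obtain us C where us: "\<forall>j\<in>{1..k}. set (us j) = P j \<and> fan_branch N (us j) (C j)"
    and disjC: "disjoint_family_on (\<lambda>j. \<Union>i\<in>{1..length (us j)}. C j i - N) {1..k}"
    and verts: "gverts H = N \<union> (\<Union>j\<in>{1..k}. \<Union>i\<in>{1..length (us j)}. C j i)"
    and edges: "gedges H = clique_edges N \<union> (\<Union>j\<in>{1..k}. \<Union>i\<in>{1..length (us j)}. clique_edges (C j i))"
    using fan'[THEN conjunct2, THEN conjunct2, THEN conjunct2, THEN conjunct2, THEN conjunct2]
    by (elim exE conjE)
  define len where "len j = length (us j)" for j
  \<comment> \<open>Attached cliques are indexed by pairs: the block j and the position i in its
    branch. Thus \<open>card Q\<close> is the size of W.\<close>
  define Q where "Q = Sigma {1..k} (\<lambda>j. {1..len j})"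
  define K where "K = (\<lambda>(j, i). C j i)"
  have dist: "distinct (us j)" and setus: "set (us j) = P j" if "j \<in> {1..k}" for j
    using us that unfolding fan_branch_def by blast+
  have cell: "finite (C j i)" "card (C j i) > i" "N \<inter> C j i = set (take i (us j))" if "(j, i) \<in> Q" for j i
    using us that unfolding fan_branch_def Q_def len_def by auto
  have len: "len j = card (P j)" "len j \<ge> 1" if "j \<in> {1..k}" for j
  proof -
    show "len j = card (P j)"
      using distinct_card[OF dist[OF that]] setus[OF that] by (simp add: len_def)
    moreover have "finite (P j)"
      using setus[OF that] by (metis List.finite_set)
    ultimately show "len j \<ge> 1"
      using neP that by (simp add: Suc_le_eq card_gt_0_iff)
  qed
  have finQ: "finite Q"
    by (simp add: Q_def)
  have gverts: "gverts H = fan_verts N Q K"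
    unfolding verts fan_verts_def by (auto simp: Q_def K_def len_def)
  have gedges: "gedges H = fan_edges N Q K"
    unfolding edges fan_edges_def by (auto simp: Q_def K_def len_def)
  interpret F: clique_fan N Q K
  proof
    show "finite (K q)" "K q - N \<noteq> {}" if "q \<in> Q" for q
    proof -
      obtain j i where q: "q = (j, i)"
        by fastforce
      note c = cell[OF that[unfolded q]]
      show "finite (K q)"
        using c by (simp add: K_def q)
      have "card (set (take i (us j))) \<le> i"
        using card_length[of "take i (us j)"] by simp
      then have "C j i \<noteq> N \<inter> C j i"
        using c by (metis leD)
      then show "K q - N \<noteq> {}"
        by (auto simp: K_def q)
    qed
    show "q = q'" if qq: "q \<in> Q" "q' \<in> Q" "y \<in> K q" "y \<in> K q'" "y \<notin> N" for q q' y
    proof -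
      obtain j i j' i' where q: "q = (j, i)" "q' = (j', i')"
        by fastforce
      have j: "j \<in> {1..k}" "j' \<in> {1..k}" and i: "i \<in> {1..length (us j)}" "i' \<in> {1..length (us j')}"
        using qq(1,2) by (auto simp: q Q_def len_def)
      have y: "y \<in> C j i - N" "y \<in> C j' i' - N"
        using qq(3-5) by (auto simp: q K_def)
      have "j = j'"
        using disjC j i y unfolding disjoint_family_on_def by blast
      moreover have "disjoint_family_on (\<lambda>i. C j i - N) {1..length (us j)}"
        using us j(1) unfolding fan_branch_def by blast
      ultimately have "i = i'"
        using i y unfolding disjoint_family_on_def by blast
      then show ?thesis
        using \<open>j = j'\<close> q by simp
    qed
  qed (use finN finQ in auto)
  have P_sub: "P j \<subseteq> N" if "j \<in> {1..k}" for j
    using that WN W by blast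
  have vN: "v \<in> N"
    using P_sub[of 1] v k by auto
  have edge_iff: "{u, w} \<in> gedges H \<longleftrightarrow> {u, w} \<in> F.E" for u w
    by (simp add: gedges)
  have only: "w = v" if "{f, w} \<in> gedges H" for w
  proof -
    have "card {e \<in> gedges H. f \<in> e} = 1"
      using leaf by (simp add: is_leaf_def vdegree_def)
    then obtain e where e: "{e \<in> gedges H. f \<in> e} = {e}"
      unfolding One_nat_def card_1_singleton_iff ..
    have "{f, w} \<in> {e \<in> gedges H. f \<in> e}" "{f, v} \<in> {e \<in> gedges H. f \<in> e}"
      using that nbr by simp_all
    then have "{f, w} = {f, v}"
      unfolding e by simp
    then show ?thesis
      by (auto simp: doubleton_eq_iff)
  qed
  have fv: "f \<noteq> v"
    using nbr by (simp add: edge_iff fan_edges_iff)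
  \<comment> \<open>The i-th clique contains the first i vertices of the ordering, and list
    positions start at 0; so the vertex at position p lies in the cliques p + 1, ..., len j of its
    block and in no others.\<close>
  have core_cells: "{q \<in> Q. us j ! p \<in> K q} = {j} \<times> {Suc p..len j}" if j: "j \<in> {1..k}" and p: "p < len j" for j p
  proof (intro Set.set_eqI iffI)
    fix q
    assume q: "q \<in> {q \<in> Q. us j ! p \<in> K q}"
    obtain j' i where ji: "q = (j', i)"
      by fastforce
    have j': "j' \<in> {1..k}" and i: "i \<in> {1..len j'}"
      using q by (auto simp: ji Q_def)
    have mem: "us j ! p \<in> set (us j)"
      using p by (simp add: len_def)
    then have "us j ! p \<in> N"
      using setus[OF j] P_sub[OF j] by blast
    then have tk: "us j ! p \<in> set (take i (us j'))"
      using q cell(3)[of j' i] by (auto simp: ji K_def)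
    then have "us j ! p \<in> set (us j')"
      by (rule in_set_takeD)
    then have "j' = j"
      using disjP j j' mem setus unfolding disjoint_family_on_def by (metis disjoint_iff)
    then show "q \<in> {j} \<times> {Suc p..len j}"
      using tk set_take_nth_iff[OF dist[OF j], of p i] i p by (auto simp: ji len_def)
  next
    fix q
    assume "q \<in> {j} \<times> {Suc p..len j}"
    then obtain i where q: "q = (j, i)" "Suc p \<le> i" "i \<le> len j"
      by auto
    then have jiQ: "(j, i) \<in> Q"
      using j by (auto simp: Q_def)
    have "us j ! p \<in> set (take i (us j))"
      using q p set_take_nth_iff[OF dist[OF j], of p i] by (simp add: len_def)
    then show "q \<in> {q \<in> Q. us j ! p \<in> K q}"
      using cell(3)[OF jiQ] jiQ q(1) by (auto simp: K_def)
  qed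
  have no_cells: "{q \<in> Q. w \<in> K q} = {}" if w: "w \<in> N" "w \<notin> W" for w
  proof -
    have False if q: "q \<in> Q" "w \<in> K q" for q
    proof -
      obtain j i where ji: "q = (j, i)"
        by fastforce
      have j: "j \<in> {1..k}"
        using q by (auto simp: ji Q_def)
      have "w \<in> set (us j)"
        using q w cell(3)[of j i] in_set_takeD[of w i "us j"] by (auto simp: ji K_def)
      then show False
        using w j W setus[OF j] by blast
    qed
    then show ?thesis
      by blast
  qed
  have T_ge: "len j \<le> T" if "j \<in> {1..k}" for j
    unfolding T using that len by (intro Max_ge) auto
  have T_attained: "\<exists>j\<in>{1..k}. T = len j"
  proof -
    have "T \<in> (\<lambda>j. card (P j)) ` {1..k}"
      unfolding T using k by (intro Max_in) auto
    then show ?thesis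
      using len by auto
  qed
  have one: "1 \<in> {1..k}"
    using k by simp
  have ge: "x \<le> T'" if "x \<in> insert (card (P 1) - 1) ((\<lambda>j. card (P j)) ` {2..k})" for x
    unfolding T' by (rule Max_ge[OF _ that]) simp
  have T'_ge: "len 1 - 1 \<le> T'" "\<And>j. j \<in> {2..k} \<Longrightarrow> len j \<le> T'"
    using ge len(1)[OF one] len(1) by auto
  have T'_attained: "T' = len 1 - 1 \<or> (\<exists>j\<in>{2..k}. T' = len j)"
  proof -
    have "T' \<in> insert (card (P 1) - 1) ((\<lambda>j. card (P j)) ` {2..k})"
      unfolding T' by (intro Max_in) auto
    then show ?thesis
      using len[OF one] len by auto
  qed
  have rest: "j = 1 \<or> j \<in> {2..k}" if "j \<in> {1..k}" for j
    using that by auto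
  \<comment> \<open>The equation T' = T - 1 holds when P 1 is the unique largest block; in all other
    cases lowering its size does not change the maximum.\<close>
  have T1: "T' = T - 1 \<Longrightarrow> T = len 1" "T' \<noteq> T - 1 \<Longrightarrow> T' = T"
  proof -
    obtain j where j: "j \<in> {1..k}" "T = len j"
      using T_attained by blast
    have "T' \<le> T"
      using T'_attained T_ge[OF one] T_ge by fastforce
    moreover have "T - 1 \<le> T'"
      using j rest[OF j(1)] T'_ge by fastforce
    ultimately show "T' \<noteq> T - 1 \<Longrightarrow> T' = T"
      by linarith
    show "T = len 1" if "T' = T - 1"
      using that j rest[OF j(1)] T'_ge(2)[of j] len(2)[OF j(1)] by fastforce
  qed
  show ?thesis
  proof (cases "f \<in> N")
    case True
    have "N = {f, v}"
    proof -
      have "w = v" if "w \<in> N" "w \<noteq> f" for w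
        using only[of w] that True by (simp add: edge_iff fan_edges_iff)
      then show ?thesis
        using True vN by blast
    qed
    \<comment> \<open>A vertex of W lies in an attached clique and so has a new vertex as neighbour;
      but the only neighbour of the leaf is v, a vertex of K_n.\<close>
    have fW: "f \<notin> W"
    proof
      assume "f \<in> W"
      then obtain j where j: "j \<in> {1..k}" "f \<in> P j"
        using W by blast
      have "f \<in> set (us j)"
        using j(2) setus[OF j(1)] by simp
      then obtain p where p: "p < len j" "f = us j ! p"
        by (auto simp: in_set_conv_nth len_def)
      have "(j, len j) \<in> {q \<in> Q. us j ! p \<in> K q}"
        unfolding core_cells[OF j(1) p(1)] using p by simp
      then have q: "(j, len j) \<in> Q" "f \<in> K (j, len j)"
        using p by auto
      obtain y where y: "y \<in> K (j, len j)" "y \<notin> N"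
        using F.new_vertex[OF q(1)] by blast
      then have "{f, y} \<in> gedges H"
        using F.adjacent_new(1)[OF q(1) y] q True by (auto simp: edge_iff)
      then show False
        using only y vN by blast
    qed
    then have "W \<subseteq> {v}"
      using WN \<open>N = {f, v}\<close> by blast
    then have Pj: "P j = {v}" if "j \<in> {1..k}" for j
      using that neP W by blast
    have "k = 1"
    proof (rule ccontr)
      assume "k \<noteq> 1"
      then have "2 \<in> {1..k}"
        using k by simp
      then show False
        using disjP Pj[of 1] Pj[of 2] one unfolding disjoint_family_on_def by fastforce
    qed
    have len1: "len 1 = 1"
      using len[OF one] Pj[OF one] by simp
    have Q1: "Q = {(1, 1)}"
      using \<open>k = 1\<close> len1 by (auto simp: Q_def)
    have "us 1 = [v]"
      using setus[OF one] Pj[OF one] dist[OF one] len1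
      by (cases "us 1") (auto simp: len_def)
    then have NC: "N \<inter> C 1 1 = {v}"
      using cell(3)[of 1 1] Q1 by simp
    \<comment> \<open>The core {f, v} is replaced by {v}: the core edge becomes the leaf edge, and
      the rest is the single attached clique.\<close>
    interpret G: clique_fan "{v}" Q K
    proof
      show "K q - {v} \<noteq> {}" if "q \<in> Q" for q
        using F.new_vertex[OF that] vN by blast
      show "q = q'" if "q \<in> Q" "q' \<in> Q" for q q'
        using that Q1 by simp
    qed (use F.finite_Q F.finite_C in auto)
    have prof: "rooted_profile G.X G.E v 1 1"
      by (rule G.rooted_profile_single_clique[OF refl Q1]) (use NC in \<open>auto simp: K_def\<close>)
    show ?thesis
    proof (rule that[OF prof])
      show "f \<notin> G.X"
        using NC True fv Q1 by (auto simp: fan_verts_def K_def)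
      show "gverts H = insert f G.X"
        using \<open>N = {f, v}\<close> by (auto simp: gverts fan_verts_def)
      show "gedges H = insert {f, v} G.E"
        using \<open>N = {f, v}\<close> fv by (auto simp: gedges fan_edges_def clique_edges_def insert_commute)
      have "T = 1"
        using T_attained \<open>k = 1\<close> len1 by auto
      moreover have "T' = 0"
        using T'_attained \<open>k = 1\<close> len1 by auto
      ultimately show "T' \<noteq> T - 1 \<Longrightarrow> (1::nat) < 1"
        by simp
    qed auto
  next
    case False
    have "f \<in> gverts H"
      using leaf by (simp add: is_leaf_def)
    then obtain q0 where q0: "q0 \<in> Q" "f \<in> K q0"
      using False by (auto simp: gverts fan_verts_def)
    obtain j0 i0 where ji0: "q0 = (j0, i0)"
      by fastforce
    have j0: "j0 \<in> {1..k}" and i0: "1 \<le> i0" "i0 \<le> len j0"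
      using q0 by (auto simp: ji0 Q_def)
    have "v \<in> K q0"
      using nbr F.adjacent_new(2)[OF q0 False, of v] by (simp add: edge_iff)
    moreover have "w = v" if "w \<in> K q0" "w \<noteq> f" for w
      using only[of w] that F.adjacent_new(2)[OF q0 False, of w] by (simp add: edge_iff)
    ultimately have Kq0: "K q0 = {f, v}"
      using q0 by blast
    have "N \<inter> K q0 = {v}"
      unfolding Kq0 using vN False by auto
    then have tk: "set (take i0 (us j0)) = {v}"
      using cell(3)[of j0 i0] q0 by (simp add: ji0 K_def)
    \<comment> \<open>The clique {f, v} meets N in the first \<open>i0\<close> vertices of an
      ordering, and v is the only one; hence v comes first in its block and lies in all cliques of
      that block.\<close>
    have "i0 = 1"
      using distinct_card[of "take i0 (us j0)"] dist[OF j0] i0 tk by (simp add: len_def)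
    have "us j0 ! 0 \<in> set (take i0 (us j0))"
      using set_take_nth_iff[OF dist[OF j0], of 0 i0] i0 by (cases "us j0 = []") (simp_all add: len_def)
    then have v_eq: "us j0 ! 0 = v"
      using tk by simp
    have "v \<in> P j0"
      using v_eq setus[OF j0] len(2)[OF j0] nth_mem[of 0 "us j0"]
      by (cases "us j0 = []") (simp_all add: len_def)
    then have "j0 = 1"
      using disjP j0 one v unfolding disjoint_family_on_def by blast
    then have q0_eq: "q0 = (1, 1)" and v_eq: "us 1 ! 0 = v"
      using \<open>i0 = 1\<close> v_eq by (simp_all add: ji0)
    \<comment> \<open>Omitting the clique {f, v} removes exactly the vertex f and the edge to v,
      since v stays in the core.\<close>
    define Q' where "Q' = Q - {q0}"
    interpret G: clique_fan N Q' K
      using F.finite_N F.finite_Q F.finite_C F.new_vertex F.disjoint_new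
      by unfold_locales (auto simp: Q'_def)
    have len1: "len 1 \<ge> 1"
      by (rule len(2)[OF one])
    have cells': "{q \<in> Q'. us j ! p \<in> K q} = {j} \<times> {Suc p..len j} - {q0}" if "j \<in> {1..k}" "p < len j" for j p
      using core_cells[OF that] unfolding Q'_def by blast
    have no_cells': "card {q \<in> Q'. w \<in> K q} = 0" if "w \<in> N" "w \<notin> W" for w
    proof -
      have "{q \<in> Q'. w \<in> K q} = {}"
        using no_cells[OF that] unfolding Q'_def by blast
      then show ?thesis
        by (simp only: card.empty)
    qed
    have card_cells: "card {q \<in> Q'. us j ! p \<in> K q} = len j - p" if "j \<in> {1..k}" "p < len j" "us j ! p \<noteq> v" for j p
    proof -
      have "q0 \<notin> {j} \<times> {Suc p..len j}"
        using that v_eq by (cases "p = 0") (auto simp: q0_eq)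
      then show ?thesis
        unfolding cells'[OF that(1,2)] by (simp add: card_cartesian_product)
    qed
    \<comment> \<open>A vertex of P 1 other than v has position at least 1 and so lies in at most |P
      1| - 1 cliques; in another block the full size of the block is possible. This is the origin of
      T'.\<close>
    have bound: "card {q \<in> Q'. u \<in> K q} \<le> T'" if u: "u \<in> N" "u \<noteq> v" for u
    proof (cases "u \<in> W")
      case True
      then obtain j where j: "j \<in> {1..k}" "u \<in> P j"
        using W by blast
      have "u \<in> set (us j)"
        using j(2) setus[OF j(1)] by simp
      then obtain p where p: "p < len j" "u = us j ! p"
        by (auto simp: in_set_conv_nth len_def)
      have card: "card {q \<in> Q'. u \<in> K q} = len j - p"
        using card_cells[OF j(1) p(1)] u p by simp
      show ?thesis
      proof (cases "j = 1")
        case True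
        then have "p \<noteq> 0"
          using p u v_eq by (metis)
        then show ?thesis
          using card True T'_ge(1) by simp
      next
        case False
        then have "len j \<le> T'"
          using rest[OF j(1)] T'_ge(2) by blast
        then show ?thesis
          using card by simp
      qed
    qed (use no_cells' u in simp)
    \<comment> \<open>The bound is attained by the first vertex of another block or by the second
      vertex of P 1.\<close>
    have witness: "\<exists>w\<in>N. w \<noteq> v \<and> card {q \<in> Q'. w \<in> K q} = T'"
    proof -
      have nth: "us j ! p \<in> N" "us j ! p \<in> P j" if "j \<in> {1..k}" "p < len j" for j p
        using that setus[OF that(1)] P_sub[OF that(1)] nth_mem[of p "us j"] by (auto simp: len_def)
      consider j where "j \<in> {2..k}" "T' = len j" | "T' = len 1 - 1" "2 \<le> len 1" | "T' = len 1 - 1" "len 1 = 1"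
        using T'_attained len1 by (metis One_nat_def Suc_1 le_antisym not_less_eq_eq)
      then show ?thesis
      proof cases
        case 1
        then have j: "j \<in> {1..k}" "0 < len j" "j \<noteq> 1"
          using len(2)[of j] by auto
        have "us j ! 0 \<noteq> v"
          using nth(2)[OF j(1,2)] disjP j one v unfolding disjoint_family_on_def by blast
        then show ?thesis
          using card_cells[OF j(1,2)] nth(1)[OF j(1,2)] 1 by auto
      next
        case 2
        then have p: "1 < len 1"
          by simp
        have "us 1 ! 1 \<noteq> v"
          using p dist[OF one] v_eq nth_eq_iff_index_eq[of "us 1" 1 0]
          by (cases "us 1 = []") (auto simp: len_def)
        then show ?thesis
          using card_cells[OF one p] nth(1)[OF one p] 2 by auto
      next
        \<comment> \<open>Now W = {v}, and neither choice exists; n \<ge> 2 provides a core vertex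
          outside W, which lies in no attached clique.\<close>
        case 3
        then have "T' = 0"
          by simp
        have "k = 1"
        proof (rule ccontr)
          assume "k \<noteq> 1"
          then have "2 \<in> {1..k}" "2 \<in> {2..k}"
            using k by auto
          then show False
            using T'_ge(2)[of 2] len(2)[of 2] \<open>T' = 0\<close> by simp
        qed
        have "card (P 1) = 1"
          using 3 len[OF one] by simp
        then have "W = {v}"
          using W \<open>k = 1\<close> v by (auto simp: card_1_singleton_iff)
        obtain w where "w \<in> N" "w \<noteq> v"
          using N2 card_le_Suc0_iff_eq[OF finN] vN by (metis One_nat_def Suc_1 not_less_eq_eq)
        then show ?thesis
          using no_cells'[of w] \<open>W = {v}\<close> \<open>T' = 0\<close> by auto
      qed
    qed
    then obtain w where w: "w \<in> N" "w \<noteq> v" "card {q \<in> Q'. w \<in> K q} = T'"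
      by blast
    have zero: "Q' = {}" if "T' = 0"
    proof -
      have "q = q0" if q: "q \<in> Q" for q
      proof -
        obtain j i where ji: "q = (j, i)"
          by fastforce
        have j: "j \<in> {1..k}" and i: "1 \<le> i" "i \<le> len j"
          using q by (auto simp: ji Q_def)
        have "j = 1"
          using rest[OF j] T'_ge(2)[of j] len(2)[OF j] \<open>T' = 0\<close> by auto
        then show ?thesis
          using i T'_ge(1) \<open>T' = 0\<close> by (auto simp: ji q0_eq)
      qed
      then show ?thesis
        by (auto simp: Q'_def)
    qed
    have prof: "rooted_profile G.X G.E v (1 + card Q' - T') (1 + card {q \<in> Q'. v \<notin> K q})"
      by (rule G.rooted_profile_core[OF vN w bound zero])
    have cardQ: "card Q = Suc (card Q')"
      unfolding Q'_def by (rule card_Suc_Diff1[OF finQ q0(1), symmetric])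
    have cells_v: "{q \<in> Q. v \<in> K q} = {1} \<times> {1..len 1}"
      using core_cells[OF one, of 0, unfolded v_eq] len1 by simp
    have "{q \<in> Q'. v \<notin> K q} = {q \<in> Q. v \<notin> K q}"
      using Kq0 by (auto simp: Q'_def)
    then have \<beta>: "card {q \<in> Q'. v \<notin> K q} + len 1 = Suc (card Q')"
      using F.card_cells_split[of v] cardQ by (simp add: cells_v card_cartesian_product)
    have T'Q: "T' \<le> card Q'"
      unfolding w(3)[symmetric] using G.finite_Q by (intro card_mono) auto
    \<comment> \<open>By the preceding count \<beta> - \<alpha> = T' - (len 1 - 1). If T' = T - 1
      then T = len 1 and this is zero; otherwise T' = T is at least len 1 and it is
      positive.\<close>
    have eq: "1 + card Q' - T' = 1 + card {q \<in> Q'. v \<notin> K q}" if "T' = T - 1"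
      using T1(1)[OF that] that \<beta> len1 T'Q by simp
    have lt: "1 + card Q' - T' < 1 + card {q \<in> Q'. v \<notin> K q}" if "T' \<noteq> T - 1"
      using T1(2)[OF that] T_ge[OF one] \<beta> T'Q by simp
    have le: "1 + card Q' - T' \<le> 1 + card {q \<in> Q'. v \<notin> K q}"
      using eq lt by (cases "T' = T - 1") auto
    show ?thesis
    proof (rule that[OF prof])
      show "f \<notin> G.X"
        using False F.disjoint_new[OF q0(1) _ q0(2)] by (auto simp: fan_verts_def Q'_def)
      show "gverts H = insert f G.X"
        using q0 Kq0 vN by (auto simp: gverts fan_verts_def Q'_def)
      have "clique_edges (K q0) = {{f, v}}"
        using fv by (auto simp: Kq0 clique_edges_def insert_commute)
      then show "gedges H = insert {f, v} G.E"
        using q0 by (auto simp: gedges fan_edges_def Q'_def)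
    qed (use eq lt le in auto)
  qed
qed

theorem theorem3p9:
  fixes G :: "nat \<Rightarrow> 'v graph"
    and N :: "nat \<Rightarrow> 'v set"
    and W :: "nat \<Rightarrow> 'v set"
    and P :: "nat \<Rightarrow> nat \<Rightarrow> 'v set"
    and n k T T' :: "nat \<Rightarrow> nat"
    and f v :: "nat \<Rightarrow> 'v"
    and s t :: nat
  assumes fan: "\<And>i. i \<in> {1, 2} \<Longrightarrow> is_fan_graph (N i) (W i) (k i) (P i) (G i)"
    and card_N: "\<And>i. i \<in> {1, 2} \<Longrightarrow> card (N i) = n i"
    and n: "\<And>i. i \<in> {1, 2} \<Longrightarrow> n i \<ge> 2"
    and k: "\<And>i. i \<in> {1, 2} \<Longrightarrow> k i \<ge> 1"
    and disjoint: "gverts (G 1) \<inter> gverts (G 2) = {}"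
    and leaf: "\<And>i. i \<in> {1, 2} \<Longrightarrow> is_leaf (G i) (f i)"
    and neighbor: "\<And>i. i \<in> {1, 2} \<Longrightarrow> {f i, v i} \<in> gedges (G i)"
    and degree: "\<And>i. i \<in> {1, 2} \<Longrightarrow> vdegree (G i) (v i) \<ge> 2"
    and index: "\<And>i. i \<in> {1, 2} \<Longrightarrow> v i \<in> P i 1"
    and T: "\<And>i. i \<in> {1, 2} \<Longrightarrow> T i = Max ((\<lambda>j. card (P i j)) ` {1..k i})"
    and T': "\<And>i. i \<in> {1, 2} \<Longrightarrow>
      T' i = Max (insert (card (P i 1) - 1) ((\<lambda>j. card (P i j)) ` {2..k i}))"
    and t: "t = card {i \<in> {1, 2}. T' i \<noteq> T i - 1}"
    and s: "s = (if t = 0 then 0 else 1)"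
  shows "int (edge_depth TYPE('k::field) (star_op (G 1) (f 1) (G 2) (f 2))) =
    int (edge_depth TYPE('k) (G 1)) + int (edge_depth TYPE('k) (G 2)) - int s"
proof -
  have prof: "\<exists>X E \<alpha> \<beta>. rooted_profile X E (v i) \<alpha> \<beta> \<and> f i \<notin> X \<and> gverts (G i) = insert (f i) X \<and>
      gedges (G i) = insert {f i, v i} E \<and> \<alpha> \<le> \<beta> \<and> (T' i = T i - 1 \<longrightarrow> \<alpha> = \<beta>) \<and> (T' i \<noteq> T i - 1 \<longrightarrow> \<alpha> < \<beta>)"
    if i: "i \<in> {1, 2}" for i
    using fan_rooted_profile[OF fan[OF i] _ k[OF i] leaf[OF i] neighbor[OF i] index[OF i] T[OF i] T'[OF i]]
      n[OF i] card_N[OF i] by metis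
  obtain X1 E1 \<alpha>1 \<beta>1 where 1: "rooted_profile X1 E1 (v 1) \<alpha>1 \<beta>1" "f 1 \<notin> X1" "gverts (G 1) = insert (f 1) X1"
    "gedges (G 1) = insert {f 1, v 1} E1" "\<alpha>1 \<le> \<beta>1" "T' 1 = T 1 - 1 \<longrightarrow> \<alpha>1 = \<beta>1" "T' 1 \<noteq> T 1 - 1 \<longrightarrow> \<alpha>1 < \<beta>1"
    using prof[of 1] by auto
  obtain X2 E2 \<alpha>2 \<beta>2 where 2: "rooted_profile X2 E2 (v 2) \<alpha>2 \<beta>2" "f 2 \<notin> X2" "gverts (G 2) = insert (f 2) X2"
    "gedges (G 2) = insert {f 2, v 2} E2" "\<alpha>2 \<le> \<beta>2" "T' 2 = T 2 - 1 \<longrightarrow> \<alpha>2 = \<beta>2" "T' 2 \<noteq> T 2 - 1 \<longrightarrow> \<alpha>2 < \<beta>2"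
    using prof[of 2] by auto
  define \<phi> where "\<phi> = (\<lambda>x. if x = f 2 then f 1 else x)"
  \<comment> \<open>The identification moves only \<open>f 2\<close>, which occurs in the second
    graph outside \<open>X2\<close> and in its leaf edge alone; everything on \<open>X2\<close> is
    unchanged.\<close>
  have id: "\<phi> ` Y = Y" if "Y \<subseteq> X2" for Y
  proof -
    have "\<phi> ` Y = (\<lambda>x. x) ` Y"
      using that 2(2) by (intro image_cong refl) (auto simp: \<phi>_def)
    then show ?thesis
      by simp
  qed
  have E2: "(`) \<phi> ` E2 = E2"
  proof -
    have "edges_on X2 E2"
      using 2(1) by (simp add: rooted_profile_def)
    then have "e \<subseteq> X2" if "e \<in> E2" for e
      using that unfolding edges_on_def by fastforce
    then have "(`) \<phi> ` E2 = (\<lambda>e. e) ` E2"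
      by (intro image_cong refl id)
    then show ?thesis
      by simp
  qed
  have "v 2 \<in> X2"
    using 2(1) by (simp add: rooted_profile_def)
  then have \<phi>: "\<phi> (f 2) = f 1" "\<phi> (v 2) = v 2"
    using 2(2) by (auto simp: \<phi>_def)
  have star: "gverts (star_op (G 1) (f 1) (G 2) (f 2)) = insert (f 1) (X1 \<union> X2)"
    "gedges (star_op (G 1) (f 1) (G 2) (f 2)) = insert {f 1, v 1} (insert {f 1, v 2} (E1 \<union> E2))"
    unfolding star_op_def Let_def \<phi>_def[symmetric] 1(3,4) 2(3,4) by (auto simp: \<phi> E2 id)
  have disj: "X1 \<inter> X2 = {}" "f 1 \<notin> X2"
    using disjoint 1(3) 2(3) by auto
  have G1: "edge_depth TYPE('k) (G 1) = min \<beta>1 (Suc \<alpha>1)"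
    by (rule edge_depth_leaf[OF 1(1-4)])
  have G2: "edge_depth TYPE('k) (G 2) = min \<beta>2 (Suc \<alpha>2)"
    by (rule edge_depth_leaf[OF 2(1-4)])
  have G12: "edge_depth TYPE('k) (star_op (G 1) (f 1) (G 2) (f 2)) =
      min (Suc (\<alpha>1 + \<alpha>2)) (min (\<beta>1 + \<alpha>2) (\<alpha>1 + \<beta>2))"
    by (rule edge_depth_glue[OF 1(1) 2(1) 1(2) disj(2,1) 1(5) 2(5) star])
  have s_eq: "s = (if T' 1 = T 1 - 1 \<and> T' 2 = T 2 - 1 then 0 else 1)"
    unfolding s t by auto
  \<comment> \<open>Each depth is \<alpha> plus 1 if \<alpha> < \<beta>, and the glued depth is
    \<alpha>1 + \<alpha>2 plus 1 if both inequalities are strict. The difference is therefore 1 as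
    soon as one of them is strict, and 0 otherwise.\<close>
  show ?thesis
    unfolding G1 G2 G12 s_eq using 1(5-7) 2(5-7) by (auto simp: min_def)
qed

end
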